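(* Let $S=\mathbb{Z}$ be equipped with the metric $d(x,y)=|x-y|$ and assume that $\mathscr{L}$ is the generator of an interacting particle system on $\Omega=\{0,\dots,q-1\}^{\mathbb{Z}}$ satisfying conditions (L1), (R1), (R2) and (R3) listed in the context with $\varrho(r)=\exp(-\alpha r)$ for some $\alpha>0$. Let $(S(t))_{t\ge0}$ be the associated Markov semigroup. Then $$\mathscr{A}=\mathscr{O}=\mathscr{S}.$$ In particular, such systems exhibit neither weak nor strong time-translation symmetry breaking, and $|\mathscr{S}|=1$ implies that the interacting particle system is ergodic.
   Context: Let $q\in\mathbb{N}$, and equip $\Omega=\{0,\dots,q-1\}^{S}$ ($S=\mathbb{Z}$) with the product topology and Borel $\sigma$-algebra; $\Omega_\Delta=\{0,\dots,q-1\}^\Delta$, $C(\Omega)$ is the space of continuous functions $\Omega\to\mathbb{R}$, and $\mathcal{M}_1(\Omega)$ the set of Borel probability measures on $\Omega$. For $\xi_\Delta\in\Omega_\Delta$, $\xi_\Delta\eta_{\Delta^c}$ is the configuration equal to $\xi_\Delta$ on $\Delta$ and to $\eta$ off $\Delta$. The oscillation of $f$ at $x\in S$ is $\delta_x(f)=\sup\{|f(\eta)-f(\xi)|\colon \eta=\xi\text{ off }x\}$; $D(\Omega)=\{f\in C(\Omega)\colon\sum_{x\in S}\delta_x(f)<\infty\}$. Rates: for each finite $\Delta\subset S$ and $\xi_\Delta\in\Omega_\Delta$ let $c_\Delta(\cdot,\xi_\Delta)\colon\Omega\to[0,\infty)$ be continuous (no translation invariance or reversibility is assumed). The generator is $$\mathscr{L}f(\eta)=\sum_{\Delta\subset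 S\text{ finite}}\ \sum_{\xi_\Delta\in\Omega_\Delta}c_\Delta(\eta,\xi_\Delta)\,[f(\xi_\Delta\eta_{\Delta^c})-f(\eta)],\quad f\in D(\Omega).$$ For $x\ne y$ put $\gamma(x,y)=\sum_{\Delta\ni x}\sum_{\xi_\Delta\in\Omega_\Delta}\delta_y(c_\Delta(\cdot,\xi_\Delta))$, and $\gamma(x,x)=0$. Conditions, for a function $\varrho\colon[0,\infty)\to(0,\infty)$ and a constant $L>0$: (L1) $\mathbf{C}_1:=\sup_{x\in S}\sum_{\Delta\ni x}\sum_{\xi_\Delta}\|c_\Delta(\cdot,\xi_\Delta)\|_\infty<\infty$. (R1) $c_\Delta\equiv0$ whenever $\mathrm{diam}(\Delta)\ge L$. (R2) There is $\mathbf{C}_\varrho\in(0,\infty)$ with $\varrho(d(x,z))\varrho(d(z,y))\le\mathbf{C}_\varrho\,\varrho(d(x,y))$ for all $x,y,z\in S$ (automatic for $\varrho(r)=e^{-\alpha r}$). (R3) $\mathbf{C}_\gamma:=\sup_{x\in S}\sum_{y\in S}\frac{\gamma(x,y)}{\varrho(d(x,y))}<\infty$. Under (L1) and (R3) (which gives $\sup_x\sum_{y\neq x}\gamma(x,y)<\infty$), $\mathscr{L}$ with core $D(\Omega)$ generates a unique Markov (Feller) semigroup $(S(t))_{t\ge0}$ on $C(\Omega)$; $\nu S(t)$ denotes the law with $\nu S(t)(f)=\nu(S(t)f)$. Definitions: $\mathscr{S}=\{\nu\in\mathcal{M}_1(\Omega)\colon\nu S(t)=\nu\ \forall t\ge0\}$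 (stationary measures); $\mathscr{O}=\{\nu\in\mathcal{M}_1(\Omega)\colon\exists t>0\text{ with }\nu S(t)=\nu\}$; $\mathscr{A}=\{\nu\in\mathcal{M}_1(\Omega)\colon\exists\nu_0\in\mathcal{M}_1(\Omega)\text{ and }t_n\uparrow\infty\text{ with }\nu_0S(t_n)\to\nu\text{ weakly}\}$ (attractor). Strong time-translation symmetry breaking means $\mathscr{S}\subsetneq\mathscr{O}$; weak time-translation symmetry breaking means $\mathscr{S}\subsetneq\mathscr{A}$. The system is ergodic if it has a unique stationary measure $\nu$ and $\nu_0S(t)\to\nu$ weakly as $t\to\infty$ for every $\nu_0\in\mathcal{M}_1(\Omega)$. *)

theory Defs
  imports "HOL-Probability.Probability"
begin

text \<open>
  The single-site space \<open>{0, \<dots>, q - 1}\<close> with \<open>q = CARD('q)\<close>, carrying the discrete topology.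
\<close>

typedef ('q::finite) spin = "{..<CARD('q)}"
  by (rule exI[of _ 0]) simp

instance spin :: (finite) finite
proof
  have "(UNIV :: 'a spin set) = Abs_spin ` {..<CARD('a)}"
    by (rule type_definition.Abs_image[OF type_definition_spin, symmetric])
  then show "finite (UNIV :: 'a spin set)"
    by (metis finite_imageI finite_lessThan)
qed

instantiation spin :: (finite) discrete_topology
begin

definition open_spin :: "'a spin set \<Rightarrow> bool" where
  "open_spin A \<longleftrightarrow> True"

instance
  by standard (simp_all add: open_spin_def)

end

instance spin :: (finite) second_countable_topology
proof
  have "open = generate_topology (UNIV :: 'a spin set set)"
    by (auto simp: fun_eq_iff open_spin_def intro: generate_topology.Basis)
  then show "\<exists>B :: 'a spin set set. countable B \<and> open = generate_topology B"
    using countable_finite[OF finite] by blast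
qed

type_synonym 'q config = "int \<Rightarrow> 'q spin"

text \<open>
  \<open>\<Omega>\<close> is the whole type \<^typ>\<open>'q config\<close> with the library's product topology, and \<open>C(\<Omega>)\<close> with the
  supremum norm is the type \<open>'q config \<Rightarrow>\<^sub>C real\<close>, since \<open>\<Omega>\<close> is compact.
  Elements of \<open>\<Omega>\<^bsub>\<Delta>\<^esub>\<close> are represented by functions that are \<^const>\<open>undefined\<close> off \<open>\<Delta>\<close>.
\<close>

definition local_configs :: "int set \<Rightarrow> 'q::finite config set" where
  "local_configs \<Delta> = (\<Pi>\<^sub>E x\<in>\<Delta>. UNIV)"

text \<open>\<open>override_on \<eta> \<xi> \<Delta>\<close> below is the configuration equal to \<open>\<xi>\<close> on \<open>\<Delta>\<close> and to \<open>\<eta>\<close> off \<open>\<Delta>\<close>.\<close>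

definition site_dist :: "int \<Rightarrow> int \<Rightarrow> real" where
  "site_dist x y = real_of_int \<bar>x - y\<bar>"

definition prob_measures :: "'q::finite config measure set" where
  "prob_measures = {\<nu>. prob_space \<nu> \<and> sets \<nu> = sets borel}"

text \<open>
  Suprema and series of nonnegative terms that may be infinite are taken in \<^typ>\<open>ennreal\<close>.
\<close>

definition oscillation :: "int \<Rightarrow> ('q::finite config \<Rightarrow> real) \<Rightarrow> ennreal" where
  "oscillation x f =
     (SUP (\<eta>, \<xi>) \<in> {(\<eta>, \<xi>). \<forall>z. z \<noteq> x \<longrightarrow> \<eta> z = \<xi> z}. ennreal \<bar>f \<eta> - f \<xi>\<bar>)"

definition sup_norm :: "('q::finite config \<Rightarrow> real) \<Rightarrow> ennreal" where
  "sup_norm f = (SUP \<eta>. ennreal \<bar>f \<eta>\<bar>)"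

definition smooth_functions :: "('q::finite config \<Rightarrow>\<^sub>C real) set" where
  "smooth_functions = {f. (\<Sum>\<^sub>\<infinity>x. oscillation x (apply_bcontfun f)) < \<infinity>}"

text \<open>The rate \<open>c\<^bsub>\<Delta>\<^esub>(\<eta>, \<xi>\<^bsub>\<Delta>\<^esub>)\<close> is written \<open>c \<Delta> \<eta> \<xi>\<close>; only finite \<open>\<Delta>\<close> and \<open>\<xi> \<in> \<Omega>\<^bsub>\<Delta>\<^esub>\<close> matter.\<close>

type_synonym 'q rates = "int set \<Rightarrow> 'q config \<Rightarrow> 'q config \<Rightarrow> real"

definition admissible_rates :: "'q::finite rates \<Rightarrow> bool" where
  "admissible_rates c \<longleftrightarrow>
     (\<forall>\<Delta>. finite \<Delta> \<longrightarrow> (\<forall>\<xi>\<in>local_configs \<Delta>.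
        continuous_on UNIV (\<lambda>\<eta>. c \<Delta> \<eta> \<xi>) \<and> (\<forall>\<eta>. 0 \<le> c \<Delta> \<eta> \<xi>)))"

definition influence :: "'q::finite rates \<Rightarrow> int \<Rightarrow> int \<Rightarrow> ennreal" where
  "influence c x y =
     (if x = y then 0
      else (\<Sum>\<^sub>\<infinity>\<Delta>\<in>{\<Delta>. finite \<Delta> \<and> x \<in> \<Delta>}. \<Sum>\<xi>\<in>local_configs \<Delta>. oscillation y (\<lambda>\<eta>. c \<Delta> \<eta> \<xi>)))"

definition condition_L1 :: "'q::finite rates \<Rightarrow> bool" where
  "condition_L1 c \<longleftrightarrow>
     (SUP x. \<Sum>\<^sub>\<infinity>\<Delta>\<in>{\<Delta>. finite \<Delta> \<and> x \<in> \<Delta>}. \<Sum>\<xi>\<in>local_configs \<Delta>. sup_norm (\<lambda>\<eta>. c \<Delta> \<eta> \<xi>)) < \<infinity>"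

text \<open>
  \<^typ>\<open>int\<close> has no metric in the library; the diameter is that of the isometric image in the reals.
\<close>

definition condition_R1 :: "real \<Rightarrow> 'q::finite rates \<Rightarrow> bool" where
  "condition_R1 L c \<longleftrightarrow>
     (\<forall>\<Delta>. finite \<Delta> \<and> L \<le> diameter (real_of_int ` \<Delta>) \<longrightarrow> (\<forall>\<xi>\<in>local_configs \<Delta>. \<forall>\<eta>. c \<Delta> \<eta> \<xi> = 0))"

definition condition_R2 :: "(real \<Rightarrow> real) \<Rightarrow> bool" where
  "condition_R2 \<rho> \<longleftrightarrow>
     (\<exists>C>0. \<forall>x y z :: int. \<rho> (site_dist x z) * \<rho> (site_dist z y) \<le> C * \<rho> (site_dist x y))"

definition condition_R3 :: "(real \<Rightarrow> real) \<Rightarrow> 'q::finite rates \<Rightarrow> bool" where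
  "condition_R3 \<rho> c \<longleftrightarrow>
     (SUP x. \<Sum>\<^sub>\<infinity>y. influence c x y / ennreal (\<rho> (site_dist x y))) < \<infinity>"

definition formal_generator :: "'q::finite rates \<Rightarrow> ('q config \<Rightarrow> real) \<Rightarrow> 'q config \<Rightarrow> real" where
  "formal_generator c f \<eta> =
     (\<Sum>\<^sub>\<infinity>\<Delta>\<in>{\<Delta>. finite \<Delta>}. \<Sum>\<xi>\<in>local_configs \<Delta>. c \<Delta> \<eta> \<xi> * (f (override_on \<eta> \<xi> \<Delta>) - f \<eta>))"

text \<open>
  The graph of the operator with domain \<open>D(\<Omega>)\<close>. Under (L1) the series converges uniformly in \<open>\<eta>\<close>
  for every \<open>f\<close> in \<open>D(\<Omega>)\<close>, so its sum is a continuous function and no \<open>f\<close> is lost here.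
\<close>

definition generator_graph ::
    "'q::finite rates \<Rightarrow> (('q config \<Rightarrow>\<^sub>C real) \<times> ('q config \<Rightarrow>\<^sub>C real)) set" where
  "generator_graph c =
     {(f, g). f \<in> smooth_functions \<and> apply_bcontfun g = formal_generator c (apply_bcontfun f)}"

type_synonym 'q semigroup = "real \<Rightarrow> ('q config \<Rightarrow>\<^sub>C real) \<Rightarrow> ('q config \<Rightarrow>\<^sub>C real)"

definition markov_semigroup :: "'q::finite semigroup \<Rightarrow> bool" where
  "markov_semigroup S \<longleftrightarrow>
     (\<forall>t\<ge>0. linear (S t)) \<and>
     (\<forall>f. S 0 f = f) \<and>
     (\<forall>s\<ge>0. \<forall>t\<ge>0. \<forall>f. S (s + t) f = S s (S t f)) \<and>
     (\<forall>f. \<forall>t\<ge>0. continuous (at_right t) (\<lambda>s. S s f)) \<and>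
     (\<forall>t\<ge>0. S t (const_bcontfun 1) = const_bcontfun 1) \<and>
     (\<forall>t\<ge>0. \<forall>f. (\<forall>\<eta>. 0 \<le> apply_bcontfun f \<eta>) \<longrightarrow> (\<forall>\<eta>. 0 \<le> apply_bcontfun (S t f) \<eta>))"

definition infinitesimal_generator ::
    "'q::finite semigroup \<Rightarrow> (('q config \<Rightarrow>\<^sub>C real) \<times> ('q config \<Rightarrow>\<^sub>C real)) set" where
  "infinitesimal_generator S =
     {(f, g). ((\<lambda>t. (S t f - f) /\<^sub>R t) \<longlongrightarrow> g) (at_right 0)}"

text \<open>
  \<open>S\<close> is the Markov semigroup generated by the rates \<open>c\<close> with core \<open>D(\<Omega>)\<close>: its infinitesimal
  generator is the closure of the operator above, in the sup-norm topology on graphs.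
\<close>

definition generates :: "'q::finite rates \<Rightarrow> 'q semigroup \<Rightarrow> bool" where
  "generates c S \<longleftrightarrow>
     markov_semigroup S \<and> infinitesimal_generator S = closure (generator_graph c)"

text \<open>
  The law \<open>\<nu>S(t)\<close>. For a Markov semigroup it exists and is unique by the Riesz representation theorem.
\<close>

definition evolve :: "'q::finite semigroup \<Rightarrow> real \<Rightarrow> 'q config measure \<Rightarrow> 'q config measure" where
  "evolve S t \<nu> =
     (THE \<mu>. \<mu> \<in> prob_measures \<and>
        (\<forall>f. (\<integral>\<eta>. apply_bcontfun f \<eta> \<partial>\<mu>) = (\<integral>\<eta>. apply_bcontfun (S t f) \<eta> \<partial>\<nu>)))"

definition weakly_converges ::
    "('i \<Rightarrow> 'q::finite config measure) \<Rightarrow> 'q config measure \<Rightarrow> 'i filter \<Rightarrow> bool" where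
  "weakly_converges \<mu> \<nu> F \<longleftrightarrow>
     (\<forall>f :: 'q config \<Rightarrow>\<^sub>C real.
        ((\<lambda>i. \<integral>\<eta>. apply_bcontfun f \<eta> \<partial>\<mu> i) \<longlongrightarrow> (\<integral>\<eta>. apply_bcontfun f \<eta> \<partial>\<nu>)) F)"

definition stationary_measures :: "'q::finite semigroup \<Rightarrow> 'q config measure set" where
  "stationary_measures S = {\<nu> \<in> prob_measures. \<forall>t\<ge>0. evolve S t \<nu> = \<nu>}"

definition periodic_measures :: "'q::finite semigroup \<Rightarrow> 'q config measure set" where
  "periodic_measures S = {\<nu> \<in> prob_measures. \<exists>t>0. evolve S t \<nu> = \<nu>}"

definition attractor :: "'q::finite semigroup \<Rightarrow> 'q config measure set" where
  "attractor S =
     {\<nu> \<in> prob_measures. \<exists>\<nu>\<^sub>0\<in>prob_measures. \<exists>t :: nat \<Rightarrow> real.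
        (\<forall>n. 0 \<le> t n) \<and> incseq t \<and> filterlim t at_top sequentially \<and>
        weakly_converges (\<lambda>n. evolve S (t n) \<nu>\<^sub>0) \<nu> sequentially}"

definition strong_symmetry_breaking :: "'q::finite semigroup \<Rightarrow> bool" where
  "strong_symmetry_breaking S \<longleftrightarrow> stationary_measures S \<subset> periodic_measures S"

definition weak_symmetry_breaking :: "'q::finite semigroup \<Rightarrow> bool" where
  "weak_symmetry_breaking S \<longleftrightarrow> stationary_measures S \<subset> attractor S"

definition ergodic :: "'q::finite semigroup \<Rightarrow> bool" where
  "ergodic S \<longleftrightarrow>
     (\<exists>\<nu>. stationary_measures S = {\<nu>} \<and>
        (\<forall>\<nu>\<^sub>0\<in>prob_measures. weakly_converges (\<lambda>t. evolve S t \<nu>\<^sub>0) \<nu> at_top))"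

end

theory Submission
  imports Defs
begin

text \<open>
  Everything rests on \<open>\<parallel>S(T + s) f - S(T) f\<parallel> \<longrightarrow> 0\<close> as \<open>T \<longrightarrow> \<infinity>\<close>, for every continuous \<open>f\<close> and \<open>s \<ge> 0\<close>.
  To compare the two times, let the dynamics run over the time span \<open>[0, T]\<close> with its speed raised by a
  factor \<open>1 + e(t)\<close>, where \<open>t\<close> is counted back from the end and \<open>e\<close> has integral \<open>s\<close>. For \<open>f\<close> depending
  on finitely many sites, exponential locality makes only the sites within distance of order \<open>1 + t\<close>
  relevant, so in dimension one the cost of the change of speed is of order \<open>\<integral> e(t)\<^sup>2 (1 + t) dt\<close>. The
  choice of \<open>e(t)\<close> proportional to \<open>1 / (1 + t)\<close> makes it \<open>O(1 / ln T)\<close>. The cost is measured by the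
  square inequality \<open>(S(T + s) f)\<^sup>2 \<le> S(T) (f\<^sup>2) + O(1 / ln T)\<close>, which is obtained for the explicit Euler
  scheme of truncated generators and applied to \<open>a \<plusminus> f\<close> with a large constant \<open>a\<close>.

  Weak limits along \<open>t\<^sub>n \<longrightarrow> \<infinity>\<close> are therefore stationary, and ergodicity follows by compactness of the
  set of probability measures.
\<close>

subsection \<open>Cylinders and continuous functions\<close>

text \<open>The density of the time change is forced. If the relevant region at backward time t has
  volume V(t), then Cauchy-Schwarz gives s^2 / \<integral>(1/V) as the least value of \<integral>e^2
  V subject to \<integral>e = s, attained for e proportional to 1/V. With V(t) = 1 + t the integral
  of 1/V diverges logarithmically and the cost tends to 0; a region growing quadratically would
  leave a positive cost. Squares enter because the generator applied to u^2 exceeds 2 u times the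
  generator applied to u by a nonnegative quadratic form in the increments of u. This gain absorbs
  the extra drift caused by the speed-up. The inequality thus plays the role of an entropy
  comparison of two path laws. The Euler scheme is used because each step is explicit: monotonicity
  and the growth of weighted oscillations are followed by induction, and contractivity of the
  semigroup transfers the result. Constants depending on the number of jumps kept in the truncation
  are harmless, since the step size tends to 0 before the truncation level tends to infinity, and T
  tends to infinity last.\<close>

definition window :: "nat \<Rightarrow> int set" where
  "window n = {- int n..int n}"

definition cylinder :: "nat \<Rightarrow> 'q::finite config \<Rightarrow> 'q config set" where
  "cylinder n \<eta> = {\<xi>. \<forall>x\<in>window n. \<xi> x = \<eta> x}"

lemma finite_window [simp]: "finite (window n)"
  by (simp add: window_def)

lemma window_mono: "m \<le> n \<Longrightarrow> window m \<subseteq> window n"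
  by (auto simp: window_def)

lemma cylinder_antimono: "m \<le> n \<Longrightarrow> cylinder n \<eta> \<subseteq> cylinder m \<eta>"
  using window_mono by (fastforce simp: cylinder_def)

lemma self_in_cylinder [simp]: "\<eta> \<in> cylinder n \<eta>"
  by (simp add: cylinder_def)

lemma cylinder_eq: "\<xi> \<in> cylinder n \<eta> \<Longrightarrow> cylinder n \<xi> = cylinder n \<eta>"
  by (auto simp: cylinder_def)

lemma open_cylinder: "open (cylinder n (\<eta> :: 'q::finite config))"
proof -
  have "cylinder n \<eta> = (\<Pi>\<^sub>E x\<in>UNIV. if x \<in> window n then {\<eta> x} else UNIV)"
    by (auto simp: cylinder_def PiE_UNIV_domain Pi_iff split: if_splits)
  moreover have "open \<dots>"
    by (rule open_PiE) (auto simp: open_spin_def intro: finite_subset[OF _ finite_window[of n]])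
  ultimately show ?thesis by simp
qed

lemma closed_cylinder: "closed (cylinder n (\<eta> :: 'q::finite config))"
proof -
  have "- cylinder n \<eta> = (\<Union>\<xi>\<in>- cylinder n \<eta>. cylinder n \<xi>)"
    by (auto simp: cylinder_def)
  also have "open \<dots>"
    by (intro open_UN ballI open_cylinder)
  finally have "open (- cylinder n \<eta>)" .
  then show ?thesis by (simp add: closed_def)
qed

text \<open>A basic open set of the product topology restricts only finitely many coordinates, and a
  symmetric window contains all of them.\<close>

lemma open_contains_cylinder:
  fixes U :: "'q::finite config set"
  assumes "open U" "\<eta> \<in> U"
  shows "\<exists>n. cylinder n \<eta> \<subseteq> U"
proof -
  have "openin (product_topology (\<lambda>i::int. euclidean :: 'q spin topology) UNIV) U"
    using assms(1) by (simp add: open_fun_def)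
  from product_topology_open_contains_basis[OF this assms(2)]
  obtain X where X: "\<eta> \<in> (\<Pi>\<^sub>E i\<in>UNIV. X i)" "finite {i. X i \<noteq> UNIV}" "(\<Pi>\<^sub>E i\<in>UNIV. X i) \<subseteq> U"
    unfolding topspace_euclidean by blast
  \<comment> \<open>The inserted 0 keeps the maximum meaningful when no coordinate is
    restricted.\<close>
  define n where "n = nat (Max (insert 0 (abs ` {i. X i \<noteq> UNIV})))"
  have "i \<in> window n" if "X i \<noteq> UNIV" for i
  proof -
    have "\<bar>i\<bar> \<le> Max (insert 0 (abs ` {i. X i \<noteq> UNIV}))"
      using that X(2) by (intro Max_ge) auto
    then show ?thesis by (auto simp: window_def n_def)
  qed
  then have "\<xi> i \<in> X i" if "\<xi> \<in> cylinder n \<eta>" for \<xi> i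
    using that X(1) by (cases "X i = UNIV") (auto simp: cylinder_def PiE_UNIV_domain Pi_iff)
  then have "cylinder n \<eta> \<subseteq> (\<Pi>\<^sub>E i\<in>UNIV. X i)"
    unfolding PiE_UNIV_domain by blast
  with X(3) show ?thesis by blast
qed

lemma compact_config: "compact (UNIV :: 'q::finite config set)"
proof -
  have "compact_space (product_topology (\<lambda>i::int. euclidean :: 'q spin topology) UNIV)"
    by (simp add: compact_space_product_topology, simp add: compact_space_def finite_imp_compact)
  then show ?thesis
    by (simp add: euclidean_product_topology compact_space_def flip: compactin_euclidean_iff)
qed

lemma apply_Bcontfun:
  fixes f :: "'q::finite config \<Rightarrow> real"
  assumes "continuous_on UNIV f"
  shows "apply_bcontfun (Bcontfun f) = f"
  using assms compact_continuous_image[OF assms compact_config]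
  by (intro Bcontfun_inverse) (simp add: bcontfun_def compact_imp_bounded)

text \<open>Compactness in the role of a Lebesgue number. Cylinders behave like the balls of an
  ultrametric, so the largest of the finitely many window sizes works everywhere: such a cylinder
  lies inside whichever member of the cover contains its centre.\<close>

lemma uniformly_local:
  fixes f :: "'q::finite config \<Rightarrow> real"
  assumes "continuous_on UNIV f" "0 < e"
  shows "\<exists>n. \<forall>\<eta> \<xi>. \<xi> \<in> cylinder n \<eta> \<longrightarrow> \<bar>f \<xi> - f \<eta>\<bar> < e"
proof -
  have "\<exists>n. \<forall>\<xi>\<in>cylinder n \<eta>. \<bar>f \<xi> - f \<eta>\<bar> < e / 2" for \<eta>
  proof -
    have "open (f -` {f \<eta> - e / 2<..<f \<eta> + e / 2})"
      using assms(1) by (intro open_vimage) auto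
    from open_contains_cylinder[OF this, of \<eta>] obtain n
      where n: "cylinder n \<eta> \<subseteq> f -` {f \<eta> - e / 2<..<f \<eta> + e / 2}"
      using assms(2) by auto
    have "\<bar>f \<xi> - f \<eta>\<bar> < e / 2" if "\<xi> \<in> cylinder n \<eta>" for \<xi>
      using subsetD[OF n that] by (auto simp: abs_if)
    then show ?thesis by blast
  qed
  then obtain N where N: "\<And>\<eta> \<xi>. \<xi> \<in> cylinder (N \<eta>) \<eta> \<Longrightarrow> \<bar>f \<xi> - f \<eta>\<bar> < e / 2"
    by metis
  have "UNIV \<subseteq> (\<Union>\<eta>\<in>UNIV. cylinder (N \<eta>) \<eta>)"
    using self_in_cylinder by (intro subsetI UN_I[OF UNIV_I])
  then obtain C' where C': "C' \<subseteq> UNIV" "finite C'" "UNIV \<subseteq> (\<Union>\<eta>\<in>C'. cylinder (N \<eta>) \<eta>)"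
    by (rule compactE_image[OF compact_config open_cylinder])
  define n where "n = Max (N ` C')"
  have "\<bar>f \<xi> - f \<eta>\<bar> < e" if "\<xi> \<in> cylinder n \<eta>" for \<xi> \<eta>
  proof -
    obtain \<zeta> where \<zeta>: "\<zeta> \<in> C'" "\<eta> \<in> cylinder (N \<zeta>) \<zeta>"
      using C'(3) by blast
    have "N \<zeta> \<le> n"
      using \<zeta>(1) C'(2) by (simp add: n_def)
    then have "\<xi> \<in> cylinder (N \<zeta>) \<eta>"
      using that cylinder_antimono by blast
    then have "\<xi> \<in> cylinder (N \<zeta>) \<zeta>"
      using cylinder_eq[OF \<zeta>(2)] by simp
    from N[OF this] N[OF \<zeta>(2)] show ?thesis by linarith
  qed
  then show ?thesis by blast
qed

text \<open>A canonical representative of each cylinder: \<open>restrict\<close> puts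
  \<open>undefined\<close> at every site off the window, so only finitely many configurations occur
  as values.\<close>

definition truncate :: "nat \<Rightarrow> 'q::finite config \<Rightarrow> 'q config" where
  "truncate n \<eta> = restrict \<eta> (window n)"

lemma finite_range_truncate: "finite (range (truncate n :: 'q::finite config \<Rightarrow> 'q config))"
proof (rule finite_subset)
  show "range (truncate n) \<subseteq> (\<Pi>\<^sub>E x\<in>window n. (UNIV :: 'q spin set))"
    by (auto simp: truncate_def)
qed (intro finite_PiE; simp)

lemma truncate_in_cylinder: "truncate n \<eta> \<in> cylinder n \<eta>"
  by (simp add: truncate_def cylinder_def)

lemma truncate_eq_iff: "truncate n \<eta> = truncate n \<xi> \<longleftrightarrow> \<eta> \<in> cylinder n \<xi>"
  by (auto simp: truncate_def cylinder_def fun_eq_iff restrict_def)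

lemma continuous_truncate:
  fixes f :: "'q::finite config \<Rightarrow> real"
  shows "continuous_on UNIV (\<lambda>\<eta>. f (truncate n \<eta>))"
proof (subst continuous_on_open_vimage[OF open_UNIV], safe)
  fix B :: "real set"
  have "(\<lambda>\<eta>. f (truncate n \<eta>)) -` B \<inter> UNIV = (\<Union>\<eta>\<in>{\<eta>. f (truncate n \<eta>) \<in> B}. cylinder n \<eta>)"
    by (auto simp: truncate_eq_iff[symmetric])
  also have "open \<dots>"
    by (intro open_UN ballI open_cylinder)
  finally show "open ((\<lambda>\<eta>. f (truncate n \<eta>)) -` B \<inter> UNIV)" .
qed

definition truncation :: "nat \<Rightarrow> ('q::finite config \<Rightarrow>\<^sub>C real) \<Rightarrow> 'q config \<Rightarrow>\<^sub>C real" where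
  "truncation n f = Bcontfun (\<lambda>\<eta>. apply_bcontfun f (truncate n \<eta>))"

lemma apply_truncation: "apply_bcontfun (truncation n f) \<eta> = apply_bcontfun f (truncate n \<eta>)"
  by (simp add: truncation_def apply_Bcontfun continuous_truncate)

lemma truncation_approx:
  fixes f :: "'q::finite config \<Rightarrow>\<^sub>C real"
  assumes "0 < e"
  shows "\<exists>n. norm (truncation n f - f) \<le> e"
proof -
  obtain n where n: "\<And>\<eta> \<xi>. \<xi> \<in> cylinder n \<eta> \<Longrightarrow> \<bar>apply_bcontfun f \<xi> - apply_bcontfun f \<eta>\<bar> < e"
    using uniformly_local[of "apply_bcontfun f" e] assms by auto
  have "norm (truncation n f - f) \<le> e"
    by (rule norm_bound) (use n[OF truncate_in_cylinder] in \<open>auto simp: apply_truncation less_imp_le\<close>)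
  then show ?thesis by blast
qed

subsection \<open>Riesz representation\<close>

abbreviation clopen_sets :: "'q::finite config set set" where
  "clopen_sets \<equiv> {A. open A \<and> closed A}"

text \<open>An open set is the union of the cylinders inside it. This union is countable, since for
  each n the truncations supply finitely many representatives.\<close>

lemma sigma_sets_clopen: "sigma_sets UNIV (clopen_sets :: 'q::finite config set set) = sets borel"
proof -
  have "sigma_sets UNIV {S. open S} = sigma_sets UNIV (clopen_sets :: 'q config set set)"
  proof (rule sigma_sets_eqI)
    fix U :: "'q config set" assume "U \<in> {S. open S}"
    then have U: "open U" by simp
    define Z where "Z = (\<Union>n. (\<lambda>\<zeta>. cylinder n \<zeta>) ` {\<zeta> \<in> range (truncate n). cylinder n \<zeta> \<subseteq> U})"
    have "\<Union>Z = U"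
    proof
      show "U \<subseteq> \<Union>Z"
      proof
        fix \<eta> assume "\<eta> \<in> U"
        then obtain n where n: "cylinder n \<eta> \<subseteq> U"
          using open_contains_cylinder[OF U] by blast
        have "cylinder n (truncate n \<eta>) = cylinder n \<eta>"
          by (rule cylinder_eq[OF truncate_in_cylinder])
        then have "cylinder n \<eta> \<in> Z"
          unfolding Z_def using n by blast
        then show "\<eta> \<in> \<Union>Z" by (meson UnionI self_in_cylinder)
      qed
    qed (auto simp: Z_def)
    moreover have "finite {\<zeta> \<in> range (truncate n). cylinder n \<zeta> \<subseteq> U}" for n
      by (rule finite_subset[of _ "range (truncate n)"]) (use finite_range_truncate in blast)+
    then have "countable Z"
      unfolding Z_def by (intro countable_UN countableI_type countable_image countable_finite) simp_all
    moreover have "Z \<subseteq> clopen_sets"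
      by (auto simp: Z_def open_cylinder closed_cylinder)
    ultimately show "U \<in> sigma_sets UNIV clopen_sets"
      by (metis (no_types, lifting) sigma_sets.Basic sigma_sets_UNION subset_iff)
  next
    fix U :: "'q config set" assume "U \<in> clopen_sets"
    then show "U \<in> sigma_sets UNIV {S. open S}" by (auto intro: sigma_sets.Basic)
  qed
  then show ?thesis by (simp add: borel_def)
qed

lemma apply_Bcontfun_indicator:
  fixes A :: "'q::finite config set"
  assumes "open A" "closed A"
  shows "apply_bcontfun (Bcontfun (indicator A)) = (indicator A :: _ \<Rightarrow> real)"
proof (intro apply_Bcontfun, subst continuous_on_open_vimage[OF open_UNIV], safe)
  fix B :: "real set"
  have "(indicator A -` B :: 'q config set) \<inter> UNIV \<in> {{}, A, - A, UNIV}"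
    by (cases "0 \<in> B"; cases "1 \<in> B") (auto simp: indicator_def of_bool_def split: if_splits)
  then show "open ((indicator A -` B :: 'q config set) \<inter> UNIV)"
    using assms by (auto simp: closed_def)
qed

text \<open>Indicators of clopen sets are continuous, so both measures agree on an
  intersection-stable generator of the Borel sets.\<close>

lemma prob_measures_eqI:
  fixes \<mu> \<nu> :: "'q::finite config measure"
  assumes \<mu>: "\<mu> \<in> prob_measures" and \<nu>: "\<nu> \<in> prob_measures"
    and eq: "\<And>f :: 'q config \<Rightarrow>\<^sub>C real. (\<integral>\<eta>. apply_bcontfun f \<eta> \<partial>\<mu>) = (\<integral>\<eta>. apply_bcontfun f \<eta> \<partial>\<nu>)"
  shows "\<mu> = \<nu>"
proof (rule measure_eqI_generator_eq)
  interpret M: prob_space \<mu> using \<mu> by (simp add: prob_measures_def)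
  interpret N: prob_space \<nu> using \<nu> by (simp add: prob_measures_def)
  have sets: "sets \<mu> = sets borel" "sets \<nu> = sets borel"
    using \<mu> \<nu> by (simp_all add: prob_measures_def)
  show "emeasure \<mu> A = emeasure \<nu> A" if "A \<in> clopen_sets" for A
  proof -
    have "apply_bcontfun (Bcontfun (indicator A)) = (indicator A :: _ \<Rightarrow> real)"
      using that by (simp add: apply_Bcontfun_indicator)
    moreover have "A \<in> sets \<mu>" "A \<in> sets \<nu>"
      using that by (simp_all add: sets)
    ultimately have "measure \<mu> A = measure \<nu> A"
      using eq[of "Bcontfun (indicator A :: _ \<Rightarrow> real)"] sets.Int_space_eq2 by (simp add: sets)
    then show ?thesis
      by (simp add: M.emeasure_eq_measure N.emeasure_eq_measure)
  qed
  show "Int_stable (clopen_sets :: 'q config set set)"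
    by (auto simp: Int_stable_def)
  show "range (\<lambda>_::nat. UNIV) \<subseteq> (clopen_sets :: 'q config set set)" by auto
  show "emeasure \<mu> UNIV \<noteq> \<infinity>" by simp
qed (use \<mu> \<nu> in \<open>auto simp: prob_measures_def sigma_sets_clopen\<close>)

lemma integrable_bcontfun:
  fixes \<mu> :: "'q::finite config measure"
  assumes "\<mu> \<in> prob_measures"
  shows "integrable \<mu> (apply_bcontfun f :: _ \<Rightarrow> real)"
proof -
  interpret prob_space \<mu> using assms by (simp add: prob_measures_def)
  have "apply_bcontfun f \<in> borel_measurable \<mu>"
    using borel_measurable_continuous_onI[OF continuous_on_apply_bcontfun] assms
    by (subst measurable_cong_sets[of \<mu> borel borel borel]) (simp_all add: prob_measures_def)
  then show ?thesis
    by (intro integrable_const_bound[of _ "norm f"] AE_I2) (use norm_bounded[of f] in auto)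
qed

text \<open>Both \<open>norm f\<close> + f and \<open>norm f\<close> - f are nonnegative, and the
  functional sends the constant \<open>norm f\<close> to itself.\<close>

lemma positive_functional_norm_le:
  fixes \<Lambda> :: "('q::finite config \<Rightarrow>\<^sub>C real) \<Rightarrow> real"
  assumes lin: "linear \<Lambda>" and pos: "\<And>f. (\<And>\<eta>. 0 \<le> apply_bcontfun f \<eta>) \<Longrightarrow> 0 \<le> \<Lambda> f"
    and one: "\<Lambda> (const_bcontfun 1) = 1"
  shows "\<bar>\<Lambda> f\<bar> \<le> norm f"
proof -
  have b: "\<bar>apply_bcontfun f \<eta>\<bar> \<le> norm f" for \<eta>
    using norm_bounded[of f \<eta>] by simp
  have "0 \<le> \<Lambda> (norm f *\<^sub>R const_bcontfun 1 - f)" "0 \<le> \<Lambda> (norm f *\<^sub>R const_bcontfun 1 + f)"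
    by (intro pos; use b in \<open>auto simp: abs_le_iff minus_le_iff\<close>;
        smt (verit) b)+
  then show ?thesis
    by (simp add: linear_diff[OF lin] linear_add[OF lin] linear_cmul[OF lin] one)
qed

text \<open>On the algebra of clopen sets the functional defines a finitely additive set function.
  It is continuous at the empty set by compactness: a decreasing sequence of clopen sets with empty
  intersection is eventually empty. Caratheodory extension gives the measure, and uniform density of
  the truncations identifies its integral with \<Lambda>.\<close>

lemma riesz_representation:
  fixes \<Lambda> :: "('q::finite config \<Rightarrow>\<^sub>C real) \<Rightarrow> real"
  assumes lin: "linear \<Lambda>" and pos: "\<And>f. (\<And>\<eta>. 0 \<le> apply_bcontfun f \<eta>) \<Longrightarrow> 0 \<le> \<Lambda> f"
    and one: "\<Lambda> (const_bcontfun 1) = 1"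
  shows "\<exists>\<mu>\<in>prob_measures. \<forall>f. (\<integral>\<eta>. apply_bcontfun f \<eta> \<partial>\<mu>) = \<Lambda> f"
proof -
  define ind where "ind A = Bcontfun (indicator A :: 'q config \<Rightarrow> real)" for A
  have ind: "apply_bcontfun (ind A) = indicator A" if "A \<in> clopen_sets" for A
    using that by (simp add: ind_def apply_Bcontfun_indicator)
  interpret algebra UNIV "clopen_sets :: 'q config set set"
    by (auto simp: algebra_iff_Un Compl_eq_Diff_UNIV[symmetric] closed_Compl open_Compl)
  define m where "m A = ennreal (\<Lambda> (ind A))" for A
  have \<Lambda>0: "0 \<le> \<Lambda> (ind A)" if "A \<in> clopen_sets" for A
    by (rule pos) (simp add: ind[OF that])
  have m_empty: "m {} = 0"
  proof -
    have "ind {} = 0"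
      by (rule bcontfun_eqI) (simp add: ind)
    then show ?thesis by (simp add: m_def linear_0[OF lin])
  qed
  have "\<exists>\<mu>. (\<forall>A\<in>clopen_sets. \<mu> A = m A) \<and> measure_space UNIV (sigma_sets UNIV clopen_sets) \<mu>"
  proof (rule caratheodory_empty_continuous)
    show "positive clopen_sets m"
      by (simp add: positive_def m_empty)
    show "additive clopen_sets m"
      unfolding additive_def
    proof (intro ballI impI)
      fix A B :: "'q config set"
      assume AB: "A \<in> clopen_sets" "B \<in> clopen_sets" "A \<inter> B = {}"
      then have U: "A \<union> B \<in> clopen_sets" by auto
      have "ind (A \<union> B) = ind A + ind B"
        by (rule bcontfun_eqI)
           (simp add: ind[OF AB(1)] ind[OF AB(2)] ind[OF U] indicator_add[OF AB(3), symmetric])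
      then have "\<Lambda> (ind (A \<union> B)) = \<Lambda> (ind A) + \<Lambda> (ind B)"
        by (simp add: linear_add[OF lin])
      then show "m (A \<union> B) = m A + m B"
        using \<Lambda>0[OF AB(1)] \<Lambda>0[OF AB(2)] by (simp add: m_def)
    qed
    show "m A \<noteq> \<infinity>" for A by (simp add: m_def)
    fix A :: "nat \<Rightarrow> 'q config set"
    assume A: "range A \<subseteq> clopen_sets" "decseq A" "(\<Inter>i. A i) = {}"
    have cov: "UNIV \<subseteq> (\<Union>i\<in>UNIV. - A i)" using A(3) by auto
    have "open (- A i)" for i using A(1) by (auto simp: open_Compl)
    from compactE_image[OF compact_config this cov] obtain C where C: "C \<subseteq> UNIV" "finite C" "UNIV \<subseteq> (\<Union>i\<in>C. - A i)"
      by blast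
    have "A j = {}" if "Max (insert 0 C) \<le> j" for j
    proof -
      have "A j \<subseteq> A i" if "i \<in> C" for i
      proof -
        have "i \<le> Max (insert 0 C)" using C(2) that by (intro Max_ge) auto
        then show ?thesis using \<open>Max (insert 0 C) \<le> j\<close> decseqD[OF A(2), of i j] by simp
      qed
      with C(3) show ?thesis by blast
    qed
    then have "eventually (\<lambda>j. m (A j) = 0) sequentially"
      unfolding eventually_sequentially by (intro exI[of _ "Max (insert 0 C)"]) (simp add: m_empty)
    then show "(\<lambda>i. m (A i)) \<longlonglongrightarrow> 0" by (rule tendsto_eventually)
  qed
  then obtain \<mu>0 where \<mu>0: "\<And>A. A \<in> clopen_sets \<Longrightarrow> \<mu>0 A = m A"
    "measure_space UNIV (sets borel :: 'q config set set) \<mu>0"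
    unfolding sigma_sets_clopen by blast
  define \<mu> where "\<mu> = measure_of UNIV (sets (borel :: 'q config measure)) \<mu>0"
  have sets\<mu>: "sets \<mu> = sets borel"
    unfolding \<mu>_def using sets.sets_measure_of_eq[of borel] by simp
  have em: "emeasure \<mu> A = m A" if "A \<in> clopen_sets" for A
  proof -
    have "A \<in> sets borel" using that by auto
    then have "emeasure \<mu> A = \<mu>0 A"
      unfolding \<mu>_def using \<mu>0(2) sets.sigma_algebra_axioms[of "borel :: 'q config measure"]
      by (intro emeasure_measure_of_sigma) (auto simp: measure_space_def)
    then show ?thesis using \<mu>0(1)[OF that] by simp
  qed
  have "ind UNIV = const_bcontfun 1"
    by (rule bcontfun_eqI) (simp add: ind const_bcontfun.rep_eq)
  then have "emeasure \<mu> UNIV = 1"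
    by (simp add: em m_def one)
  then have P: "\<mu> \<in> prob_measures"
    using sets_eq_imp_space_eq[OF sets\<mu>] sets\<mu> by (auto simp: prob_measures_def intro!: prob_spaceI)
  interpret prob_space \<mu> using P by (simp add: prob_measures_def)
  define I where "I f = (\<integral>\<eta>. apply_bcontfun f \<eta> \<partial>\<mu>)" for f :: "'q config \<Rightarrow>\<^sub>C real"
  have I_add: "I (f + g) = I f + I g" for f g
    by (simp add: I_def integrable_bcontfun[OF P])
  have I_scale: "I (r *\<^sub>R f) = r * I f" for f r
    by (simp add: I_def)
  have linI: "linear I"
    by (rule linearI) (simp_all add: I_add I_scale)
  have I_ind: "I (ind A) = \<Lambda> (ind A)" if "A \<in> clopen_sets" for A
  proof -
    have "I (ind A) = measure \<mu> A"
      using that by (simp add: I_def ind[OF that] sets\<mu>)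
    also have "\<dots> = \<Lambda> (ind A)"
      using em[OF that] \<Lambda>0[OF that] by (simp add: measure_def m_def)
    finally show ?thesis .
  qed
  have I_trunc: "I (truncation n f) = \<Lambda> (truncation n f)" for n f
  proof -
    have cl: "cylinder n \<zeta> \<in> clopen_sets" for \<zeta> :: "'q config"
      by (simp add: open_cylinder closed_cylinder)
    \<comment> \<open>The range of \<open>truncate n\<close> lists every cylinder of size n exactly
      once, so a truncation is a finite combination of clopen indicators.\<close>
    have eq: "truncation n f = (\<Sum>\<zeta>\<in>range (truncate n). apply_bcontfun f \<zeta> *\<^sub>R ind (cylinder n \<zeta>))"
    proof (rule bcontfun_eqI)
      fix \<eta> :: "'q config"
      have *: "\<eta> \<in> cylinder n \<zeta> \<longleftrightarrow> \<zeta> = truncate n \<eta>" if "\<zeta> \<in> range (truncate n)" for \<zeta>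
        using that truncate_eq_iff[of n \<eta>] cylinder_eq[OF truncate_in_cylinder] by force
      have "apply_bcontfun (\<Sum>\<zeta>\<in>Z. apply_bcontfun f \<zeta> *\<^sub>R ind (cylinder n \<zeta>)) \<eta>
          = (\<Sum>\<zeta>\<in>Z. apply_bcontfun f \<zeta> * indicator (cylinder n \<zeta>) \<eta>)" for Z
        by (induction Z rule: infinite_finite_induct) (simp_all add: ind[OF cl] del: sum_mult_indicator)
      also have "(\<Sum>\<zeta>\<in>range (truncate n). apply_bcontfun f \<zeta> * indicator (cylinder n \<zeta>) \<eta>)
          = (\<Sum>\<zeta>\<in>range (truncate n). if \<zeta> = truncate n \<eta> then apply_bcontfun f \<zeta> else 0)"
        by (intro sum.cong refl) (simp add: indicator_def *)
      also have "\<dots> = apply_bcontfun (truncation n f) \<eta>"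
        by (simp add: finite_range_truncate apply_truncation)
      finally show "apply_bcontfun (truncation n f) \<eta>
        = apply_bcontfun (\<Sum>\<zeta>\<in>range (truncate n). apply_bcontfun f \<zeta> *\<^sub>R ind (cylinder n \<zeta>)) \<eta>"
        by simp
    qed
    show ?thesis
      unfolding eq linear_sum[OF lin] linear_sum[OF linI] linear_cmul[OF lin] linear_cmul[OF linI]
      by (simp add: I_ind[OF cl])
  qed
  have Inorm: "\<bar>I f\<bar> \<le> norm f" for f
  proof (rule positive_functional_norm_le[OF linI])
    show "0 \<le> I f" if "\<And>\<eta>. 0 \<le> apply_bcontfun f \<eta>" for f
      unfolding I_def by (rule Bochner_Integration.integral_nonneg) (rule that)
    show "I (const_bcontfun 1) = 1"
      using prob_space by (simp add: I_def const_bcontfun.rep_eq)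
  qed
  have "I f = \<Lambda> f" for f
  proof -
    have "\<bar>I f - \<Lambda> f\<bar> \<le> 0 + e" if e: "0 < e" for e
    proof -
      obtain n where n: "norm (truncation n f - f) \<le> e / 2"
        using truncation_approx[of "e / 2" f] e by auto
      have "\<bar>I (truncation n f - f)\<bar> \<le> e / 2" "\<bar>\<Lambda> (truncation n f - f)\<bar> \<le> e / 2"
        using Inorm[of "truncation n f - f"]
          positive_functional_norm_le[OF lin pos one, of "truncation n f - f"] n by simp_all
      then show ?thesis
        using I_trunc[of n f] by (simp add: linear_diff[OF linI] linear_diff[OF lin] abs_if split: if_splits)
    qed
    then show ?thesis using field_le_epsilon[of "\<bar>I f - \<Lambda> f\<bar>" 0] by simp
  qed
  then show ?thesis using P unfolding I_def by blast
qed

subsection \<open>Weighted oscillations\<close>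

text \<open>A majorant w replaces the exact oscillations: everything stays real-valued, and an Euler
  step can be described by an explicit new majorant.\<close>

definition has_osc :: "(int \<Rightarrow> real) \<Rightarrow> ('q::finite config \<Rightarrow> real) \<Rightarrow> bool" where
  "has_osc w f \<longleftrightarrow> (\<forall>x \<eta> \<xi>. (\<forall>z. z \<noteq> x \<longrightarrow> \<eta> z = \<xi> z) \<longrightarrow> \<bar>f \<eta> - f \<xi>\<bar> \<le> w x)"

text \<open>An exponentially weighted version of the sum of oscillations that defines D(\<Omega>).
  Bounding all finite partial sums expresses summability and the bound at once. Along the dynamics M
  grows at most like exp (K * t), so oscillations far beyond distance K t / \<alpha> from the origin
  are negligible: this is the light cone.\<close>

definition tame :: "real \<Rightarrow> real \<Rightarrow> ('q::finite config \<Rightarrow> real) \<Rightarrow> bool" where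
  "tame \<alpha> M f \<longleftrightarrow>
     (\<exists>w. has_osc w f \<and> (\<forall>Y. finite Y \<longrightarrow> (\<Sum>y\<in>Y. exp (\<alpha> * real_of_int \<bar>y\<bar>) * w y) \<le> M))"

lemma has_oscD: "has_osc w f \<Longrightarrow> (\<And>z. z \<noteq> x \<Longrightarrow> \<eta> z = \<xi> z) \<Longrightarrow> \<bar>f \<eta> - f \<xi>\<bar> \<le> w x"
  unfolding has_osc_def by blast

lemma has_osc_nonneg: "has_osc w f \<Longrightarrow> 0 \<le> w x"
  using has_oscD[of w f x undefined undefined] by simp

lemma tame_nonneg: "tame \<alpha> M f \<Longrightarrow> 0 \<le> M"
  unfolding tame_def by (metis finite.emptyI sum.empty)

text \<open>The sites of \<Delta> are changed one at a time.\<close>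

lemma has_osc_override:
  assumes "has_osc w f" "finite \<Delta>"
  shows "\<bar>f (override_on \<eta> \<xi> \<Delta>) - f \<eta>\<bar> \<le> (\<Sum>x\<in>\<Delta>. w x)"
  using assms(2)
proof (induction \<Delta> rule: finite_induct)
  case (insert x \<Delta>)
  have "\<bar>f (override_on \<eta> \<xi> (insert x \<Delta>)) - f (override_on \<eta> \<xi> \<Delta>)\<bar> \<le> w x"
    by (rule has_oscD[OF assms(1)]) (simp add: override_on_def)
  with insert show ?case by simp
qed simp

text \<open>Needed because the comparison also runs the Euler scheme from the square of f. The bound
  comes from factoring a difference of squares.\<close>

lemma tame_square:
  fixes f :: "'q::finite config \<Rightarrow> real"
  assumes "tame \<alpha> M f" "\<And>\<eta>. \<bar>f \<eta>\<bar> \<le> B"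
  shows "tame \<alpha> (2 * B * M) (\<lambda>\<eta>. (f \<eta>)\<^sup>2)"
proof -
  obtain w where w: "has_osc w f"
    "\<And>Y. finite Y \<Longrightarrow> (\<Sum>y\<in>Y. exp (\<alpha> * real_of_int \<bar>y\<bar>) * w y) \<le> M"
    using assms(1) unfolding tame_def by blast
  have B: "0 \<le> B" using assms(2)[of undefined] by linarith
  have "has_osc (\<lambda>x. 2 * B * w x) (\<lambda>\<eta>. (f \<eta>)\<^sup>2)"
    unfolding has_osc_def
  proof (intro allI impI)
    fix x and \<eta> \<xi> :: "'q config" assume *: "\<forall>z. z \<noteq> x \<longrightarrow> \<eta> z = \<xi> z"
    have "\<bar>(f \<eta>)\<^sup>2 - (f \<xi>)\<^sup>2\<bar> = \<bar>f \<eta> + f \<xi>\<bar> * \<bar>f \<eta> - f \<xi>\<bar>"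
      by (simp add: power2_eq_square square_diff_square_factored abs_mult)
    also have "\<dots> \<le> (2 * B) * w x"
      using assms(2)[of \<eta>] assms(2)[of \<xi>] B has_oscD[OF w(1), of x \<eta> \<xi>] *
      by (intro mult_mono) auto
    finally show "\<bar>(f \<eta>)\<^sup>2 - (f \<xi>)\<^sup>2\<bar> \<le> 2 * B * w x" .
  qed
  moreover have "(\<Sum>y\<in>Y. exp (\<alpha> * real_of_int \<bar>y\<bar>) * (2 * B * w y)) \<le> 2 * B * M" if "finite Y" for Y
    using mult_left_mono[OF w(2)[OF that], of "2 * B"] B
    by (simp add: sum_distrib_left mult_ac)
  ultimately show ?thesis unfolding tame_def by (intro exI conjI allI impI)
qed

text \<open>Supplies a uniformly dense class of tame functions: off the window the oscillation
  vanishes, inside it is at most 2 B.\<close>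

lemma tame_truncation:
  fixes f :: "'q::finite config \<Rightarrow> real"
  assumes "\<And>\<eta>. \<bar>f \<eta>\<bar> \<le> B"
  shows "tame \<alpha> (\<Sum>x\<in>window n. exp (\<alpha> * real_of_int \<bar>x\<bar>) * (2 * B)) (\<lambda>\<eta>. f (truncate n \<eta>))"
proof -
  have B: "0 \<le> B" using assms[of undefined] by linarith
  define w where "w x = (if x \<in> window n then 2 * B else 0)" for x
  have "has_osc w (\<lambda>\<eta>. f (truncate n \<eta>))"
    unfolding has_osc_def
  proof (intro allI impI)
    fix x and \<eta> \<xi> :: "'q config" assume *: "\<forall>z. z \<noteq> x \<longrightarrow> \<eta> z = \<xi> z"
    show "\<bar>f (truncate n \<eta>) - f (truncate n \<xi>)\<bar> \<le> w x"
    proof (cases "x \<in> window n")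
      case True
      then show ?thesis using assms[of "truncate n \<eta>"] assms[of "truncate n \<xi>"] by (simp add: w_def)
    next
      case False
      with * have "truncate n \<eta> = truncate n \<xi>"
        by (auto simp: truncate_eq_iff cylinder_def)
      then show ?thesis by (simp add: w_def B)
    qed
  qed
  moreover have "(\<Sum>y\<in>Y. exp (\<alpha> * real_of_int \<bar>y\<bar>) * w y) \<le> (\<Sum>x\<in>window n. exp (\<alpha> * real_of_int \<bar>x\<bar>) * (2 * B))"
    if "finite Y" for Y
  proof -
    have "(\<Sum>y\<in>Y. exp (\<alpha> * real_of_int \<bar>y\<bar>) * w y)
        = (\<Sum>y\<in>Y \<inter> window n. exp (\<alpha> * real_of_int \<bar>y\<bar>) * (2 * B))"
      by (intro sum.mono_neutral_cong_right that) (auto simp: w_def)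
    also have "\<dots> \<le> (\<Sum>x\<in>window n. exp (\<alpha> * real_of_int \<bar>x\<bar>) * (2 * B))"
      using B by (intro sum_mono2) auto
    finally show ?thesis .
  qed
  ultimately show ?thesis unfolding tame_def by (intro exI conjI allI impI)
qed

subsection \<open>Finitely many jumps\<close>

text \<open>The empty \<open>\<Delta>\<close> is left out: it induces no jump, and (L1) does not bound its rate.\<close>

definition jumps :: "(int set \<times> 'q::finite config) set" where
  "jumps = {(\<Delta>, \<xi>). finite \<Delta> \<and> \<Delta> \<noteq> {} \<and> \<xi> \<in> local_configs \<Delta>}"

abbreviation jump :: "int set \<times> 'q::finite config \<Rightarrow> 'q config \<Rightarrow> 'q config" where
  "jump i \<eta> \<equiv> override_on \<eta> (snd i) (fst i)"

text \<open>The conditions on the rates in real-valued form: b and C carry (L1), L carries (R1), v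
  and K carry (R3). Only finite families of jumps occur in the sums, so no infinite series has to be
  handled here. The sum in \<open>osc_sum\<close> may contain the diagonal term y = x, which
  \<open>influence\<close> sets to 0, so K has to cover this term as well.\<close>

locale jump_rates =
  fixes r :: "int set \<times> 'q::finite config \<Rightarrow> 'q config \<Rightarrow> real"
    and b :: "int set \<times> 'q config \<Rightarrow> real"
    and v :: "int set \<times> 'q config \<Rightarrow> int \<Rightarrow> real"
    and \<alpha> C K L :: real
  assumes \<alpha>_pos: "0 < \<alpha>"
    and rate_continuous: "i \<in> jumps \<Longrightarrow> continuous_on UNIV (r i)"
    and rate_nonneg: "i \<in> jumps \<Longrightarrow> 0 \<le> r i \<eta>"
    and rate_le: "i \<in> jumps \<Longrightarrow> r i \<eta> \<le> b i"
    and rate_osc: "i \<in> jumps \<Longrightarrow> has_osc (v i) (r i)"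
    and rate_range: "i \<in> jumps \<Longrightarrow> x \<in> fst i \<Longrightarrow> y \<in> fst i \<Longrightarrow> r i \<eta> \<noteq> 0 \<Longrightarrow> real_of_int \<bar>x - y\<bar> \<le> L"
    and bound_sum: "finite I \<Longrightarrow> I \<subseteq> jumps \<Longrightarrow> (\<Sum>i\<in>{i \<in> I. x \<in> fst i}. b i) \<le> C"
    and osc_sum: "finite I \<Longrightarrow> I \<subseteq> jumps \<Longrightarrow> finite Y \<Longrightarrow>
      (\<Sum>y\<in>Y. exp (\<alpha> * real_of_int \<bar>x - y\<bar>) * (\<Sum>i\<in>{i \<in> I. x \<in> fst i}. v i y)) \<le> K"
begin

definition gen :: "(int set \<times> 'q config) set \<Rightarrow> ('q config \<Rightarrow> real) \<Rightarrow> 'q config \<Rightarrow> real" where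
  "gen I f \<eta> = (\<Sum>i\<in>I. r i \<eta> * (f (jump i \<eta>) - f \<eta>))"

lemma C_nonneg: "0 \<le> C"
  using bound_sum[of "{}"] by simp

lemma K_nonneg: "0 \<le> K"
  using osc_sum[of "{}" "{}"] by simp

lemma bound_nonneg: "i \<in> jumps \<Longrightarrow> 0 \<le> b i"
  using rate_nonneg rate_le order_trans by blast

lemma finite_support: "i \<in> jumps \<Longrightarrow> finite (fst i)"
  by (auto simp: jumps_def)

text \<open>Exchanging jumps and sites makes the bounds per site, \<open>bound_sum\<close> and
  \<open>osc_sum\<close>, applicable to a sum over all jumps.\<close>

lemma sum_over_support:
  fixes g :: "int set \<times> 'q config \<Rightarrow> int \<Rightarrow> real"
  assumes "finite I" "I \<subseteq> jumps"
  shows "(\<Sum>i\<in>I. \<Sum>x\<in>fst i. g i x) = (\<Sum>x\<in>\<Union>(fst ` I). \<Sum>i\<in>{i \<in> I. x \<in> fst i}. g i x)"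
proof -
  have fin: "finite (\<Union>(fst ` I))"
    using assms finite_support by blast
  have "(\<Sum>i\<in>I. \<Sum>x\<in>fst i. g i x) = (\<Sum>i\<in>I. \<Sum>x\<in>{x \<in> \<Union>(fst ` I). x \<in> fst i}. g i x)"
    by (intro sum.cong refl) auto
  also have "\<dots> = (\<Sum>x\<in>\<Union>(fst ` I). \<Sum>i\<in>{i \<in> I. x \<in> fst i}. g i x)"
    by (rule sum.swap_restrict[OF assms(1) fin])
  finally show ?thesis .
qed

text \<open>At distance at least s the weight exp (\<alpha> |x|) is at least exp (\<alpha> s);
  inserting it produces the decay. The distance assumption concerns only jumps with nonzero rate at
  \<eta>, since the range condition controls only these, and the others are discarded at the
  start.\<close>

lemma sum_jumps_far:
  assumes f: "tame \<alpha> M f" and I: "finite I" "I \<subseteq> jumps"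
    and far: "\<And>i x. i \<in> I \<Longrightarrow> x \<in> fst i \<Longrightarrow> r i \<eta> \<noteq> 0 \<Longrightarrow> s \<le> real_of_int \<bar>x\<bar>"
  shows "(\<Sum>i\<in>I. r i \<eta> * \<bar>f (jump i \<eta>) - f \<eta>\<bar>) \<le> C * M * exp (- \<alpha> * s)"
proof -
  obtain w where w: "has_osc w f"
    "\<And>Y. finite Y \<Longrightarrow> (\<Sum>y\<in>Y. exp (\<alpha> * real_of_int \<bar>y\<bar>) * w y) \<le> M"
    using f unfolding tame_def by blast
  have w0: "0 \<le> w x" for x using has_osc_nonneg[OF w(1)] .
  define I' where "I' = {i \<in> I. r i \<eta> \<noteq> 0}"
  have I': "finite I'" "I' \<subseteq> jumps" using I by (auto simp: I'_def)
  have fin: "finite (\<Union>(fst ` I'))"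
    using I' finite_support by blast
  have far': "s \<le> real_of_int \<bar>x\<bar>" if "x \<in> \<Union>(fst ` I')" for x
    using that far by (auto simp: I'_def)
  have "(\<Sum>i\<in>I. r i \<eta> * \<bar>f (jump i \<eta>) - f \<eta>\<bar>) = (\<Sum>i\<in>I'. r i \<eta> * \<bar>f (jump i \<eta>) - f \<eta>\<bar>)"
    by (rule sum.mono_neutral_right) (auto simp: I I'_def)
  also have "\<dots> \<le> (\<Sum>i\<in>I'. b i * (\<Sum>x\<in>fst i. w x))"
  proof (intro sum_mono mult_mono)
    fix i assume "i \<in> I'"
    then have i: "i \<in> jumps" using I' by blast
    show "r i \<eta> \<le> b i" "0 \<le> b i" using rate_le bound_nonneg i by blast+
    show "\<bar>f (jump i \<eta>) - f \<eta>\<bar> \<le> (\<Sum>x\<in>fst i. w x)"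
      by (rule has_osc_override[OF w(1) finite_support[OF i]])
  qed simp
  also have "\<dots> = (\<Sum>x\<in>\<Union>(fst ` I'). w x * (\<Sum>i\<in>{i \<in> I'. x \<in> fst i}. b i))"
    unfolding sum_distrib_left sum_over_support[OF I'] by (simp add: mult.commute)
  also have "\<dots> \<le> (\<Sum>x\<in>\<Union>(fst ` I'). w x * C)"
    using bound_sum[OF I'] w0 by (intro sum_mono mult_left_mono) auto
  also have "\<dots> \<le> (\<Sum>x\<in>\<Union>(fst ` I'). (exp (- \<alpha> * s) * C) * (exp (\<alpha> * real_of_int \<bar>x\<bar>) * w x))"
  proof (rule sum_mono)
    fix x assume "x \<in> \<Union>(fst ` I')"
    then have "1 \<le> exp (- \<alpha> * s + \<alpha> * real_of_int \<bar>x\<bar>)"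
      using far'[of x] \<alpha>_pos by simp
    then have "1 * (C * w x) \<le> exp (- \<alpha> * s + \<alpha> * real_of_int \<bar>x\<bar>) * (C * w x)"
      using C_nonneg w0 by (intro mult_right_mono) auto
    also have "\<dots> = (exp (- \<alpha> * s) * C) * (exp (\<alpha> * real_of_int \<bar>x\<bar>) * w x)"
      by (simp only: exp_add mult_ac)
    finally show "w x * C \<le> (exp (- \<alpha> * s) * C) * (exp (\<alpha> * real_of_int \<bar>x\<bar>) * w x)"
      by (simp add: mult.commute)
  qed
  also have "\<dots> \<le> (exp (- \<alpha> * s) * C) * M"
    unfolding sum_distrib_left[symmetric] using w(2)[OF fin] C_nonneg
    by (intro mult_left_mono) auto
  finally show ?thesis by (simp add: mult_ac)
qed

lemma sum_jumps:
  assumes "tame \<alpha> M f" "finite I" "I \<subseteq> jumps"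
  shows "(\<Sum>i\<in>I. r i \<eta> * \<bar>f (jump i \<eta>) - f \<eta>\<bar>) \<le> C * M"
  using sum_jumps_far[OF assms, of \<eta> 0] by simp

lemma gen_abs_le_sum:
  assumes "I \<subseteq> jumps"
  shows "\<bar>gen I f \<eta>\<bar> \<le> (\<Sum>i\<in>I. r i \<eta> * \<bar>f (jump i \<eta>) - f \<eta>\<bar>)"
  unfolding gen_def
  by (rule order_trans[OF sum_abs sum_mono]) (use assms rate_nonneg in \<open>auto simp: abs_mult subset_iff\<close>)

text \<open>Bounds the oscillation at y created by the dependence of the rates on y: v passes the
  oscillation of f from the site x of a jump on to y. The weight at y is at most the weight at x
  times exp (\<alpha> |x - y|), so the double sum splits into the weighted sum for f and the one
  bounded by K.\<close>

lemma interaction_sum: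
  assumes w: "has_osc w f" "\<And>Y. finite Y \<Longrightarrow> (\<Sum>y\<in>Y. exp (\<alpha> * real_of_int \<bar>y\<bar>) * w y) \<le> M"
    and I: "finite I" "I \<subseteq> jumps" and Y: "finite Y"
  shows "(\<Sum>y\<in>Y. exp (\<alpha> * real_of_int \<bar>y\<bar>) * (\<Sum>i\<in>I. v i y * (\<Sum>x\<in>fst i. w x))) \<le> K * M"
proof -
  let ?X = "\<Union>(fst ` I)"
  have fin: "finite ?X"
    using I finite_support by blast
  have v0: "0 \<le> v i y" if "i \<in> I" for i y
    using has_osc_nonneg[OF rate_osc] I(2) that by blast
  have "(\<Sum>y\<in>Y. exp (\<alpha> * real_of_int \<bar>y\<bar>) * (\<Sum>i\<in>I. v i y * (\<Sum>x\<in>fst i. w x)))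
      = (\<Sum>y\<in>Y. exp (\<alpha> * real_of_int \<bar>y\<bar>) * (\<Sum>x\<in>?X. w x * (\<Sum>i\<in>{i \<in> I. x \<in> fst i}. v i y)))"
    unfolding sum_distrib_left[of "v _ _"] sum_over_support[OF I] sum_distrib_left[of "w _"]
    by (simp add: mult.commute)
  also have "\<dots> \<le> (\<Sum>y\<in>Y. \<Sum>x\<in>?X. (exp (\<alpha> * real_of_int \<bar>x\<bar>) * w x) *
      (exp (\<alpha> * real_of_int \<bar>x - y\<bar>) * (\<Sum>i\<in>{i \<in> I. x \<in> fst i}. v i y)))"
    unfolding sum_distrib_left[of "exp (\<alpha> * real_of_int \<bar>_\<bar>)" _ ?X]
  proof (intro sum_mono)
    fix x y
    let ?V = "\<Sum>i\<in>{i \<in> I. x \<in> fst i}. v i y"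
    have "\<alpha> * real_of_int \<bar>y\<bar> \<le> \<alpha> * (real_of_int \<bar>x\<bar> + real_of_int \<bar>x - y\<bar>)"
      using \<alpha>_pos by (intro mult_left_mono) linarith+
    then have "exp (\<alpha> * real_of_int \<bar>y\<bar>) \<le> exp (\<alpha> * real_of_int \<bar>x\<bar>) * exp (\<alpha> * real_of_int \<bar>x - y\<bar>)"
      by (simp add: distrib_left flip: exp_add)
    then have "exp (\<alpha> * real_of_int \<bar>y\<bar>) * (w x * ?V)
      \<le> (exp (\<alpha> * real_of_int \<bar>x\<bar>) * exp (\<alpha> * real_of_int \<bar>x - y\<bar>)) * (w x * ?V)"
      using has_osc_nonneg[OF w(1)] v0 by (intro mult_right_mono mult_nonneg_nonneg sum_nonneg) auto
    then show "exp (\<alpha> * real_of_int \<bar>y\<bar>) * (w x * ?V)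
      \<le> (exp (\<alpha> * real_of_int \<bar>x\<bar>) * w x) * (exp (\<alpha> * real_of_int \<bar>x - y\<bar>) * ?V)"
      by (simp add: mult_ac)
  qed
  also have "\<dots> = (\<Sum>x\<in>?X. (exp (\<alpha> * real_of_int \<bar>x\<bar>) * w x) *
      (\<Sum>y\<in>Y. exp (\<alpha> * real_of_int \<bar>x - y\<bar>) * (\<Sum>i\<in>{i \<in> I. x \<in> fst i}. v i y)))"
    by (subst sum.swap) (simp add: sum_distrib_left)
  also have "\<dots> \<le> (\<Sum>x\<in>?X. (exp (\<alpha> * real_of_int \<bar>x\<bar>) * w x) * K)"
    using osc_sum[OF I Y] has_osc_nonneg[OF w(1)] by (intro sum_mono mult_left_mono) auto
  also have "\<dots> \<le> M * K"
    unfolding sum_distrib_right[symmetric] using w(2)[OF fin] K_nonneg by (rule mult_right_mono)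
  finally show ?thesis by (simp add: mult.commute)
qed

lemma jump_eq_off:
  fixes \<eta> \<xi> :: "'q config"
  assumes "\<And>z. z \<noteq> x \<Longrightarrow> \<eta> z = \<xi> z" "z \<noteq> x"
  shows "jump i \<eta> z = jump i \<xi> z"
  using assms by (simp add: override_on_def)

text \<open>For h small enough the step is a convex combination of f and its values after jumps, and
  two configurations that differ only at y still differ at most at y after a common jump. Hence the
  only growth comes from the change of the rates, and the factor 1 + h * K does not depend on
  I.\<close>

lemma euler_tame:
  assumes f: "tame \<alpha> M f" and I: "finite I" "I \<subseteq> jumps"
    and h: "0 \<le> h" "h * (\<Sum>i\<in>I. b i) \<le> 1"
  shows "tame \<alpha> ((1 + h * K) * M) (\<lambda>\<eta>. f \<eta> + h * gen I f \<eta>)"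
proof -
  obtain w where w: "has_osc w f"
    "\<And>Y. finite Y \<Longrightarrow> (\<Sum>y\<in>Y. exp (\<alpha> * real_of_int \<bar>y\<bar>) * w y) \<le> M"
    using f unfolding tame_def by blast
  define w' where "w' y = w y + h * (\<Sum>i\<in>I. v i y * (\<Sum>x\<in>fst i. w x))" for y
  have "has_osc w' (\<lambda>\<eta>. f \<eta> + h * gen I f \<eta>)"
    unfolding has_osc_def
  proof (intro allI impI)
    fix y and \<eta> \<xi> :: "'q config" assume d: "\<forall>z. z \<noteq> y \<longrightarrow> \<eta> z = \<xi> z"
    let ?a = "1 - h * (\<Sum>i\<in>I. r i \<eta>)"
    have r0: "0 \<le> r i \<eta>" if "i \<in> I" for i using that I rate_nonneg by blast
    have "h * (\<Sum>i\<in>I. r i \<eta>) \<le> h * (\<Sum>i\<in>I. b i)"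
      using h I rate_le by (intro mult_left_mono sum_mono) auto
    then have a: "0 \<le> ?a" using h by linarith
    \<comment> \<open>The two configurations are coupled to make the same jumps at the rates of
      \<eta>; the last sum is the mismatch of the rates.\<close>
    have eq: "(f \<eta> + h * gen I f \<eta>) - (f \<xi> + h * gen I f \<xi>)
      = ?a * (f \<eta> - f \<xi>) + h * (\<Sum>i\<in>I. r i \<eta> * (f (jump i \<eta>) - f (jump i \<xi>)))
        + h * (\<Sum>i\<in>I. (r i \<eta> - r i \<xi>) * (f (jump i \<xi>) - f \<xi>))"
      by (simp add: gen_def algebra_simps sum_subtractf sum.distrib sum_distrib_left)
    have "\<bar>(f \<eta> + h * gen I f \<eta>) - (f \<xi> + h * gen I f \<xi>)\<bar>
      \<le> ?a * w y + h * (\<Sum>i\<in>I. r i \<eta> * w y) + h * (\<Sum>i\<in>I. v i y * (\<Sum>x\<in>fst i. w x))"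
      unfolding eq
    proof (intro order_trans[OF abs_triangle_ineq] add_mono)
      show "\<bar>?a * (f \<eta> - f \<xi>)\<bar> \<le> ?a * w y"
        unfolding abs_mult abs_of_nonneg[OF a]
        using a d by (intro mult_left_mono has_oscD[OF w(1)]) auto
      have "\<bar>\<Sum>i\<in>I. r i \<eta> * (f (jump i \<eta>) - f (jump i \<xi>))\<bar> \<le> (\<Sum>i\<in>I. r i \<eta> * w y)"
      proof (rule order_trans[OF sum_abs sum_mono])
        fix i assume i: "i \<in> I"
        show "\<bar>r i \<eta> * (f (jump i \<eta>) - f (jump i \<xi>))\<bar> \<le> r i \<eta> * w y"
          unfolding abs_mult abs_of_nonneg[OF r0[OF i]]
          using d by (intro mult_left_mono has_oscD[OF w(1)] r0 i jump_eq_off) auto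
      qed
      then show "\<bar>h * (\<Sum>i\<in>I. r i \<eta> * (f (jump i \<eta>) - f (jump i \<xi>)))\<bar> \<le> h * (\<Sum>i\<in>I. r i \<eta> * w y)"
        unfolding abs_mult abs_of_nonneg[OF h(1)] by (rule mult_left_mono[OF _ h(1)])
      have "\<bar>\<Sum>i\<in>I. (r i \<eta> - r i \<xi>) * (f (jump i \<xi>) - f \<xi>)\<bar> \<le> (\<Sum>i\<in>I. v i y * (\<Sum>x\<in>fst i. w x))"
      proof (rule order_trans[OF sum_abs sum_mono])
        fix i assume "i \<in> I"
        then have i: "i \<in> jumps" using I by blast
        show "\<bar>(r i \<eta> - r i \<xi>) * (f (jump i \<xi>) - f \<xi>)\<bar> \<le> v i y * (\<Sum>x\<in>fst i. w x)"
          unfolding abs_mult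
          using has_oscD[OF rate_osc[OF i], of y \<eta> \<xi>] d has_osc_nonneg[OF rate_osc[OF i], of y]
            has_osc_override[OF w(1) finite_support[OF i], of \<xi> "snd i"]
          by (intro mult_mono) auto
      qed
      then show "\<bar>h * (\<Sum>i\<in>I. (r i \<eta> - r i \<xi>) * (f (jump i \<xi>) - f \<xi>))\<bar>
          \<le> h * (\<Sum>i\<in>I. v i y * (\<Sum>x\<in>fst i. w x))"
        unfolding abs_mult abs_of_nonneg[OF h(1)] by (rule mult_left_mono[OF _ h(1)])
    qed
    also have "\<dots> = w' y"
      unfolding w'_def sum_distrib_right[symmetric] by (simp add: algebra_simps)
    finally show "\<bar>(f \<eta> + h * gen I f \<eta>) - (f \<xi> + h * gen I f \<xi>)\<bar> \<le> w' y" .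
  qed
  moreover have "(\<Sum>y\<in>Y. exp (\<alpha> * real_of_int \<bar>y\<bar>) * w' y) \<le> (1 + h * K) * M" if "finite Y" for Y
  proof -
    have "(\<Sum>y\<in>Y. exp (\<alpha> * real_of_int \<bar>y\<bar>) * w' y) = (\<Sum>y\<in>Y. exp (\<alpha> * real_of_int \<bar>y\<bar>) * w y)
        + h * (\<Sum>y\<in>Y. exp (\<alpha> * real_of_int \<bar>y\<bar>) * (\<Sum>i\<in>I. v i y * (\<Sum>x\<in>fst i. w x)))"
      by (simp add: w'_def sum.distrib distrib_left sum_distrib_left mult_ac)
    also have "\<dots> \<le> M + h * (K * M)"
      using w(2)[OF that] mult_left_mono[OF interaction_sum[OF w I that] h(1)] by (rule add_mono)
    finally show ?thesis by (simp add: algebra_simps)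
  qed
  ultimately show ?thesis unfolding tame_def by (intro exI conjI allI impI)
qed

text \<open>Unlike in \<open>euler_tame\<close>, the factor contains the total rate of I. The lemma
  allows the generator to be applied a second time, in the remainder of an Euler step, where the
  factor is compensated by h^2.\<close>

lemma gen_tame:
  assumes f: "tame \<alpha> M f" and I: "finite I" "I \<subseteq> jumps"
  shows "tame \<alpha> ((2 * (\<Sum>i\<in>I. b i) + K) * M) (gen I f)"
proof -
  obtain w where w: "has_osc w f"
    "\<And>Y. finite Y \<Longrightarrow> (\<Sum>y\<in>Y. exp (\<alpha> * real_of_int \<bar>y\<bar>) * w y) \<le> M"
    using f unfolding tame_def by blast
  let ?b = "\<Sum>i\<in>I. b i"
  have b0: "0 \<le> ?b" using I bound_nonneg by (intro sum_nonneg) auto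
  define w' where "w' y = 2 * ?b * w y + (\<Sum>i\<in>I. v i y * (\<Sum>x\<in>fst i. w x))" for y
  have "has_osc w' (gen I f)"
    unfolding has_osc_def
  proof (intro allI impI)
    fix y and \<eta> \<xi> :: "'q config" assume d: "\<forall>z. z \<noteq> y \<longrightarrow> \<eta> z = \<xi> z"
    have eq: "gen I f \<eta> - gen I f \<xi> = (\<Sum>i\<in>I. r i \<eta> * ((f (jump i \<eta>) - f (jump i \<xi>)) - (f \<eta> - f \<xi>))
        + (r i \<eta> - r i \<xi>) * (f (jump i \<xi>) - f \<xi>))"
      unfolding gen_def sum_subtractf[symmetric] by (intro sum.cong refl) (simp add: algebra_simps)
    have "\<bar>gen I f \<eta> - gen I f \<xi>\<bar> \<le> (\<Sum>i\<in>I. b i * (2 * w y) + v i y * (\<Sum>x\<in>fst i. w x))"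
      unfolding eq
    proof (rule order_trans[OF sum_abs sum_mono])
      fix i assume "i \<in> I"
      then have i: "i \<in> jumps" using I by blast
      have "\<bar>f (jump i \<eta>) - f (jump i \<xi>)\<bar> \<le> w y"
        using d by (intro has_oscD[OF w(1)] jump_eq_off) auto
      moreover have "\<bar>f \<eta> - f \<xi>\<bar> \<le> w y"
        using d by (intro has_oscD[OF w(1)]) auto
      ultimately have "\<bar>r i \<eta> * ((f (jump i \<eta>) - f (jump i \<xi>)) - (f \<eta> - f \<xi>))\<bar> \<le> b i * (2 * w y)"
        unfolding abs_mult using rate_le[OF i] rate_nonneg[OF i] bound_nonneg[OF i]
        by (intro mult_mono) auto
      moreover have "\<bar>(r i \<eta> - r i \<xi>) * (f (jump i \<xi>) - f \<xi>)\<bar> \<le> v i y * (\<Sum>x\<in>fst i. w x)"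
        unfolding abs_mult
        using has_oscD[OF rate_osc[OF i], of y \<eta> \<xi>] d has_osc_nonneg[OF rate_osc[OF i], of y]
          has_osc_override[OF w(1) finite_support[OF i], of \<xi> "snd i"]
        by (intro mult_mono) auto
      ultimately show "\<bar>r i \<eta> * ((f (jump i \<eta>) - f (jump i \<xi>)) - (f \<eta> - f \<xi>))
          + (r i \<eta> - r i \<xi>) * (f (jump i \<xi>) - f \<xi>)\<bar> \<le> b i * (2 * w y) + v i y * (\<Sum>x\<in>fst i. w x)"
        by linarith
    qed
    also have "\<dots> = w' y"
      unfolding w'_def sum.distrib sum_distrib_right[symmetric] by (simp add: mult_ac)
    finally show "\<bar>gen I f \<eta> - gen I f \<xi>\<bar> \<le> w' y" .
  qed
  moreover have "(\<Sum>y\<in>Y. exp (\<alpha> * real_of_int \<bar>y\<bar>) * w' y) \<le> (2 * ?b + K) * M" if "finite Y" for Y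
  proof -
    have "(\<Sum>y\<in>Y. exp (\<alpha> * real_of_int \<bar>y\<bar>) * w' y) = (2 * ?b) * (\<Sum>y\<in>Y. exp (\<alpha> * real_of_int \<bar>y\<bar>) * w y)
        + (\<Sum>y\<in>Y. exp (\<alpha> * real_of_int \<bar>y\<bar>) * (\<Sum>i\<in>I. v i y * (\<Sum>x\<in>fst i. w x)))"
      unfolding w'_def sum_distrib_left[of "2 * ?b"] sum.distrib[symmetric]
      by (intro sum.cong refl) (simp only: distrib_left mult.left_commute[of "2 * ?b"] mult.assoc[of "2 * ?b"])
    also have "\<dots> \<le> (2 * ?b) * M + K * M"
      using w(2)[OF that] interaction_sum[OF w I that] b0 by (intro add_mono mult_left_mono) auto
    finally show ?thesis by (simp add: algebra_simps)
  qed
  ultimately show ?thesis unfolding tame_def by (intro exI conjI allI impI)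
qed

text \<open>The step is a combination of values of f with nonnegative coefficients as soon as h
  times the total rate is at most 1.\<close>

lemma euler_mono:
  assumes I: "finite I" "I \<subseteq> jumps" and h: "0 \<le> h" "h * (\<Sum>i\<in>I. b i) \<le> 1"
    and fg: "\<And>\<eta>. f \<eta> \<le> g \<eta>"
  shows "f \<eta> + h * gen I f \<eta> \<le> g \<eta> + h * gen I g \<eta>"
proof -
  have "h * (\<Sum>i\<in>I. r i \<eta>) \<le> h * (\<Sum>i\<in>I. b i)"
    using h I rate_le by (intro mult_left_mono sum_mono) auto
  then have a: "0 \<le> 1 - h * (\<Sum>i\<in>I. r i \<eta>)" using h by linarith
  have eq: "f \<eta> + h * gen I f \<eta> = (1 - h * (\<Sum>i\<in>I. r i \<eta>)) * f \<eta> + h * (\<Sum>i\<in>I. r i \<eta> * f (jump i \<eta>))" for f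
    by (simp add: gen_def algebra_simps sum_subtractf sum_distrib_left)
  have "(\<Sum>i\<in>I. r i \<eta> * f (jump i \<eta>)) \<le> (\<Sum>i\<in>I. r i \<eta> * g (jump i \<eta>))"
    using I rate_nonneg fg by (intro sum_mono mult_left_mono) auto
  then show ?thesis
    unfolding eq using a h(1) fg by (intro add_mono mult_left_mono) auto
qed

lemma gen_const [simp]: "gen I (\<lambda>_. a) \<eta> = 0"
  by (simp add: gen_def)

lemma euler_bound:
  assumes I: "finite I" "I \<subseteq> jumps" and h: "0 \<le> h" "h * (\<Sum>i\<in>I. b i) \<le> 1"
    and f: "\<And>\<eta>. \<bar>f \<eta>\<bar> \<le> B"
  shows "\<bar>f \<eta> + h * gen I f \<eta>\<bar> \<le> B"
proof -
  have "f \<eta> + h * gen I f \<eta> \<le> B + h * gen I (\<lambda>_. B) \<eta>"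
    using f by (intro euler_mono I h) (simp add: abs_le_iff)
  moreover have "- B + h * gen I (\<lambda>_. - B) \<eta> \<le> f \<eta> + h * gen I f \<eta>"
    using f by (intro euler_mono I h) (simp add: abs_le_iff minus_le_iff)
  ultimately show ?thesis by simp
qed

lemma continuous_gen:
  assumes "I \<subseteq> jumps" "continuous_on UNIV f"
  shows "continuous_on UNIV (gen I f)"
proof -
  have "continuous_on UNIV (\<lambda>\<eta>. f (jump i \<eta>))" for i
  proof (rule continuous_on_compose2[OF assms(2)])
    show "continuous_on UNIV (jump i)"
    proof (rule continuous_on_coordinatewise_then_product)
      show "continuous_on UNIV (\<lambda>\<eta>. jump i \<eta> x)" for x
        by (cases "x \<in> fst i") (simp_all add: override_on_def)
    qed
  qed simp
  then show ?thesis
    unfolding gen_def using assms rate_continuous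
    by (intro continuous_on_sum continuous_on_mult continuous_on_diff) auto
qed

end

subsection \<open>The generator\<close>

lemma finite_local_configs: "finite \<Delta> \<Longrightarrow> finite (local_configs \<Delta> :: 'q::finite config set)"
  unfolding local_configs_def by (intro finite_PiE) simp_all

lemma tame_smooth:
  fixes f :: "'q::finite config \<Rightarrow>\<^sub>C real"
  assumes "tame \<alpha> M (apply_bcontfun f)" "0 < \<alpha>"
  shows "f \<in> smooth_functions"
proof -
  obtain w where w: "has_osc w (apply_bcontfun f)"
    "\<And>Y. finite Y \<Longrightarrow> (\<Sum>y\<in>Y. exp (\<alpha> * real_of_int \<bar>y\<bar>) * w y) \<le> M"
    using assms(1) unfolding tame_def by blast
  have w0: "0 \<le> w x" for x using has_osc_nonneg[OF w(1)] .
  have osc: "oscillation x (apply_bcontfun f) \<le> ennreal (w x)" for x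
    unfolding oscillation_def
    by (rule SUP_least) (auto intro!: ennreal_leI has_oscD[OF w(1)])
  have "(\<Sum>\<^sub>\<infinity>x. oscillation x (apply_bcontfun f)) \<le> ennreal M"
  proof (rule infsum_le_finite_sums)
    show "(\<lambda>x. oscillation x (apply_bcontfun f)) summable_on UNIV"
      by (simp add: nonneg_summable_on_complete)
    fix Y :: "int set" assume Y: "finite Y"
    have "(\<Sum>x\<in>Y. oscillation x (apply_bcontfun f)) \<le> (\<Sum>x\<in>Y. ennreal (w x))"
      using osc by (rule sum_mono)
    also have "\<dots> = ennreal (\<Sum>x\<in>Y. w x)"
      using w0 by simp
    also have "(\<Sum>x\<in>Y. w x) \<le> (\<Sum>y\<in>Y. exp (\<alpha> * real_of_int \<bar>y\<bar>) * w y)"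
    proof (rule sum_mono)
      fix y
      have "1 * w y \<le> exp (\<alpha> * real_of_int \<bar>y\<bar>) * w y"
        using w0 assms(2) by (intro mult_right_mono) auto
      then show "w y \<le> exp (\<alpha> * real_of_int \<bar>y\<bar>) * w y" by simp
    qed
    also have "\<dots> \<le> M" by (rule w(2)[OF Y])
    finally show "(\<Sum>x\<in>Y. oscillation x (apply_bcontfun f)) \<le> ennreal M"
      by (simp add: ennreal_leI)
  qed
  then show ?thesis
    unfolding smooth_functions_def by (auto intro: le_less_trans simp: ennreal_less_top)
qed

context jump_rates
begin

definition level :: "nat \<Rightarrow> (int set \<times> 'q config) set" where
  "level n = {i \<in> jumps. fst i \<subseteq> window n}"

lemma level_subset: "level n \<subseteq> jumps"
  by (auto simp: level_def)

lemma finite_level: "finite (level n)"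
proof (rule finite_subset)
  show "level n \<subseteq> Sigma (Pow (window n)) local_configs"
    by (auto simp: level_def jumps_def)
  show "finite (Sigma (Pow (window n)) local_configs :: (int set \<times> 'q config) set)"
    using finite_subset[OF _ finite_window] by (intro finite_SigmaI finite_local_configs) auto
qed

text \<open>Here finite range is used: an active jump that leaves the window has a site beyond
  distance n, hence all its sites lie at distance at least n - L from the origin, and
  \<open>sum_jumps_far\<close> applies.\<close>

lemma gen_level_far:
  assumes f: "tame \<alpha> M f" and I: "finite I" "I \<subseteq> jumps" "level n \<subseteq> I"
  shows "\<bar>gen I f \<eta> - gen (level n) f \<eta>\<bar> \<le> C * M * exp (- \<alpha> * (real n - L))"
proof -
  have "gen I f \<eta> - gen (level n) f \<eta> = gen (I - level n) f \<eta>"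
    unfolding gen_def using I by (simp add: sum_diff finite_level)
  also have "\<bar>gen (I - level n) f \<eta>\<bar> \<le> (\<Sum>i\<in>I - level n. r i \<eta> * \<bar>f (jump i \<eta>) - f \<eta>\<bar>)"
    using I by (intro gen_abs_le_sum) auto
  also have "\<dots> \<le> C * M * exp (- \<alpha> * (real n - L))"
  proof (rule sum_jumps_far[OF f])
    fix i x assume i: "i \<in> I - level n" "x \<in> fst i" "r i \<eta> \<noteq> 0"
    then have "i \<in> jumps" using I by blast
    moreover from this i obtain y where y: "y \<in> fst i" "y \<notin> window n"
      by (auto simp: level_def)
    ultimately have "real_of_int \<bar>x - y\<bar> \<le> L"
      using rate_range i by blast
    moreover have "int n < \<bar>y\<bar>" using y(2) by (auto simp: window_def)
    ultimately show "real n - L \<le> real_of_int \<bar>x\<bar>" by linarith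
  qed (use I in auto)
  finally show ?thesis .
qed

text \<open>The formal generator is the limit of sums over finite families of sets. Every family
  that contains all subsets of the window includes \<open>level n\<close>, so the bound of
  \<open>gen_level_far\<close> holds along a tail of the net and survives the limit.\<close>

lemma formal_generator_approx:
  assumes f: "tame \<alpha> M f"
  shows "\<bar>formal_generator (\<lambda>\<Delta> \<eta> \<xi>. r (\<Delta>, \<xi>) \<eta>) f \<eta> - gen (level n) f \<eta>\<bar> \<le> C * M * exp (- \<alpha> * (real n - L))"
proof -
  define t where "t \<Delta> = (\<Sum>\<xi>\<in>local_configs \<Delta>. r (\<Delta>, \<xi>) \<eta> * (f (override_on \<eta> \<xi> \<Delta>) - f \<eta>))" for \<Delta>
  \<comment> \<open>The empty set belongs to the index set of the formal generator but not to
    \<open>jumps\<close>; its term is 0.\<close>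
  define J where "J F = Sigma (F - {{}}) (local_configs :: int set \<Rightarrow> 'q config set)" for F
  have J: "finite (J F)" "J F \<subseteq> jumps" if "finite F" "F \<subseteq> {\<Delta>. finite \<Delta>}" for F
    using that by (auto simp: J_def jumps_def intro!: finite_SigmaI finite_local_configs)
  have t_empty: "t {} = 0" by (simp add: t_def)
  have sum_t: "(\<Sum>\<Delta>\<in>F. t \<Delta>) = gen (J F) f \<eta>" if F: "finite F" "F \<subseteq> {\<Delta>. finite \<Delta>}" for F
  proof -
    have "(\<Sum>\<Delta>\<in>F. t \<Delta>) = (\<Sum>\<Delta>\<in>F - {{}}. t \<Delta>)"
      using F t_empty by (intro sum.mono_neutral_right) auto
    also have "\<dots> = gen (J F) f \<eta>"
      unfolding t_def gen_def J_def using F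
      by (subst sum.Sigma) (auto simp: split_beta finite_local_configs)
    finally show ?thesis .
  qed
  have "(\<Sum>\<Delta>\<in>F. \<bar>t \<Delta>\<bar>) \<le> C * M" if F: "finite F" "F \<subseteq> {\<Delta>. finite \<Delta>}" for F
  proof -
    have "(\<Sum>\<Delta>\<in>F. \<bar>t \<Delta>\<bar>) = (\<Sum>\<Delta>\<in>F - {{}}. \<bar>t \<Delta>\<bar>)"
      using F t_empty by (intro sum.mono_neutral_right) auto
    also have "\<dots> \<le> (\<Sum>\<Delta>\<in>F - {{}}. \<Sum>\<xi>\<in>local_configs \<Delta>. r (\<Delta>, \<xi>) \<eta> * \<bar>f (override_on \<eta> \<xi> \<Delta>) - f \<eta>\<bar>)"
    proof (rule sum_mono)
      fix \<Delta> assume \<Delta>: "\<Delta> \<in> F - {{}}"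
      have "\<bar>r (\<Delta>, \<xi>) \<eta> * (f (override_on \<eta> \<xi> \<Delta>) - f \<eta>)\<bar> = r (\<Delta>, \<xi>) \<eta> * \<bar>f (override_on \<eta> \<xi> \<Delta>) - f \<eta>\<bar>"
        if "\<xi> \<in> local_configs \<Delta>" for \<xi>
        using rate_nonneg[of "(\<Delta>, \<xi>)" \<eta>] that \<Delta> F by (auto simp: abs_mult jumps_def)
      then show "\<bar>t \<Delta>\<bar> \<le> (\<Sum>\<xi>\<in>local_configs \<Delta>. r (\<Delta>, \<xi>) \<eta> * \<bar>f (override_on \<eta> \<xi> \<Delta>) - f \<eta>\<bar>)"
        unfolding t_def by (intro order_trans[OF sum_abs]) simp
    qed
    also have "\<dots> = (\<Sum>i\<in>J F. r i \<eta> * \<bar>f (jump i \<eta>) - f \<eta>\<bar>)"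
      unfolding J_def using F by (subst sum.Sigma) (auto simp: split_beta finite_local_configs)
    also have "\<dots> \<le> C * M" by (rule sum_jumps[OF f J[OF F]])
    finally show ?thesis .
  qed
  \<comment> \<open>An infinite sum that does not converge is 0 by convention. The uniform bound C *
    M excludes this case and makes the finite sums converge to the formal generator.\<close>
  then have "(\<lambda>\<Delta>. norm (t \<Delta>)) summable_on {\<Delta>. finite \<Delta>}"
    by (intro nonneg_bdd_above_summable_on bdd_aboveI[of _ "C * M"]) auto
  then have "t summable_on {\<Delta>. finite \<Delta>}"
    by (rule abs_summable_summable)
  then have lim: "(sum t \<longlongrightarrow> formal_generator (\<lambda>\<Delta> \<eta> \<xi>. r (\<Delta>, \<xi>) \<eta>) f \<eta>) (finite_subsets_at_top {\<Delta>. finite \<Delta>})"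
    unfolding formal_generator_def t_def[symmetric] by (simp add: has_sum_infsum flip: has_sum_def)
  have "\<forall>\<^sub>F F in finite_subsets_at_top {\<Delta>. finite \<Delta>}.
      \<bar>sum t F - gen (level n) f \<eta>\<bar> \<le> C * M * exp (- \<alpha> * (real n - L))"
    unfolding eventually_finite_subsets_at_top
  proof (intro exI[of _ "Pow (window n)"] conjI allI impI)
    show "Pow (window n) \<subseteq> {\<Delta>. finite \<Delta>}"
      using finite_subset[OF _ finite_window] by auto
    fix F assume F: "finite F \<and> Pow (window n) \<subseteq> F \<and> F \<subseteq> {\<Delta>. finite \<Delta>}"
    then have "level n \<subseteq> J F" by (auto simp: level_def J_def jumps_def)
    with F J[of F] show "\<bar>sum t F - gen (level n) f \<eta>\<bar> \<le> C * M * exp (- \<alpha> * (real n - L))"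
      using gen_level_far[OF f, of "J F" n \<eta>] sum_t[of F] by simp
  qed simp
  moreover have "((\<lambda>F. \<bar>sum t F - gen (level n) f \<eta>\<bar>) \<longlongrightarrow>
      \<bar>formal_generator (\<lambda>\<Delta> \<eta> \<xi>. r (\<Delta>, \<xi>) \<eta>) f \<eta> - gen (level n) f \<eta>\<bar>) (finite_subsets_at_top {\<Delta>. finite \<Delta>})"
    by (intro tendsto_intros lim)
  ultimately show ?thesis
    by (intro tendsto_upperbound) auto
qed

lemma exp_level_tendsto: "(\<lambda>n. a * exp (- \<alpha> * (real n - L))) \<longlonglongrightarrow> 0"
proof -
  have "exp (- \<alpha> * (real n - L)) = exp (\<alpha> * L) * exp (- \<alpha>) ^ n" for n
    by (simp add: algebra_simps flip: exp_of_nat_mult exp_add)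
  then show ?thesis
    using \<alpha>_pos by (simp add: tendsto_mult_right_zero LIMSEQ_power_zero)
qed

lemma continuous_formal_generator:
  assumes f: "tame \<alpha> M f" "continuous_on UNIV f"
  shows "continuous_on UNIV (formal_generator (\<lambda>\<Delta> \<eta> \<xi>. r (\<Delta>, \<xi>) \<eta>) f)"
proof (rule uniform_limit_theorem)
  show "\<forall>\<^sub>F n in sequentially. continuous_on UNIV (gen (level n) f)"
    using continuous_gen[OF level_subset f(2)] by simp
  show "uniform_limit UNIV (\<lambda>n. gen (level n) f) (formal_generator (\<lambda>\<Delta> \<eta> \<xi>. r (\<Delta>, \<xi>) \<eta>) f) sequentially"
    unfolding uniform_limit_iff
  proof (intro allI impI)
    fix e :: real assume "0 < e"
    with exp_level_tendsto[of "C * M"] have "\<forall>\<^sub>F n in sequentially. C * M * exp (- \<alpha> * (real n - L)) < e"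
      by (rule order_tendstoD)
    then show "\<forall>\<^sub>F n in sequentially. \<forall>\<eta>\<in>UNIV.
        dist (gen (level n) f \<eta>) (formal_generator (\<lambda>\<Delta> \<eta> \<xi>. r (\<Delta>, \<xi>) \<eta>) f \<eta>) < e"
    proof eventually_elim
      case (elim n)
      then show ?case
        using formal_generator_approx[OF f(1), of _ n] by (auto simp: dist_real_def abs_minus_commute intro: le_less_trans)
    qed
  qed
qed simp

lemma generator_graph_tame:
  assumes f: "tame \<alpha> M (apply_bcontfun f)"
  shows "\<exists>g. (f, g) \<in> generator_graph (\<lambda>\<Delta> \<eta> \<xi>. r (\<Delta>, \<xi>) \<eta>) \<and>
    (\<forall>n \<eta>. \<bar>apply_bcontfun g \<eta> - gen (level n) (apply_bcontfun f) \<eta>\<bar> \<le> C * M * exp (- \<alpha> * (real n - L)))"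
proof (intro exI[of _ "Bcontfun (formal_generator (\<lambda>\<Delta> \<eta> \<xi>. r (\<Delta>, \<xi>) \<eta>) (apply_bcontfun f))"] conjI allI)
  have *: "apply_bcontfun (Bcontfun (formal_generator (\<lambda>\<Delta> \<eta> \<xi>. r (\<Delta>, \<xi>) \<eta>) (apply_bcontfun f)))
    = formal_generator (\<lambda>\<Delta> \<eta> \<xi>. r (\<Delta>, \<xi>) \<eta>) (apply_bcontfun f)"
    by (intro apply_Bcontfun continuous_formal_generator[OF f]) simp
  show "(f, Bcontfun (formal_generator (\<lambda>\<Delta> \<eta> \<xi>. r (\<Delta>, \<xi>) \<eta>) (apply_bcontfun f))) \<in> generator_graph (\<lambda>\<Delta> \<eta> \<xi>. r (\<Delta>, \<xi>) \<eta>)"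
    using tame_smooth[OF f \<alpha>_pos] by (simp add: generator_graph_def *)
  show "\<bar>apply_bcontfun (Bcontfun (formal_generator (\<lambda>\<Delta> \<eta> \<xi>. r (\<Delta>, \<xi>) \<eta>) (apply_bcontfun f))) \<eta>
      - gen (level n) (apply_bcontfun f) \<eta>\<bar> \<le> C * M * exp (- \<alpha> * (real n - L))" for n \<eta>
    unfolding * by (rule formal_generator_approx[OF f])
qed

end

section \<open>From the conditions on the rates to real-valued bounds\<close>

lemma sum_le_infsum_ennreal:
  fixes f :: "'a \<Rightarrow> ennreal"
  assumes "finite F" "F \<subseteq> A"
  shows "sum f F \<le> infsum f A"
proof -
  have "infsum f F \<le> infsum f A"
    by (rule infsum_mono_neutral) (use assms in \<open>auto simp: nonneg_summable_on_complete\<close>)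
  with assms show ?thesis by simp
qed

lemma sum_jumps_le_infsum:
  fixes g :: "int set \<Rightarrow> 'q::finite config \<Rightarrow> ennreal"
  assumes "finite I" "I \<subseteq> jumps"
  shows "(\<Sum>i\<in>{i \<in> I. x \<in> fst i}. g (fst i) (snd i))
    \<le> (\<Sum>\<^sub>\<infinity>\<Delta>\<in>{\<Delta>. finite \<Delta> \<and> x \<in> \<Delta>}. \<Sum>\<xi>\<in>local_configs \<Delta>. g \<Delta> \<xi>)"
proof -
  define F where "F = fst ` {i \<in> I. x \<in> fst i}"
  have F: "finite F" "F \<subseteq> {\<Delta>. finite \<Delta> \<and> x \<in> \<Delta>}"
    using assms by (auto simp: F_def jumps_def)
  have "(\<Sum>i\<in>{i \<in> I. x \<in> fst i}. g (fst i) (snd i)) \<le> (\<Sum>i\<in>(SIGMA \<Delta>:F. local_configs \<Delta>). g (fst i) (snd i))"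
  proof (rule sum_mono2)
    show "finite (Sigma F (local_configs :: int set \<Rightarrow> 'q config set))"
      using F by (intro finite_SigmaI finite_local_configs) auto
    show "{i \<in> I. x \<in> fst i} \<subseteq> (SIGMA \<Delta>:F. local_configs \<Delta>)"
      using assms by (force simp: F_def jumps_def)
  qed simp
  also have "\<dots> = (\<Sum>\<Delta>\<in>F. \<Sum>\<xi>\<in>local_configs \<Delta>. g \<Delta> \<xi>)"
    using F by (subst sum.Sigma) (auto simp: split_beta finite_local_configs)
  also have "\<dots> \<le> (\<Sum>\<^sub>\<infinity>\<Delta>\<in>{\<Delta>. finite \<Delta> \<and> x \<in> \<Delta>}. \<Sum>\<xi>\<in>local_configs \<Delta>. g \<Delta> \<xi>)"
    using F by (intro sum_le_infsum_ennreal) auto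
  finally show ?thesis .
qed

text \<open>The extended suprema in the conditions become real constants once they are known to be
  finite. Finiteness for a single jump follows from the sum at any of its sites, which is why a jump
  must act on at least one site.\<close>

lemma jump_rates_of_conditions:
  fixes c :: "'q::finite rates"
  assumes \<alpha>: "0 < \<alpha>" and adm: "admissible_rates c" and L1: "condition_L1 c" and R1: "condition_R1 L c"
    and R3: "condition_R3 (\<lambda>r. exp (- \<alpha> * r)) c"
  shows "\<exists>b v C K. jump_rates (\<lambda>i \<eta>. c (fst i) \<eta> (snd i)) b v \<alpha> C K L"
proof -
  define N where "N i = sup_norm (\<lambda>\<eta>. c (fst i) \<eta> (snd i))" for i
  define b where "b i = enn2real (N i)" for i
  define v where "v i y = enn2real (oscillation y (\<lambda>\<eta>. c (fst i) \<eta> (snd i)))" for i y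
  define C' where "C' = (SUP x. \<Sum>\<^sub>\<infinity>\<Delta>\<in>{\<Delta>. finite \<Delta> \<and> x \<in> \<Delta>}. \<Sum>\<xi>\<in>local_configs \<Delta>. sup_norm (\<lambda>\<eta>. c \<Delta> \<eta> \<xi>))"
  define K' where "K' = (SUP x. \<Sum>\<^sub>\<infinity>y. influence c x y / ennreal (exp (- \<alpha> * site_dist x y)))"
  have C': "C' < \<infinity>" using L1 by (simp add: condition_L1_def C'_def)
  have K': "K' < \<infinity>" using R3 by (simp add: condition_R3_def K'_def)
  have b0: "0 \<le> b i" for i by (simp add: b_def)
  have N_sum: "(\<Sum>i\<in>{i \<in> I. x \<in> fst i}. N i) \<le> C'" if "finite I" "I \<subseteq> jumps" for I x
    using sum_jumps_le_infsum[OF that, where x = x and g = "\<lambda>\<Delta> \<xi>. sup_norm (\<lambda>\<eta>. c \<Delta> \<eta> \<xi>)"]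
    unfolding C'_def N_def by (rule order_trans) (rule SUP_upper, simp)
  have N: "N i = ennreal (b i)" if i: "i \<in> jumps" for i
  proof -
    obtain x where "x \<in> fst i" using i by (auto simp: jumps_def)
    then have "{j \<in> {i}. x \<in> fst j} = {i}" by auto
    then have "N i \<le> C'" using N_sum[of "{i}" x] i by simp
    then have "N i < \<infinity>" using C' by (rule le_less_trans)
    then show ?thesis by (simp add: b_def)
  qed
  have adm': "continuous_on UNIV (\<lambda>\<eta>. c (fst i) \<eta> (snd i))" "0 \<le> c (fst i) \<eta> (snd i)" if "i \<in> jumps" for i \<eta>
    using adm that by (auto simp: admissible_rates_def jumps_def)
  have le: "c (fst i) \<eta> (snd i) \<le> b i" if i: "i \<in> jumps" for i \<eta>
  proof -
    have "ennreal \<bar>c (fst i) \<eta> (snd i)\<bar> \<le> N i"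
      unfolding N_def sup_norm_def by (rule SUP_upper) simp
    then show ?thesis unfolding N[OF i] using b0[of i] by simp
  qed
  \<comment> \<open>The rate takes its values between 0 and b i, so two of its values differ by at
    most b i.\<close>
  have osc_le: "oscillation y (\<lambda>\<eta>. c (fst i) \<eta> (snd i)) \<le> ennreal (b i)" if i: "i \<in> jumps" for i y
    unfolding oscillation_def
  proof (rule SUP_least, clarify)
    fix \<eta> \<xi>
    show "ennreal \<bar>c (fst i) \<eta> (snd i) - c (fst i) \<xi> (snd i)\<bar> \<le> ennreal (b i)"
      using le[OF i, of \<eta>] le[OF i, of \<xi>] adm'(2)[OF i, of \<eta>] adm'(2)[OF i, of \<xi>] by (intro ennreal_leI) linarith
  qed
  have osc: "oscillation y (\<lambda>\<eta>. c (fst i) \<eta> (snd i)) = ennreal (v i y)" if i: "i \<in> jumps" for i y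
    using le_less_trans[OF osc_le[OF i, of y] ennreal_less_top] by (simp add: v_def)
  have v_le: "v i y \<le> b i" if i: "i \<in> jumps" for i y
    using osc_le[OF i, of y] unfolding osc[OF i] using b0[of i] by simp
  have v0: "0 \<le> v i y" for i y by (simp add: v_def)
  have bound: "(\<Sum>i\<in>{i \<in> I. x \<in> fst i}. b i) \<le> enn2real C'" if I: "finite I" "I \<subseteq> jumps" for I x
  proof -
    have "(\<Sum>i\<in>{i \<in> I. x \<in> fst i}. N i) = (\<Sum>i\<in>{i \<in> I. x \<in> fst i}. ennreal (b i))"
      using I by (intro sum.cong refl N) auto
    then have "ennreal (\<Sum>i\<in>{i \<in> I. x \<in> fst i}. b i) = (\<Sum>i\<in>{i \<in> I. x \<in> fst i}. N i)"
      using b0 by simp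
    also have "\<dots> \<le> ennreal (enn2real C')" using N_sum[OF I] C' by simp
    finally show ?thesis by simp
  qed
  have "jump_rates (\<lambda>i \<eta>. c (fst i) \<eta> (snd i)) b v \<alpha> (enn2real C') (enn2real K' + enn2real C') L"
  proof
    show "has_osc (v i) (\<lambda>\<eta>. c (fst i) \<eta> (snd i))" if i: "i \<in> jumps" for i
      unfolding has_osc_def
    proof (intro allI impI)
      fix x and \<eta> \<xi> :: "'q config" assume "\<forall>z. z \<noteq> x \<longrightarrow> \<eta> z = \<xi> z"
      then have "ennreal \<bar>c (fst i) \<eta> (snd i) - c (fst i) \<xi> (snd i)\<bar> \<le> oscillation x (\<lambda>\<eta>. c (fst i) \<eta> (snd i))"
        unfolding oscillation_def by (intro SUP_upper2[of "(\<eta>, \<xi>)"]) auto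
      then show "\<bar>c (fst i) \<eta> (snd i) - c (fst i) \<xi> (snd i)\<bar> \<le> v i x"
        unfolding osc[OF i] using v0 by simp
    qed
    show "real_of_int \<bar>x - y\<bar> \<le> L"
      if i: "i \<in> jumps" "x \<in> fst i" "y \<in> fst i" "c (fst i) \<eta> (snd i) \<noteq> 0" for i x y \<eta>
    proof -
      have "finite (fst i)" "snd i \<in> local_configs (fst i)" using i by (auto simp: jumps_def)
      then have "diameter (real_of_int ` fst i) < L"
        using R1 i(4) unfolding condition_R1_def by (meson not_le)
      moreover have "dist (real_of_int x) (real_of_int y) \<le> diameter (real_of_int ` fst i)"
        using \<open>finite (fst i)\<close> i by (intro diameter_bounded_bound finite_imp_bounded) auto
      ultimately show ?thesis by (simp add: dist_real_def)
    qed
    fix I :: "(int set \<times> 'q config) set" and Y :: "int set" and x :: int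
    assume I: "finite I" "I \<subseteq> jumps" and Y: "finite Y"
    define V where "V y = (\<Sum>i\<in>{i \<in> I. x \<in> fst i}. v i y)" for y
    have V0: "0 \<le> V y" for y by (simp add: V_def v0 sum_nonneg)
    have V_osc: "ennreal (V y) \<le> influence c x y" if "y \<noteq> x" for y
    proof -
      have "(\<Sum>i\<in>{i \<in> I. x \<in> fst i}. oscillation y (\<lambda>\<eta>. c (fst i) \<eta> (snd i)))
          = (\<Sum>i\<in>{i \<in> I. x \<in> fst i}. ennreal (v i y))"
        using I by (intro sum.cong refl osc) auto
      then have "ennreal (V y) = (\<Sum>i\<in>{i \<in> I. x \<in> fst i}. oscillation y (\<lambda>\<eta>. c (fst i) \<eta> (snd i)))"
        unfolding V_def using v0 by simp
      also have "\<dots> \<le> influence c x y"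
        using that sum_jumps_le_infsum[OF I, where x = x and g = "\<lambda>\<Delta> \<xi>. oscillation y (\<lambda>\<eta>. c \<Delta> \<eta> \<xi>)"]
        by (auto simp: influence_def)
      finally show ?thesis .
    qed
    have "ennreal (\<Sum>y\<in>Y - {x}. exp (\<alpha> * real_of_int \<bar>x - y\<bar>) * V y)
        = (\<Sum>y\<in>Y - {x}. ennreal (V y) / ennreal (exp (- \<alpha> * site_dist x y)))"
      using V0 by (subst sum_ennreal[symmetric])
        (auto simp: divide_ennreal site_dist_def exp_minus field_simps intro!: sum.cong)
    also have "\<dots> \<le> (\<Sum>y\<in>Y - {x}. influence c x y / ennreal (exp (- \<alpha> * site_dist x y)))"
      using V_osc by (intro sum_mono divide_right_mono_ennreal) auto
    also have "\<dots> \<le> (\<Sum>\<^sub>\<infinity>y. influence c x y / ennreal (exp (- \<alpha> * site_dist x y)))"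
      using Y by (intro sum_le_infsum_ennreal) auto
    also have "\<dots> \<le> K'" unfolding K'_def by (rule SUP_upper) simp
    also have "\<dots> = ennreal (enn2real K')" using K' by simp
    finally have off: "(\<Sum>y\<in>Y - {x}. exp (\<alpha> * real_of_int \<bar>x - y\<bar>) * V y) \<le> enn2real K'"
      by simp
    \<comment> \<open>(R3) says nothing about the diagonal term; it has weight 1 and is bounded by
      (L1), which explains the second summand of the constant.\<close>
    have "V x \<le> (\<Sum>i\<in>{i \<in> I. x \<in> fst i}. b i)"
      unfolding V_def using I v_le by (intro sum_mono) auto
    also have "\<dots> \<le> enn2real C'" by (rule bound[OF I])
    finally have diag: "V x \<le> enn2real C'" .
    have "(\<Sum>y\<in>Y. exp (\<alpha> * real_of_int \<bar>x - y\<bar>) * V y) \<le> (\<Sum>y\<in>insert x Y. exp (\<alpha> * real_of_int \<bar>x - y\<bar>) * V y)"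
      using Y V0 by (intro sum_mono2) auto
    also have "\<dots> = V x + (\<Sum>y\<in>Y - {x}. exp (\<alpha> * real_of_int \<bar>x - y\<bar>) * V y)"
      using Y by (subst sum.insert_remove) auto
    also have "\<dots> \<le> enn2real K' + enn2real C'" using diag off by simp
    finally show "(\<Sum>y\<in>Y. exp (\<alpha> * real_of_int \<bar>x - y\<bar>) * (\<Sum>i\<in>{i \<in> I. x \<in> fst i}. v i y))
        \<le> enn2real K' + enn2real C'"
      unfolding V_def .
  qed (use \<alpha> adm' le bound in auto)
  then show ?thesis by blast
qed

subsection \<open>Euler scheme and the cost of a time change\<close>

context jump_rates
begin

text \<open>The step with k = 0 acts on the observable itself and so stands for the last time
  interval of the process: the index runs backwards in time. Variable step sizes encode the time
  change.\<close>

primrec euler :: "(int set \<times> 'q config) set \<Rightarrow> (nat \<Rightarrow> real) \<Rightarrow> ('q config \<Rightarrow> real) \<Rightarrow> nat \<Rightarrow> 'q config \<Rightarrow> real" where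
  "euler I h f 0 = f"
| "euler I h f (Suc k) = (\<lambda>\<eta>. euler I h f k \<eta> + h k * gen I (euler I h f k) \<eta>)"

lemma tame_mono: "tame \<alpha> M f \<Longrightarrow> M \<le> M' \<Longrightarrow> tame \<alpha> M' f"
  unfolding tame_def by (meson order_trans)

lemma continuous_euler:
  assumes "I \<subseteq> jumps" "continuous_on UNIV f"
  shows "continuous_on UNIV (euler I h f k)"
proof (induction k)
  case (Suc k)
  then show ?case
    using continuous_gen[OF assms(1) Suc] by (auto intro!: continuous_on_add continuous_on_mult_left)
qed (simp add: assms)

lemma euler_iterate_bound:
  assumes "finite I" "I \<subseteq> jumps" "\<And>k. 0 \<le> h k" "\<And>k. h k * (\<Sum>i\<in>I. b i) \<le> 1" "\<And>\<eta>. \<bar>f \<eta>\<bar> \<le> B"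
  shows "\<bar>euler I h f k \<eta>\<bar> \<le> B"
proof (induction k arbitrary: \<eta>)
  case (Suc k)
  show ?case unfolding euler.simps by (rule euler_bound[OF assms(1-4) Suc])
qed (simp add: assms)

lemma euler_iterate_tame:
  assumes I: "finite I" "I \<subseteq> jumps" and h: "\<And>k. 0 \<le> h k" "\<And>k. h k * (\<Sum>i\<in>I. b i) \<le> 1"
    and f: "tame \<alpha> M f"
  shows "tame \<alpha> (M * exp (K * (\<Sum>j<k. h j))) (euler I h f k)"
proof (induction k)
  case (Suc k)
  have "(1 + h k * K) * (M * exp (K * (\<Sum>j<k. h j))) \<le> exp (h k * K) * (M * exp (K * (\<Sum>j<k. h j)))"
    using tame_nonneg[OF f] by (intro mult_right_mono exp_ge_add_one_self) auto
  also have "\<dots> = M * exp (K * (\<Sum>j<Suc k. h j))"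
    by (simp add: algebra_simps exp_add)
  finally show ?case
    unfolding euler.simps by (rule tame_mono[OF euler_tame[OF Suc I h]])
qed (simp add: f)

lemma gen_add_const: "gen I (\<lambda>\<eta>. f \<eta> + a) = gen I f"
  by (simp add: gen_def fun_eq_iff)

text \<open>
  With \<open>D\<close> the increment of \<open>u\<close> along a jump, \<open>D\<^sup>2 - 2 e u D \<ge> - e\<^sup>2 u\<^sup>2\<close>: speeding up time by the factor
  \<open>1 + e\<close> costs only second order in \<open>e\<close> for each of the jumps near the origin.
\<close>

lemma square_step:
  assumes I: "finite I" "I \<subseteq> jumps" and e: "0 \<le> e" and h: "0 \<le> h"
    and u: "tame \<alpha> M u" "\<And>\<eta>. \<bar>u \<eta>\<bar> \<le> B"
  shows "(u \<eta> + h * (1 + e) * gen I u \<eta>)\<^sup>2 \<le> ((u \<eta>)\<^sup>2 + h * gen I (\<lambda>\<eta>. (u \<eta>)\<^sup>2) \<eta>)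
    + (h * (e\<^sup>2 * ((2 * real m + 1) * C * B\<^sup>2) + 2 * e * B * (C * M * exp (- \<alpha> * real m)))
      + h\<^sup>2 * ((1 + e)\<^sup>2 * (2 * B * (\<Sum>i\<in>I. b i))\<^sup>2))"
proof -
  define D where "D i = u (jump i \<eta>) - u \<eta>" for i
  define near where "near = {i \<in> I. fst i \<inter> window m \<noteq> {}}"
  define far where "far = I - near"
  have nf: "I = near \<union> far" "near \<inter> far = {}" "finite near" "finite far" "near \<subseteq> jumps" "far \<subseteq> jumps"
    using I by (auto simp: near_def far_def)
  have r0: "0 \<le> r i \<eta>" if "i \<in> I" for i using that I rate_nonneg by blast
  have B: "0 \<le> B" using u(2)[of \<eta>] by linarith
  \<comment> \<open>Each near jump is counted at least once at a site of the window, and each of the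
    2 m + 1 sites carries total rate at most C. Dimension one enters through this linear
    count.\<close>
  have near_r: "(\<Sum>i\<in>near. r i \<eta>) \<le> (2 * real m + 1) * C"
  proof -
    have "(\<Sum>i\<in>near. r i \<eta>) \<le> (\<Sum>i\<in>near. \<Sum>x\<in>{x \<in> window m. x \<in> fst i}. b i)"
    proof (rule sum_mono)
      fix i assume i: "i \<in> near"
      then have ij: "i \<in> jumps" using nf by blast
      have "{x \<in> window m. x \<in> fst i} \<noteq> {}" using i by (auto simp: near_def)
      then have "0 < card {x \<in> window m. x \<in> fst i}" by (subst card_gt_0_iff) auto
      then have "1 * b i \<le> real (card {x \<in> window m. x \<in> fst i}) * b i"
        using bound_nonneg[OF ij] by (intro mult_right_mono) auto
      then show "r i \<eta> \<le> (\<Sum>x\<in>{x \<in> window m. x \<in> fst i}. b i)"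
        using rate_le[OF ij, of \<eta>] by simp
    qed
    also have "\<dots> = (\<Sum>x\<in>window m. \<Sum>i\<in>{i \<in> near. x \<in> fst i}. b i)"
      by (rule sum.swap_restrict[OF nf(3) finite_window])
    also have "\<dots> \<le> (\<Sum>x\<in>window m. C)"
      by (intro sum_mono bound_sum nf)
    also have "\<dots> = (2 * real m + 1) * C"
      by (simp add: window_def)
    finally show ?thesis .
  qed
  have far_r: "(\<Sum>i\<in>far. r i \<eta> * \<bar>D i\<bar>) \<le> C * M * exp (- \<alpha> * real m)"
    unfolding D_def
  proof (rule sum_jumps_far[OF u(1) nf(4,6)])
    fix i x assume "i \<in> far" "x \<in> fst i"
    then have "x \<notin> window m" by (auto simp: far_def near_def)
    then show "real m \<le> real_of_int \<bar>x\<bar>" by (auto simp: window_def)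
  qed
  have near_bd: "- (e\<^sup>2 * ((2 * real m + 1) * C * B\<^sup>2)) \<le> (\<Sum>i\<in>near. r i \<eta> * ((D i)\<^sup>2 - 2 * e * u \<eta> * D i))"
  proof -
    have uB: "(u \<eta>)\<^sup>2 \<le> B\<^sup>2" using u(2)[of \<eta>] B by (simp add: power2_le_iff_abs_le)
    have "(e\<^sup>2 * B\<^sup>2) * (\<Sum>i\<in>near. r i \<eta>) \<le> (e\<^sup>2 * B\<^sup>2) * ((2 * real m + 1) * C)"
      using near_r by (intro mult_left_mono) auto
    then have "- (e\<^sup>2 * ((2 * real m + 1) * C * B\<^sup>2)) \<le> - ((e\<^sup>2 * B\<^sup>2) * (\<Sum>i\<in>near. r i \<eta>))"
      by (simp add: mult_ac)
    also have "\<dots> = (\<Sum>i\<in>near. r i \<eta> * (- (e\<^sup>2 * B\<^sup>2)))"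
      by (simp add: sum_distrib_left sum_negf mult_ac)
    also have "\<dots> \<le> (\<Sum>i\<in>near. r i \<eta> * ((D i)\<^sup>2 - 2 * e * u \<eta> * D i))"
    proof (intro sum_mono mult_left_mono)
      fix i
      have "0 \<le> (D i - e * u \<eta>)\<^sup>2" by simp
      also have "\<dots> = ((D i)\<^sup>2 - 2 * e * u \<eta> * D i) + e\<^sup>2 * (u \<eta>)\<^sup>2"
        by (simp add: power2_eq_square algebra_simps)
      also have "\<dots> \<le> ((D i)\<^sup>2 - 2 * e * u \<eta> * D i) + e\<^sup>2 * B\<^sup>2"
        using uB by (intro add_left_mono mult_left_mono) auto
      finally show "- (e\<^sup>2 * B\<^sup>2) \<le> (D i)\<^sup>2 - 2 * e * u \<eta> * D i" by linarith
    qed (use r0 nf in auto)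
    finally show ?thesis .
  qed
  \<comment> \<open>For far jumps the square of D is dropped; the linear term is already small
    because u hardly depends on distant sites.\<close>
  have far_bd: "- (2 * e * B * (C * M * exp (- \<alpha> * real m))) \<le> (\<Sum>i\<in>far. r i \<eta> * ((D i)\<^sup>2 - 2 * e * u \<eta> * D i))"
  proof -
    have "(2 * e * B) * (\<Sum>i\<in>far. r i \<eta> * \<bar>D i\<bar>) \<le> (2 * e * B) * (C * M * exp (- \<alpha> * real m))"
      using far_r e B by (intro mult_left_mono) auto
    then have "- (2 * e * B * (C * M * exp (- \<alpha> * real m))) \<le> - ((2 * e * B) * (\<Sum>i\<in>far. r i \<eta> * \<bar>D i\<bar>))"
      by simp
    also have "\<dots> = (\<Sum>i\<in>far. r i \<eta> * (- (2 * e * B * \<bar>D i\<bar>)))"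
      by (simp add: sum_distrib_left sum_negf mult_ac)
    also have "\<dots> \<le> (\<Sum>i\<in>far. r i \<eta> * ((D i)\<^sup>2 - 2 * e * u \<eta> * D i))"
    proof (intro sum_mono mult_left_mono)
      fix i
      have "\<bar>u \<eta>\<bar> * \<bar>D i\<bar> \<le> B * \<bar>D i\<bar>" using u(2) by (intro mult_right_mono) auto
      moreover have "u \<eta> * D i \<le> \<bar>u \<eta>\<bar> * \<bar>D i\<bar>" by (metis abs_ge_self abs_mult)
      ultimately have "u \<eta> * D i \<le> B * \<bar>D i\<bar>" by linarith
      then have "(2 * e) * (u \<eta> * D i) \<le> (2 * e) * (B * \<bar>D i\<bar>)"
        using e by (intro mult_left_mono) auto
      then show "- (2 * e * B * \<bar>D i\<bar>) \<le> (D i)\<^sup>2 - 2 * e * u \<eta> * D i"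
        using zero_le_power2[of "D i"] unfolding mult.assoc by linarith
    qed (use r0 nf in auto)
    finally show ?thesis .
  qed
  have gD: "\<bar>gen I u \<eta>\<bar> \<le> 2 * B * (\<Sum>i\<in>I. b i)"
  proof -
    have "\<bar>gen I u \<eta>\<bar> \<le> (\<Sum>i\<in>I. r i \<eta> * \<bar>D i\<bar>)"
      unfolding D_def by (rule gen_abs_le_sum[OF I(2)])
    also have "\<dots> \<le> (\<Sum>i\<in>I. b i * (2 * B))"
    proof (intro sum_mono mult_mono)
      fix i assume "i \<in> I"
      then have i: "i \<in> jumps" using I by blast
      show "r i \<eta> \<le> b i" "0 \<le> b i" using rate_le[OF i] bound_nonneg[OF i] by auto
      show "\<bar>D i\<bar> \<le> 2 * B" unfolding D_def using u(2)[of "jump i \<eta>"] u(2)[of \<eta>] by linarith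
    qed simp
    finally show ?thesis unfolding sum_distrib_right[symmetric] by (simp add: mult_ac)
  qed
  have gen_u: "gen I u \<eta> = (\<Sum>i\<in>I. r i \<eta> * D i)" by (simp add: gen_def D_def)
  \<comment> \<open>The last sum is the carre du champ of u, the gain that has to absorb the extra
    drift 2 e u times the generator of u.\<close>
  have gen_uu: "gen I (\<lambda>\<eta>. (u \<eta>)\<^sup>2) \<eta> = 2 * u \<eta> * gen I u \<eta> + (\<Sum>i\<in>I. r i \<eta> * (D i)\<^sup>2)"
    unfolding gen_u sum_distrib_left sum.distrib[symmetric]
    unfolding gen_def D_def by (intro sum.cong refl) (simp add: power2_eq_square algebra_simps)
  have key: "(\<Sum>i\<in>I. r i \<eta> * ((D i)\<^sup>2 - 2 * e * u \<eta> * D i))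
      = gen I (\<lambda>\<eta>. (u \<eta>)\<^sup>2) \<eta> - 2 * (1 + e) * u \<eta> * gen I u \<eta>"
  proof -
    have "(\<Sum>i\<in>I. r i \<eta> * ((D i)\<^sup>2 - 2 * e * u \<eta> * D i)) = (\<Sum>i\<in>I. r i \<eta> * (D i)\<^sup>2) - 2 * e * u \<eta> * gen I u \<eta>"
      unfolding gen_u sum_distrib_left sum_subtractf[symmetric]
      by (intro sum.cong refl) (simp add: algebra_simps)
    then show ?thesis by (simp add: gen_uu algebra_simps)
  qed
  have "(\<Sum>i\<in>I. r i \<eta> * ((D i)\<^sup>2 - 2 * e * u \<eta> * D i))
      = (\<Sum>i\<in>near. r i \<eta> * ((D i)\<^sup>2 - 2 * e * u \<eta> * D i)) + (\<Sum>i\<in>far. r i \<eta> * ((D i)\<^sup>2 - 2 * e * u \<eta> * D i))"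
    by (subst nf(1)) (rule sum.union_disjoint[OF nf(3,4,2)])
  then have "2 * (1 + e) * u \<eta> * gen I u \<eta> \<le> gen I (\<lambda>\<eta>. (u \<eta>)\<^sup>2) \<eta>
      + (e\<^sup>2 * ((2 * real m + 1) * C * B\<^sup>2) + 2 * e * B * (C * M * exp (- \<alpha> * real m)))" (is "?l \<le> ?g + ?E")
    using near_bd far_bd key by linarith
  then have hl: "h * ?l \<le> h * (?g + ?E)"
    using h by (rule mult_left_mono)
  have "(gen I u \<eta>)\<^sup>2 \<le> (2 * B * (\<Sum>i\<in>I. b i))\<^sup>2"
    using gD by (metis abs_le_square_iff abs_of_nonneg order_trans abs_ge_zero)
  then have sq: "h\<^sup>2 * ((1 + e)\<^sup>2 * (gen I u \<eta>)\<^sup>2) \<le> h\<^sup>2 * ((1 + e)\<^sup>2 * (2 * B * (\<Sum>i\<in>I. b i))\<^sup>2)"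
    by (intro mult_left_mono) auto
  \<comment> \<open>The quadratic term in h is a discretisation error: for a fixed I its total over
    a fixed time span vanishes with h.\<close>
  have "(u \<eta> + h * (1 + e) * gen I u \<eta>)\<^sup>2 = (u \<eta>)\<^sup>2 + h * ?l + h\<^sup>2 * ((1 + e)\<^sup>2 * (gen I u \<eta>)\<^sup>2)"
    by (simp add: power2_eq_square algebra_simps)
  with hl sq show ?thesis by (simp add: distrib_left)
qed

text \<open>The error of each step is a constant, and constants are annihilated by the generator.
  Monotonicity of the Euler step therefore carries the accumulated errors along unchanged, and they
  simply add up.\<close>

lemma square_iterate:
  fixes e :: "nat \<Rightarrow> real" and m :: "nat \<Rightarrow> nat"
  assumes I: "finite I" "I \<subseteq> jumps" and e: "\<And>k. 0 \<le> e k" and h: "0 \<le> h"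
    and small: "\<And>k. h * (1 + e k) * (\<Sum>i\<in>I. b i) \<le> 1"
    and f: "tame \<alpha> M f" "\<And>\<eta>. \<bar>f \<eta>\<bar> \<le> B"
  shows "(euler I (\<lambda>k. h * (1 + e k)) f k \<eta>)\<^sup>2 \<le> euler I (\<lambda>_. h) (\<lambda>\<eta>. (f \<eta>)\<^sup>2) k \<eta> +
    (\<Sum>j<k. h * ((e j)\<^sup>2 * ((2 * real (m j) + 1) * C * B\<^sup>2)
        + 2 * e j * B * (C * (M * exp (K * (\<Sum>l<j. h * (1 + e l)))) * exp (- \<alpha> * real (m j))))
      + h\<^sup>2 * ((1 + e j)\<^sup>2 * (2 * B * (\<Sum>i\<in>I. b i))\<^sup>2))" (is "_ \<le> _ + (\<Sum>j<k. ?\<delta> j)")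
proof (induction k arbitrary: \<eta>)
  case (Suc k)
  let ?u = "euler I (\<lambda>k. h * (1 + e k)) f k"
  let ?v = "euler I (\<lambda>_. h) (\<lambda>\<eta>. (f \<eta>)\<^sup>2) k"
  have h': "0 \<le> h * (1 + e k)" for k using h e[of k] by simp
  have b0: "0 \<le> (\<Sum>i\<in>I. b i)" using I bound_nonneg by (intro sum_nonneg) auto
  have "h * 1 \<le> h * (1 + e k)" using h e[of k] by (intro mult_left_mono) auto
  then have "h * (\<Sum>i\<in>I. b i) \<le> h * (1 + e k) * (\<Sum>i\<in>I. b i)"
    using b0 by (intro mult_right_mono) auto
  then have small': "h * (\<Sum>i\<in>I. b i) \<le> 1" using small[of k] by linarith
  have "(?u \<eta> + h * (1 + e k) * gen I ?u \<eta>)\<^sup>2 \<le> ((?u \<eta>)\<^sup>2 + h * gen I (\<lambda>\<eta>. (?u \<eta>)\<^sup>2) \<eta>) + ?\<delta> k"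
    by (intro square_step[OF I e h euler_iterate_tame[OF I h' small f(1)] euler_iterate_bound[OF I h' small f(2)]])
  moreover have "(?u \<eta>)\<^sup>2 + h * gen I (\<lambda>\<eta>. (?u \<eta>)\<^sup>2) \<eta>
      \<le> (?v \<eta> + (\<Sum>j<k. ?\<delta> j)) + h * gen I (\<lambda>\<eta>. ?v \<eta> + (\<Sum>j<k. ?\<delta> j)) \<eta>"
    by (intro euler_mono[OF I h small'] Suc.IH)
  ultimately show ?case
    unfolding gen_add_const by simp
qed simp

end

subsection \<open>The semigroup\<close>

lemma markov_semigroup_norm_le:
  fixes S :: "'q::finite semigroup"
  assumes "markov_semigroup S" "0 \<le> t"
  shows "norm (S t f) \<le> norm f"
proof (rule norm_bound)
  fix \<eta>
  have lin: "linear (S t)" using assms by (simp add: markov_semigroup_def)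
  have "linear (\<lambda>f. apply_bcontfun (S t f) \<eta>)"
    by (rule linearI) (simp_all add: linear_add[OF lin] linear_cmul[OF lin])
  then have "\<bar>apply_bcontfun (S t f) \<eta>\<bar> \<le> norm f"
  proof (rule positive_functional_norm_le)
    show "0 \<le> apply_bcontfun (S t f) \<eta>" if "\<And>\<eta>. 0 \<le> apply_bcontfun f \<eta>" for f
      using that assms by (simp add: markov_semigroup_def)
    show "apply_bcontfun (S t (const_bcontfun 1)) \<eta> = 1"
      using assms by (simp add: markov_semigroup_def const_bcontfun.rep_eq)
  qed
  then show "norm (apply_bcontfun (S t f) \<eta>) \<le> norm f" by simp
qed

text \<open>A mean value inequality: the derivative S t g stays within D of \<phi>. Telescoping over
  m + 1 equal steps reduces it to the derivative at time 0, which the contractions S t transport to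
  later times; then m tends to infinity.\<close>

lemma semigroup_increment:
  fixes S :: "'q::finite semigroup"
  assumes S: "markov_semigroup S" and fg: "(f, g) \<in> infinitesimal_generator S" and h: "0 \<le> h"
    and D: "\<And>t. 0 \<le> t \<Longrightarrow> t \<le> h \<Longrightarrow> norm (S t g - \<phi>) \<le> D"
  shows "norm (S h f - f - h *\<^sub>R \<phi>) \<le> h * D"
proof (cases "h = 0")
  case True
  then show ?thesis using S by (simp add: markov_semigroup_def)
next
  case False
  with h have h: "0 < h" by simp
  have lin: "linear (S t)" if "0 \<le> t" for t using S that by (simp add: markov_semigroup_def)
  have add: "S (s + t) f = S s (S t f)" if "0 \<le> s" "0 \<le> t" for s t
    using S that by (simp add: markov_semigroup_def)
  have S0: "S 0 f = f" using S by (simp add: markov_semigroup_def)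
  define a where "a m = norm ((S (h / real (Suc m)) f - f) /\<^sub>R (h / real (Suc m)) - g)" for m
  have "filterlim (\<lambda>m. h / real (Suc m)) (at_right 0) sequentially"
    unfolding filterlim_at
  proof
    show "\<forall>\<^sub>F m in sequentially. h / real (Suc m) \<in> {0<..} \<and> h / real (Suc m) \<noteq> 0"
      using h by simp
    show "(\<lambda>m. h / real (Suc m)) \<longlonglongrightarrow> 0"
      by (intro LIMSEQ_Suc lim_const_over_n)
  qed
  moreover have "((\<lambda>t. (S t f - f) /\<^sub>R t) \<longlongrightarrow> g) (at_right 0)"
    using fg by (simp add: infinitesimal_generator_def)
  ultimately have "(\<lambda>m. (S (h / real (Suc m)) f - f) /\<^sub>R (h / real (Suc m))) \<longlonglongrightarrow> g"
    by (rule filterlim_compose[rotated])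
  then have "a \<longlonglongrightarrow> norm (g - g)"
    unfolding a_def by (intro tendsto_norm tendsto_diff tendsto_const)
  then have a0: "a \<longlonglongrightarrow> 0" by simp
  have "norm (S h f - f - h *\<^sub>R \<phi>) \<le> h * (a m + D)" for m
  proof -
    let ?n = "Suc m"
    define d where "d = h / real ?n"
    have d: "0 < d" using h by (simp add: d_def)
    have nd: "real ?n * d = h" by (simp add: d_def)
    have "(\<Sum>j<?n. S (real (Suc j) * d) f - S (real j * d) f) = S (real ?n * d) f - S (real 0 * d) f"
      by (rule sum_lessThan_telescope)
    then have "S h f - f = (\<Sum>j<?n. S (real (Suc j) * d) f - S (real j * d) f)"
      by (simp only: nd S0 of_nat_0 mult_zero_left)
    moreover have "h *\<^sub>R \<phi> = (\<Sum>j<?n. d *\<^sub>R \<phi>)"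
      using nd by (simp only: sum_constant_scaleR card_lessThan scaleR_scaleR)
    ultimately have "S h f - f - h *\<^sub>R \<phi> = (\<Sum>j<?n. S (real (Suc j) * d) f - S (real j * d) f - d *\<^sub>R \<phi>)"
      by (simp only: sum_subtractf)
    also have "norm \<dots> \<le> (\<Sum>j<?n. d * (a m + D))"
    proof (rule sum_norm_le)
      fix j assume "j \<in> {..<?n}"
      then have "real j * d \<le> real ?n * d" using d by (intro mult_right_mono) auto
      then have j: "0 \<le> real j * d" "real j * d \<le> h" using d nd by auto
      have "S (real (Suc j) * d) f = S (real j * d) (S d f)"
        using add[of "real j * d" d] j d by (simp add: distrib_right add.commute)
      then have "S (real (Suc j) * d) f - S (real j * d) f - d *\<^sub>R \<phi>
          = d *\<^sub>R (S (real j * d) ((S d f - f) /\<^sub>R d - g) + (S (real j * d) g - \<phi>))"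
        using d by (simp add: linear_diff[OF lin[OF j(1)]] linear_cmul[OF lin[OF j(1)]] scaleR_diff_right scaleR_add_right)
      also have "norm \<dots> \<le> d * (a m + D)"
        unfolding norm_scaleR
        using d D[OF j] markov_semigroup_norm_le[OF S j(1), of "(S d f - f) /\<^sub>R d - g"]
        by (intro mult_mono order_trans[OF norm_triangle_ineq] add_mono) (auto simp: a_def d_def)
      finally show "norm (S (real (Suc j) * d) f - S (real j * d) f - d *\<^sub>R \<phi>) \<le> d * (a m + D)" .
    qed
    also have "\<dots> = h * (a m + D)"
      using nd by (simp only: sum_constant card_lessThan mult.assoc[symmetric])
    finally show ?thesis .
  qed
  moreover have "(\<lambda>m. h * (a m + D)) \<longlonglongrightarrow> h * (0 + D)"
    by (intro tendsto_intros a0)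
  ultimately show ?thesis
    by (intro LIMSEQ_le_const[of "\<lambda>m. h * (a m + D)"]) auto
qed

locale jump_semigroup = jump_rates r b v \<alpha> C K L
  for r :: "int set \<times> 'q::finite config \<Rightarrow> 'q config \<Rightarrow> real" and b v \<alpha> C K L +
  fixes S :: "'q semigroup"
  assumes semigroup: "markov_semigroup S"
    and generator: "generator_graph (\<lambda>\<Delta> \<eta> \<xi>. r (\<Delta>, \<xi>) \<eta>) \<subseteq> infinitesimal_generator S"
begin

lemma S_linear: "0 \<le> t \<Longrightarrow> linear (S t)"
  using semigroup by (simp add: markov_semigroup_def)

lemma S_add: "0 \<le> s \<Longrightarrow> 0 \<le> t \<Longrightarrow> S (s + t) f = S s (S t f)"
  using semigroup by (simp add: markov_semigroup_def)

lemma S_zero: "S 0 f = f"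
  using semigroup by (simp add: markov_semigroup_def)

lemma S_const: "0 \<le> t \<Longrightarrow> S t (const_bcontfun 1) = const_bcontfun 1"
  using semigroup by (simp add: markov_semigroup_def)

lemma S_norm_le: "0 \<le> t \<Longrightarrow> norm (S t f) \<le> norm f"
  using markov_semigroup_norm_le[OF semigroup] .

lemma tame_generator:
  assumes f: "tame \<alpha> M (apply_bcontfun f)"
  shows "\<exists>g. (f, g) \<in> infinitesimal_generator S \<and> norm g \<le> C * M \<and>
    (\<forall>n \<eta>. \<bar>apply_bcontfun g \<eta> - gen (level n) (apply_bcontfun f) \<eta>\<bar> \<le> C * M * exp (- \<alpha> * (real n - L)))"
proof -
  obtain g where g: "(f, g) \<in> infinitesimal_generator S"
    "\<And>n \<eta>. \<bar>apply_bcontfun g \<eta> - gen (level n) (apply_bcontfun f) \<eta>\<bar> \<le> C * M * exp (- \<alpha> * (real n - L))"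
    using generator_graph_tame[OF f] generator by blast
  have "norm g \<le> C * M"
  proof (rule norm_bound)
    fix \<eta>
    have "\<bar>apply_bcontfun g \<eta>\<bar> \<le> C * M + C * M * exp (- \<alpha> * (real n - L))" for n
      using g(2)[of \<eta> n] gen_abs_le_sum[OF level_subset[of n], of "apply_bcontfun f" \<eta>]
        sum_jumps[OF f finite_level[of n] level_subset[of n], where \<eta> = \<eta>] by linarith
    moreover have "(\<lambda>n. C * M + C * M * exp (- \<alpha> * (real n - L))) \<longlonglongrightarrow> C * M + 0"
      by (intro tendsto_intros exp_level_tendsto)
    ultimately show "norm (apply_bcontfun g \<eta>) \<le> C * M"
      by (intro LIMSEQ_le_const[of "\<lambda>n. C * M + C * M * exp (- \<alpha> * (real n - L))"]) auto
  qed
  with g show ?thesis by blast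
qed

text \<open>\<open>semigroup_increment\<close> is used twice. The truncated generator sends f to a
  tame function \<phi>, hence into the domain again, which makes S t \<phi> - \<phi> of order h. The
  true image g, for which no tame bound is at hand, enters only through its uniform distance from
  \<phi>.\<close>

lemma euler_error:
  assumes f: "tame \<alpha> M (apply_bcontfun f)" and h: "0 \<le> h"
  shows "norm (S h f - f - h *\<^sub>R Bcontfun (gen (level n) (apply_bcontfun f)))
    \<le> h * ((C * exp (- \<alpha> * (real n - L)) + h * (C * (2 * (\<Sum>i\<in>level n. b i) + K))) * M)"
proof -
  define \<phi> where "\<phi> = Bcontfun (gen (level n) (apply_bcontfun f))"
  have \<phi>: "apply_bcontfun \<phi> = gen (level n) (apply_bcontfun f)"
    unfolding \<phi>_def by (intro apply_Bcontfun continuous_gen level_subset) simp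
  obtain g where g: "(f, g) \<in> infinitesimal_generator S"
    "\<And>\<eta>. \<bar>apply_bcontfun g \<eta> - gen (level n) (apply_bcontfun f) \<eta>\<bar> \<le> C * M * exp (- \<alpha> * (real n - L))"
    using tame_generator[OF f] by blast
  have g\<phi>: "norm (g - \<phi>) \<le> C * M * exp (- \<alpha> * (real n - L))"
    by (rule norm_bound) (use g(2) in \<open>simp add: \<phi>\<close>)
  have "tame \<alpha> ((2 * (\<Sum>i\<in>level n. b i) + K) * M) (apply_bcontfun \<phi>)"
    unfolding \<phi> by (rule gen_tame[OF f finite_level level_subset])
  then obtain \<psi> where \<psi>: "(\<phi>, \<psi>) \<in> infinitesimal_generator S"
    "norm \<psi> \<le> C * ((2 * (\<Sum>i\<in>level n. b i) + K) * M)"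
    using tame_generator by blast
  have "norm (S t g - \<phi>) \<le> (C * exp (- \<alpha> * (real n - L)) + h * (C * (2 * (\<Sum>i\<in>level n. b i) + K))) * M"
    if t: "0 \<le> t" "t \<le> h" for t
  proof -
    have "norm (S t \<phi> - \<phi> - t *\<^sub>R 0) \<le> t * norm \<psi>"
      by (rule semigroup_increment[OF semigroup \<psi>(1) t(1)]) (simp add: S_norm_le)
    also have "\<dots> \<le> h * (C * ((2 * (\<Sum>i\<in>level n. b i) + K) * M))"
      using t \<psi>(2) by (intro mult_mono) auto
    finally have 1: "norm (S t \<phi> - \<phi>) \<le> h * (C * ((2 * (\<Sum>i\<in>level n. b i) + K) * M))" by simp
    have "S t g - \<phi> = S t (g - \<phi>) + (S t \<phi> - \<phi>)"
      by (simp add: linear_diff[OF S_linear[OF t(1)]])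
    then have "norm (S t g - \<phi>) \<le> norm (S t (g - \<phi>)) + norm (S t \<phi> - \<phi>)"
      by (simp only: norm_triangle_ineq)
    also have "\<dots> \<le> C * M * exp (- \<alpha> * (real n - L)) + h * (C * ((2 * (\<Sum>i\<in>level n. b i) + K) * M))"
      using S_norm_le[OF t(1), of "g - \<phi>"] g\<phi> 1 by (intro add_mono) auto
    finally show ?thesis by (simp add: algebra_simps)
  qed
  then show ?thesis
    using semigroup_increment[OF semigroup g(1) h] unfolding \<phi>_def by blast
qed

text \<open>The semigroup contracts, so the errors of the single steps add up. The bound is
  exponential in T, which is harmless because T stays fixed while the scheme is refined.\<close>

lemma euler_converges:
  fixes h :: "nat \<Rightarrow> real"
  assumes f: "tame \<alpha> M (apply_bcontfun f)" and h: "\<And>k. 0 \<le> h k" "\<And>k. h k \<le> d"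
    and small: "\<And>k. h k * (\<Sum>i\<in>level n. b i) \<le> 1" and N: "(\<Sum>k<N. h k) = T"
  shows "\<bar>apply_bcontfun (S T f) \<eta> - euler (level n) h (apply_bcontfun f) N \<eta>\<bar>
    \<le> T * ((C * exp (- \<alpha> * (real n - L)) + d * (C * (2 * (\<Sum>i\<in>level n. b i) + K))) * (M * exp (K * T)))"
proof -
  let ?E = "euler (level n) h (apply_bcontfun f)"
  let ?A = "C * exp (- \<alpha> * (real n - L)) + d * (C * (2 * (\<Sum>i\<in>level n. b i) + K))"
  have M: "0 \<le> M" using tame_nonneg[OF f] .
  have b0: "0 \<le> (\<Sum>i\<in>level n. b i)" using level_subset bound_nonneg by (intro sum_nonneg) auto
  have t0: "0 \<le> (\<Sum>j<k. h j)" for k using h by (intro sum_nonneg) auto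
  define u where "u k = Bcontfun (?E k)" for k
  have u: "apply_bcontfun (u k) = ?E k" for k
    unfolding u_def by (intro apply_Bcontfun continuous_euler level_subset) simp
  have "norm (S (\<Sum>j<k. h j) f - u k) \<le> (\<Sum>j<k. h j) * (?A * (M * exp (K * T)))" if "k \<le> N" for k
    using that
  proof (induction k)
    case 0
    have "u 0 = f" by (rule bcontfun_eqI) (simp add: u)
    then show ?case by (simp add: S_zero)
  next
    case (Suc k)
    have tk: "(\<Sum>j<k. h j) \<le> T"
      unfolding N[symmetric] using h Suc by (intro sum_mono2) auto
    have uS: "u (Suc k) = u k + h k *\<^sub>R Bcontfun (gen (level n) (apply_bcontfun (u k)))"
      by (rule bcontfun_eqI)
         (simp add: u apply_Bcontfun continuous_gen[OF level_subset] continuous_euler[OF level_subset])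
    have "norm (S (h k) (u k) - u (Suc k))
        \<le> h k * ((C * exp (- \<alpha> * (real n - L)) + h k * (C * (2 * (\<Sum>i\<in>level n. b i) + K))) * (M * exp (K * (\<Sum>j<k. h j))))"
      using euler_error[OF _ h(1)[of k], of "M * exp (K * (\<Sum>j<k. h j))" "u k" n]
        euler_iterate_tame[OF finite_level level_subset h(1) small f, where k = k]
      unfolding uS u by (simp add: diff_diff_eq)
    also have "\<dots> \<le> h k * (?A * (M * exp (K * T)))"
      using h[of k] C_nonneg K_nonneg b0 tk M
      by (intro mult_left_mono mult_mono add_mono mult_right_mono) (auto intro!: mult_left_mono)
    finally have 1: "norm (S (h k) (u k) - u (Suc k)) \<le> h k * (?A * (M * exp (K * T)))" .
    have "S (\<Sum>j<Suc k. h j) f = S (h k) (S (\<Sum>j<k. h j) f)"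
      using S_add[OF h(1)[of k] t0[of k], of f] by (simp add: add.commute)
    then have "S (\<Sum>j<Suc k. h j) f - u (Suc k) = S (h k) (S (\<Sum>j<k. h j) f - u k) + (S (h k) (u k) - u (Suc k))"
      by (simp add: linear_diff[OF S_linear[OF h(1)]])
    then have "norm (S (\<Sum>j<Suc k. h j) f - u (Suc k))
        \<le> norm (S (h k) (S (\<Sum>j<k. h j) f - u k)) + norm (S (h k) (u k) - u (Suc k))"
      by (simp only: norm_triangle_ineq)
    also have "\<dots> \<le> (\<Sum>j<k. h j) * (?A * (M * exp (K * T))) + h k * (?A * (M * exp (K * T)))"
      using order_trans[OF S_norm_le[OF h(1)] Suc.IH] Suc.prems 1 by (intro add_mono) auto
    also have "\<dots> = (\<Sum>j<Suc k. h j) * (?A * (M * exp (K * T)))"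
      by (simp add: distrib_right)
    finally show ?case .
  qed
  from this[of N] have "norm (S T f - u N) \<le> T * (?A * (M * exp (K * T)))" by (simp add: N)
  then show ?thesis
    using norm_bounded[of "S T f - u N" \<eta>] by (simp add: u)
qed

end

subsection \<open>Asymptotic invariance under time shifts\<close>

text \<open>A left Riemann sum of the decreasing function 1 / (1 + t) dominates its
  integral.\<close>

lemma ln_le_sum_harmonic:
  assumes "0 < h"
  shows "ln (1 + real N * h) \<le> (\<Sum>k<N. h / (1 + real k * h))"
proof (induction N)
  case (Suc N)
  have p: "0 < 1 + real N * h" using assms by (simp add: add_pos_nonneg)
  have eq: "1 + real (Suc N) * h = (1 + real N * h) * (1 + h / (1 + real N * h))"
    using p by (simp add: field_simps)
  have "0 < 1 + h / (1 + real N * h)" using p assms by (simp add: add_pos_pos)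
  then have "ln (1 + real (Suc N) * h) = ln (1 + real N * h) + ln (1 + h / (1 + real N * h))"
    unfolding eq using p by (intro ln_mult_pos)
  also have "\<dots> \<le> (\<Sum>k<N. h / (1 + real k * h)) + h / (1 + real N * h)"
    using p assms by (intro add_mono Suc ln_add_one_self_le_self) auto
  finally show ?case by simp
qed simp

text \<open>Comparison with the telescoping differences 1 / p - 1 / (p + h); replacing p + h by (1 +
  h) p costs the factor 1 + h, which is at most 2.\<close>

lemma sum_inverse_squares_le:
  assumes "0 < h" "h \<le> (1 :: real)"
  shows "(\<Sum>k<N. h / (1 + real k * h)\<^sup>2) \<le> 2"
proof -
  have "(\<Sum>k<N. h / (1 + real k * h)\<^sup>2) \<le> (1 + h) * (1 - 1 / (1 + real N * h))"
  proof (induction N)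
    case (Suc N)
    define p where "p = 1 + real N * h"
    have p: "1 \<le> p" using assms by (simp add: p_def)
    have p': "1 + real (Suc N) * h = p + h" by (simp add: p_def algebra_simps)
    have ph: "p + h \<le> (1 + h) * p" using p assms by (simp add: algebra_simps)
    have "h / p\<^sup>2 = (h * (p + h)) / (p\<^sup>2 * (p + h))" using p assms by simp
    also have "\<dots> \<le> (h * ((1 + h) * p)) / (p\<^sup>2 * (p + h))"
      using p assms ph by (intro divide_right_mono mult_left_mono) auto
    also have "\<dots> = (1 + h) * (h / (p * (p + h)))"
      using p by (simp add: power2_eq_square)
    also have "h / (p * (p + h)) = 1 / p - 1 / (p + h)"
      using p assms by (simp add: field_simps)
    finally have "h / p\<^sup>2 \<le> (1 + h) * (1 / p - 1 / (p + h))" .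
    moreover have "(\<Sum>k<Suc N. h / (1 + real k * h)\<^sup>2) = (\<Sum>k<N. h / (1 + real k * h)\<^sup>2) + h / p\<^sup>2"
      by (simp add: p_def)
    moreover have "(1 + h) * (1 - 1 / p) + (1 + h) * (1 / p - 1 / (p + h)) = (1 + h) * (1 - 1 / (p + h))"
      by (simp add: algebra_simps)
    ultimately show ?case using Suc unfolding p' p_def[symmetric] by linarith
  qed simp
  also have "\<dots> \<le> 2 * 1"
    using assms by (intro mult_mono) (auto simp: divide_le_eq)
  finally show ?thesis by simp
qed

context jump_rates
begin

text \<open>
  A total time shift \<open>s\<close> is spread over \<open>[0, T]\<close> (time being counted from the end) with density
  proportional to \<open>1 / (1 + t)\<close>, while the region that matters grows like \<open>t\<close>. The cost is then of
  order \<open>\<integral> (1 + t) / ((1 + t) ln (1 + T))\<^sup>2 dt = 1 / ln (1 + T)\<close>.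
\<close>

lemma shift_cost:
  fixes h a s M B Z :: real and N :: nat
  defines "Z \<equiv> \<Sum>k<N. h / (1 + real k * h)"
  defines "a \<equiv> s / Z"
  defines "e \<equiv> \<lambda>k. a / (1 + real k * h)"
  defines "m \<equiv> \<lambda>k. nat \<lceil>(K + 1) / \<alpha> * (real k * h)\<rceil>"
  assumes h: "0 < h" "h \<le> 1" and N: "0 < N" and s: "0 \<le> s" and M: "0 \<le> M" and B: "0 \<le> B" and Y: "0 \<le> Y"
  shows "(\<Sum>j<N. h * ((e j)\<^sup>2 * ((2 * real (m j) + 1) * C * B\<^sup>2)
        + 2 * e j * B * (C * (M * exp (K * (\<Sum>l<j. h * (1 + e l)))) * exp (- \<alpha> * real (m j))))
      + h\<^sup>2 * ((1 + e j)\<^sup>2 * Y))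
    \<le> (s\<^sup>2 * (2 * ((K + 1) / \<alpha>) + 3) * C * B\<^sup>2 + 4 * s * B * C * M * exp (K * s)) / ln (1 + real N * h)
      + h * (real N * h) * ((1 + s / ln (1 + real N * h))\<^sup>2 * Y)"
proof -
  let ?k = "(K + 1) / \<alpha>"
  let ?T = "real N * h"
  have T: "0 < ?T" using h N by simp
  have ln0: "0 < ln (1 + ?T)" using T by simp
  have lnZ: "ln (1 + ?T) \<le> Z" unfolding Z_def by (rule ln_le_sum_harmonic[OF h(1)])
  have Z: "0 < Z" using ln0 lnZ by linarith
  have a: "0 \<le> a" using s Z by (simp add: a_def)
  have a_le: "a \<le> s / ln (1 + ?T)"
    unfolding a_def using lnZ ln0 s by (intro divide_left_mono) auto
  have k0: "0 \<le> ?k" using K_nonneg \<alpha>_pos by simp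
  define q where "q j = 1 + real j * h" for j
  have q: "1 \<le> q j" for j using h by (simp add: q_def)
  have e0: "0 \<le> e j" for j using a q[of j] by (simp add: e_def q_def)
  have e_le: "e j \<le> a" for j
    using a q[of j] mult_left_mono[OF q[of j] a] by (simp add: e_def q_def[symmetric] divide_le_eq)
  \<comment> \<open>The division by Z in a makes the total extra time exactly s, so the accelerated
    clock is never ahead by more than s.\<close>
  have hsum: "(\<Sum>l<j. h * (1 + e l)) \<le> real j * h + s" if "j \<le> N" for j
  proof -
    have "(\<Sum>l<j. h * e l) \<le> (\<Sum>l<N. h * e l)"
      using that h e0 by (intro sum_mono2) auto
    also have "\<dots> = a * Z"
      by (simp add: e_def Z_def sum_distrib_left mult_ac)
    also have "\<dots> = s" using Z by (simp add: a_def)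
    finally show ?thesis by (simp add: distrib_left sum.distrib)
  qed
  have summand: "h * ((e j)\<^sup>2 * ((2 * real (m j) + 1) * C * B\<^sup>2)
        + 2 * e j * B * (C * (M * exp (K * (\<Sum>l<j. h * (1 + e l)))) * exp (- \<alpha> * real (m j))))
      + h\<^sup>2 * ((1 + e j)\<^sup>2 * Y)
    \<le> a\<^sup>2 * (2 * ?k + 3) * C * B\<^sup>2 * (h / q j) + 2 * a * B * C * M * exp (K * s) * (h / (q j)\<^sup>2)
      + h\<^sup>2 * ((1 + s / ln (1 + ?T))\<^sup>2 * Y)" if j: "j < N" for j
  proof -
    have m_up: "real (m j) \<le> ?k * (real j * h) + 1"
    proof -
      have "0 \<le> ?k * (real j * h)" using h by (intro mult_nonneg_nonneg k0) auto
      then have "real (m j) = of_int \<lceil>?k * (real j * h)\<rceil>" unfolding m_def by (intro of_nat_nat) (simp only: zero_le_ceiling)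
      then show ?thesis using of_int_ceiling_le_add_one[of "?k * (real j * h)"] by linarith
    qed
    have m_lo: "?k * (real j * h) \<le> real (m j)"
      unfolding m_def by linarith
    have "2 * real (m j) + 1 \<le> (2 * ?k + 3) * q j"
    proof -
      have "0 \<le> 2 * ?k + 3 * (real j * h)"
        using h by (intro add_nonneg_nonneg mult_nonneg_nonneg k0) auto
      moreover have "(2 * x + 3) * (1 + y) = 2 * (x * y) + 3 + (2 * x + 3 * y)" for x y :: real
        by (simp add: algebra_simps)
      then have "(2 * ?k + 3) * q j = 2 * (?k * (real j * h)) + 3 + (2 * ?k + 3 * (real j * h))"
        unfolding q_def .
      ultimately show ?thesis using m_up by linarith
    qed
    then have "(e j)\<^sup>2 * ((2 * real (m j) + 1) * C * B\<^sup>2) \<le> (e j)\<^sup>2 * ((2 * ?k + 3) * q j * C * B\<^sup>2)"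
      using C_nonneg by (intro mult_left_mono mult_right_mono) auto
    \<comment> \<open>The square of e decays like 1 / q^2 and the window grows like q; what remains
      is again the density 1 / q, whose sum is Z.\<close>
    also have "\<dots> = a\<^sup>2 * (2 * ?k + 3) * C * B\<^sup>2 * (1 / q j)"
    proof -
      have "(e j)\<^sup>2 * q j = a\<^sup>2 * (1 / q j)"
        using q[of j] by (simp add: e_def q_def[symmetric] power2_eq_square)
      then have "(e j)\<^sup>2 * q j * ((2 * ?k + 3) * C * B\<^sup>2) = a\<^sup>2 * (1 / q j) * ((2 * ?k + 3) * C * B\<^sup>2)" by simp
      then show ?thesis by (simp only: mult_ac)
    qed
    finally have 1: "(e j)\<^sup>2 * ((2 * real (m j) + 1) * C * B\<^sup>2) \<le> a\<^sup>2 * (2 * ?k + 3) * C * B\<^sup>2 * (1 / q j)" .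
    \<comment> \<open>Origin of the slope (K + 1) / \<alpha> of the window: K cancels the growth of
      the weighted oscillations, and the additional 1 leaves a decay exp (- t).\<close>
    have "(K + 1) * (real j * h) = \<alpha> * (?k * (real j * h))" using \<alpha>_pos by simp
    also have "\<dots> \<le> \<alpha> * real (m j)" using m_lo \<alpha>_pos by (intro mult_left_mono) auto
    finally have am: "(K + 1) * (real j * h) \<le> \<alpha> * real (m j)" .
    have "K * (\<Sum>l<j. h * (1 + e l)) \<le> K * (real j * h + s)"
      using hsum[of j] j K_nonneg by (intro mult_left_mono) auto
    with am have ex: "K * (\<Sum>l<j. h * (1 + e l)) + - \<alpha> * real (m j) \<le> K * s + - (real j * h)"
      by (simp add: algebra_simps)
    have "exp (K * (\<Sum>l<j. h * (1 + e l))) * exp (- \<alpha> * real (m j)) \<le> exp (K * s) * exp (- (real j * h))"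
      unfolding exp_add[symmetric] using ex by simp
    also have "exp (- (real j * h)) \<le> 1 / q j"
      using exp_ge_add_one_self[of "real j * h"] q[of j] by (simp add: exp_minus q_def inverse_eq_divide frac_le)
    finally have E: "exp (K * (\<Sum>l<j. h * (1 + e l))) * exp (- \<alpha> * real (m j)) \<le> exp (K * s) * (1 / q j)"
      by simp
    have "2 * e j * B * (C * (M * exp (K * (\<Sum>l<j. h * (1 + e l)))) * exp (- \<alpha> * real (m j)))
        = (2 * e j * B * C * M) * (exp (K * (\<Sum>l<j. h * (1 + e l))) * exp (- \<alpha> * real (m j)))"
      by (simp only: mult_ac)
    also have "\<dots> \<le> (2 * e j * B * C * M) * (exp (K * s) * (1 / q j))"
      using e0[of j] B C_nonneg M by (intro mult_left_mono[OF E]) auto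
    also have "\<dots> = 2 * a * B * C * M * exp (K * s) * (1 / (q j)\<^sup>2)"
      using q[of j] by (simp add: e_def q_def[symmetric] power2_eq_square)
    finally have 2: "2 * e j * B * (C * (M * exp (K * (\<Sum>l<j. h * (1 + e l)))) * exp (- \<alpha> * real (m j)))
        \<le> 2 * a * B * C * M * exp (K * s) * (1 / (q j)\<^sup>2)" .
    have "(1 + e j)\<^sup>2 * Y \<le> (1 + s / ln (1 + ?T))\<^sup>2 * Y"
      using e0[of j] e_le[of j] a_le Y by (intro mult_right_mono power_mono) auto
    then have 3: "h\<^sup>2 * ((1 + e j)\<^sup>2 * Y) \<le> h\<^sup>2 * ((1 + s / ln (1 + ?T))\<^sup>2 * Y)"
      by (intro mult_left_mono) auto
    have "h * ((e j)\<^sup>2 * ((2 * real (m j) + 1) * C * B\<^sup>2)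
        + 2 * e j * B * (C * (M * exp (K * (\<Sum>l<j. h * (1 + e l)))) * exp (- \<alpha> * real (m j))))
      \<le> h * (a\<^sup>2 * (2 * ?k + 3) * C * B\<^sup>2 * (1 / q j) + 2 * a * B * C * M * exp (K * s) * (1 / (q j)\<^sup>2))"
      using h by (intro mult_left_mono add_mono 1 2) auto
    also have "h * (x * (1 / y) + x' * (1 / y')) = x * (h / y) + x' * (h / y')" for x y x' y'
      by (simp add: distrib_left mult.commute)
    finally show ?thesis using 3 by linarith
  qed
  have "(\<Sum>j<N. h * ((e j)\<^sup>2 * ((2 * real (m j) + 1) * C * B\<^sup>2)
        + 2 * e j * B * (C * (M * exp (K * (\<Sum>l<j. h * (1 + e l)))) * exp (- \<alpha> * real (m j))))
      + h\<^sup>2 * ((1 + e j)\<^sup>2 * Y))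
    \<le> (\<Sum>j<N. a\<^sup>2 * (2 * ?k + 3) * C * B\<^sup>2 * (h / q j) + 2 * a * B * C * M * exp (K * s) * (h / (q j)\<^sup>2)
      + h\<^sup>2 * ((1 + s / ln (1 + ?T))\<^sup>2 * Y))"
    by (intro sum_mono summand) auto
  also have "\<dots> = a\<^sup>2 * (2 * ?k + 3) * C * B\<^sup>2 * Z + 2 * a * B * C * M * exp (K * s) * (\<Sum>j<N. h / (q j)\<^sup>2)
      + real N * (h\<^sup>2 * ((1 + s / ln (1 + ?T))\<^sup>2 * Y))"
    unfolding sum.distrib sum_distrib_left[symmetric] by (simp add: Z_def q_def)
  also have "\<dots> \<le> a\<^sup>2 * (2 * ?k + 3) * C * B\<^sup>2 * Z + 2 * a * B * C * M * exp (K * s) * 2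
      + real N * (h\<^sup>2 * ((1 + s / ln (1 + ?T))\<^sup>2 * Y))"
    using sum_inverse_squares_le[OF h, of N] a B C_nonneg M
    by (intro add_right_mono add_left_mono mult_left_mono) (auto simp: q_def)
  also have "\<dots> = (s\<^sup>2 * (2 * ?k + 3) * C * B\<^sup>2 + 4 * s * B * C * M * exp (K * s)) / Z
      + h * ?T * ((1 + s / ln (1 + ?T))\<^sup>2 * Y)"
  proof -
    \<comment> \<open>The normalisation a = s / Z gains one factor 1 / Z, and Z is at least
      logarithmic in the time span.\<close>
    have "a\<^sup>2 * Z = s\<^sup>2 / Z" using Z by (simp add: a_def power2_eq_square)
    then have "(a\<^sup>2 * Z) * ((2 * ?k + 3) * C * B\<^sup>2) = (s\<^sup>2 / Z) * ((2 * ?k + 3) * C * B\<^sup>2)" by simp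
    then have 1: "a\<^sup>2 * (2 * ?k + 3) * C * B\<^sup>2 * Z = (s\<^sup>2 * (2 * ?k + 3) * C * B\<^sup>2) / Z"
      by (simp only: mult_ac times_divide_eq_right times_divide_eq_left)
    have 2: "2 * a * B * C * M * exp (K * s) * 2 = (4 * s * B * C * M * exp (K * s)) / Z"
      by (simp add: a_def)
    have 3: "real N * (h\<^sup>2 * ((1 + s / ln (1 + ?T))\<^sup>2 * Y)) = h * ?T * ((1 + s / ln (1 + ?T))\<^sup>2 * Y)"
      by (simp add: power2_eq_square mult_ac)
    have "(x + y) / Z = x / Z + y / Z" for x y by (rule add_divide_distrib)
    then show ?thesis unfolding 1 2 3 by simp
  qed
  also have "\<dots> \<le> (s\<^sup>2 * (2 * ?k + 3) * C * B\<^sup>2 + 4 * s * B * C * M * exp (K * s)) / ln (1 + ?T)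
      + h * ?T * ((1 + s / ln (1 + ?T))\<^sup>2 * Y)"
    using lnZ ln0 Z s B C_nonneg M k0
    by (intro add_right_mono divide_left_mono add_nonneg_nonneg mult_nonneg_nonneg) auto
  finally show ?thesis .
qed

end

section \<open>From the square inequality for the Euler scheme to time shifts of the
  semigroup\<close>

context jump_semigroup
begin

lemma S_bound:
  assumes "0 \<le> t" "\<And>\<eta>. \<bar>apply_bcontfun f \<eta>\<bar> \<le> B"
  shows "\<bar>apply_bcontfun (S t f) \<eta>\<bar> \<le> B"
proof -
  have "norm f \<le> B" by (rule norm_bound) (use assms(2) in simp)
  then show ?thesis
    using norm_bounded[of "S t f" \<eta>] S_norm_le[OF assms(1), of f] by simp
qed

text \<open>The first error is the cost of the time change and the only one to survive. The others
  measure discretisation and truncation: every occurrence of \<open>bn\<close> carries a factor h,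
  and what remains carries X, which decays exponentially in n.\<close>

lemma square_shift_discrete:
  fixes n N :: nat and T s :: real
  defines "h \<equiv> T / real N"
  defines "a0 \<equiv> s / ln (1 + T)"
  defines "X \<equiv> C * exp (- \<alpha> * (real n - L))"
  defines "bn \<equiv> \<Sum>i\<in>level n. b i"
  assumes f: "tame \<alpha> M (apply_bcontfun f)" "\<And>\<eta>. \<bar>apply_bcontfun f \<eta>\<bar> \<le> B"
    and f2: "apply_bcontfun f2 = (\<lambda>\<eta>. (apply_bcontfun f \<eta>)\<^sup>2)"
    and s: "0 \<le> s" and T: "0 < T" and N: "0 < N" and h1: "h \<le> 1" and small: "h * (1 + a0) * bn \<le> 1"
  shows "(apply_bcontfun (S (T + s) f) \<eta>)\<^sup>2 \<le> apply_bcontfun (S T f2) \<eta>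
    + (s\<^sup>2 * (2 * ((K + 1) / \<alpha>) + 3) * C * B\<^sup>2 + 4 * s * B * C * M * exp (K * s)) / ln (1 + T)
    + h * T * ((1 + a0)\<^sup>2 * (2 * B * bn)\<^sup>2)
    + 2 * B * ((T + s) * ((X + h * (1 + a0) * (C * (2 * bn + K))) * (M * exp (K * (T + s)))))
    + T * ((X + h * (C * (2 * bn + K))) * (2 * B * M * exp (K * T)))"
proof -
  have NT: "real N * h = T" using N by (simp add: h_def)
  have h0: "0 < h" using T N by (simp add: h_def)
  have M: "0 \<le> M" using tame_nonneg[OF f(1)] .
  have B: "0 \<le> B" using f(2)[of undefined] by linarith
  have b0: "0 \<le> bn" unfolding bn_def using level_subset bound_nonneg by (intro sum_nonneg) auto
  have ln0: "0 < ln (1 + T)" using T by simp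
  have a0: "0 \<le> a0" using s ln0 by (simp add: a0_def)
  define Z where "Z = (\<Sum>k<N. h / (1 + real k * h))"
  have lnZ: "ln (1 + T) \<le> Z"
    using ln_le_sum_harmonic[OF h0, of N] by (simp add: NT Z_def)
  then have Z: "0 < Z" using ln0 by linarith
  define e where "e k = s / Z / (1 + real k * h)" for k
  define m where "m k = nat \<lceil>(K + 1) / \<alpha> * (real k * h)\<rceil>" for k
  have q: "1 \<le> 1 + real k * h" for k using h0 by simp
  have e0: "0 \<le> e k" for k
    unfolding e_def using s Z q[of k] by (intro divide_nonneg_nonneg) auto
  have e_le: "e k \<le> a0" for k
  proof -
    have "e k \<le> s / Z / 1"
      unfolding e_def using s Z q[of k] by (intro divide_left_mono) auto
    also have "\<dots> \<le> a0"
      unfolding a0_def using s lnZ ln0 by (simp add: divide_left_mono)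
    finally show ?thesis .
  qed
  have e_sum: "(\<Sum>k<N. h * (1 + e k)) = T + s"
  proof -
    have "(\<Sum>k<N. h * e k) = s / Z * (\<Sum>k<N. h / (1 + real k * h))"
      unfolding sum_distrib_left by (simp add: e_def mult_ac)
    then have "(\<Sum>k<N. h * e k) = s" using Z unfolding Z_def[symmetric] by simp
    then show ?thesis by (simp add: distrib_left sum.distrib NT)
  qed
  have he: "0 \<le> h * (1 + e k)" "h * (1 + e k) \<le> h * (1 + a0)" for k
    using h0 e0[of k] e_le[of k] by auto
  have small_e: "h * (1 + e k) * bn \<le> 1" for k
    using mult_right_mono[OF he(2)[of k] b0] small by linarith
  have "h * 1 \<le> h * (1 + a0)" using h0 a0 by (intro mult_left_mono) auto
  then have small_h: "h * bn \<le> 1"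
    using mult_right_mono[OF _ b0, of h "h * (1 + a0)"] small by simp
  define u where "u = euler (level n) (\<lambda>k. h * (1 + e k)) (apply_bcontfun f) N \<eta>"
  define w where "w = euler (level n) (\<lambda>_. h) (apply_bcontfun f2) N \<eta>"
  define E where "E = (T + s) * ((X + h * (1 + a0) * (C * (2 * bn + K))) * (M * exp (K * (T + s))))"
  define E' where "E' = T * ((X + h * (C * (2 * bn + K))) * (2 * B * M * exp (K * T)))"
  have 1: "\<bar>apply_bcontfun (S (T + s) f) \<eta> - u\<bar> \<le> E"
    unfolding u_def E_def X_def bn_def
    by (rule euler_converges[OF f(1) he small_e[unfolded bn_def] e_sum])
  have 2: "\<bar>apply_bcontfun (S T f2) \<eta> - w\<bar> \<le> E'"
    unfolding w_def E'_def X_def bn_def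
  proof (rule euler_converges)
    show "tame \<alpha> (2 * B * M) (apply_bcontfun f2)"
      unfolding f2 by (rule tame_square[OF f])
    show "h * (\<Sum>i\<in>level n. b i) \<le> 1" using small_h by (simp add: bn_def)
  qed (use h0 NT in auto)
  have uB: "\<bar>u\<bar> \<le> B"
    unfolding u_def
    by (rule euler_iterate_bound[OF finite_level level_subset he(1) small_e[unfolded bn_def] f(2)])
  have SB: "\<bar>apply_bcontfun (S (T + s) f) \<eta>\<bar> \<le> B"
    using s T by (intro S_bound f(2)) auto
  have "u\<^sup>2 \<le> w + (\<Sum>j<N. h * ((e j)\<^sup>2 * ((2 * real (m j) + 1) * C * B\<^sup>2)
        + 2 * e j * B * (C * (M * exp (K * (\<Sum>l<j. h * (1 + e l)))) * exp (- \<alpha> * real (m j))))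
      + h\<^sup>2 * ((1 + e j)\<^sup>2 * (2 * B * bn)\<^sup>2))"
    unfolding u_def w_def f2 bn_def
    using h0 by (intro square_iterate[OF finite_level level_subset e0 _ small_e[unfolded bn_def] f]) auto
  also have "(\<Sum>j<N. h * ((e j)\<^sup>2 * ((2 * real (m j) + 1) * C * B\<^sup>2)
        + 2 * e j * B * (C * (M * exp (K * (\<Sum>l<j. h * (1 + e l)))) * exp (- \<alpha> * real (m j))))
      + h\<^sup>2 * ((1 + e j)\<^sup>2 * (2 * B * bn)\<^sup>2))
    \<le> (s\<^sup>2 * (2 * ((K + 1) / \<alpha>) + 3) * C * B\<^sup>2 + 4 * s * B * C * M * exp (K * s)) / ln (1 + real N * h)
      + h * (real N * h) * ((1 + s / ln (1 + real N * h))\<^sup>2 * (2 * B * bn)\<^sup>2)"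
    unfolding e_def m_def Z_def by (rule shift_cost[OF h0 h1 N s M B]) simp
  finally have 3: "u\<^sup>2 \<le> w + ((s\<^sup>2 * (2 * ((K + 1) / \<alpha>) + 3) * C * B\<^sup>2 + 4 * s * B * C * M * exp (K * s)) / ln (1 + T)
      + h * T * ((1 + a0)\<^sup>2 * (2 * B * bn)\<^sup>2))"
    unfolding NT a0_def by simp
  \<comment> \<open>Both factors of the sum are bounded by B, so passing from the Euler value to the
    semigroup inside the square costs 2 B times the Euler error.\<close>
  have "(apply_bcontfun (S (T + s) f) \<eta>)\<^sup>2 - u\<^sup>2 = (apply_bcontfun (S (T + s) f) \<eta> + u) * (apply_bcontfun (S (T + s) f) \<eta> - u)"
    by (simp add: power2_eq_square square_diff_square_factored)
  also have "\<dots> \<le> \<bar>apply_bcontfun (S (T + s) f) \<eta> + u\<bar> * \<bar>apply_bcontfun (S (T + s) f) \<eta> - u\<bar>"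
    by (simp flip: abs_mult)
  also have "\<dots> \<le> (2 * B) * E"
    using 1 uB SB by (intro mult_mono) auto
  finally show ?thesis
    using 2 3 unfolding E_def E'_def by linarith
qed

text \<open>The number of steps tends to infinity first, at a fixed truncation level, because the
  total rate \<open>bn n\<close> may grow with n; afterwards n tends to infinity.\<close>

lemma square_shift:
  assumes f: "tame \<alpha> M (apply_bcontfun f)" "\<And>\<eta>. \<bar>apply_bcontfun f \<eta>\<bar> \<le> B"
    and f2: "apply_bcontfun f2 = (\<lambda>\<eta>. (apply_bcontfun f \<eta>)\<^sup>2)"
    and s: "0 \<le> s" and T: "0 < T"
  shows "(apply_bcontfun (S (T + s) f) \<eta>)\<^sup>2 \<le> apply_bcontfun (S T f2) \<eta>
    + (s\<^sup>2 * (2 * ((K + 1) / \<alpha>) + 3) * C * B\<^sup>2 + 4 * s * B * C * M * exp (K * s)) / ln (1 + T)"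
proof -
  define a0 where "a0 = s / ln (1 + T)"
  define X where "X n = C * exp (- \<alpha> * (real n - L))" for n
  define bn where "bn n = (\<Sum>i\<in>level n. b i)" for n
  define H where "H N = T / real (Suc N)" for N
  define Q where "Q = apply_bcontfun (S T f2) \<eta>
    + (s\<^sup>2 * (2 * ((K + 1) / \<alpha>) + 3) * C * B\<^sup>2 + 4 * s * B * C * M * exp (K * s)) / ln (1 + T)"
  have X0: "X \<longlonglongrightarrow> 0" unfolding X_def by (rule exp_level_tendsto)
  have H0: "H \<longlonglongrightarrow> 0" unfolding H_def by (intro LIMSEQ_Suc lim_const_over_n)
  have "(apply_bcontfun (S (T + s) f) \<eta>)\<^sup>2
    \<le> Q + 2 * B * ((T + s) * (X n * (M * exp (K * (T + s))))) + T * (X n * (2 * B * M * exp (K * T)))" for n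
  proof -
    let ?R = "\<lambda>h. Q + h * T * ((1 + a0)\<^sup>2 * (2 * B * bn n)\<^sup>2)
      + 2 * B * ((T + s) * ((X n + h * (1 + a0) * (C * (2 * bn n + K))) * (M * exp (K * (T + s)))))
      + T * ((X n + h * (C * (2 * bn n + K))) * (2 * B * M * exp (K * T)))"
    have "(\<lambda>N. H N * (1 + a0) * bn n) \<longlonglongrightarrow> 0 * (1 + a0) * bn n"
      by (intro tendsto_intros H0)
    then have ev1: "\<forall>\<^sub>F N in sequentially. H N * (1 + a0) * bn n < 1"
      by (intro order_tendstoD) auto
    have ev2: "\<forall>\<^sub>F N in sequentially. H N < 1"
      using H0 by (rule order_tendstoD) simp
    have "\<forall>\<^sub>F N in sequentially. (apply_bcontfun (S (T + s) f) \<eta>)\<^sup>2 \<le> ?R (H N)"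
      using ev1 ev2
    proof eventually_elim
      case (elim N)
      then show ?case
        using square_shift_discrete[OF f f2 s T, of "Suc N" n \<eta>]
        unfolding Q_def X_def bn_def H_def a0_def by auto
    qed
    moreover have "(\<lambda>N. ?R (H N)) \<longlonglongrightarrow> ?R 0"
      by (intro tendsto_intros H0)
    ultimately have "(apply_bcontfun (S (T + s) f) \<eta>)\<^sup>2 \<le> ?R 0"
      by (intro tendsto_lowerbound[of "\<lambda>N. ?R (H N)"]) auto
    then show ?thesis by simp
  qed
  moreover have "(\<lambda>n. Q + 2 * B * ((T + s) * (X n * (M * exp (K * (T + s))))) + T * (X n * (2 * B * M * exp (K * T))))
    \<longlonglongrightarrow> Q + 2 * B * ((T + s) * (0 * (M * exp (K * (T + s))))) + T * (0 * (2 * B * M * exp (K * T)))"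
    by (intro tendsto_intros X0)
  ultimately have "(apply_bcontfun (S (T + s) f) \<eta>)\<^sup>2
      \<le> Q + 2 * B * ((T + s) * (0 * (M * exp (K * (T + s))))) + T * (0 * (2 * B * M * exp (K * T)))"
    by (intro LIMSEQ_le_const) auto
  then show ?thesis by (simp add: Q_def)
qed

text \<open>
  The square estimate for \<open>f + a\<close> is linear in \<open>a\<close> up to a bounded term, so dividing by a large \<open>a\<close>
  bounds \<open>S (T + s) f - S T f\<close> from above.
\<close>

lemma shift_upper:
  assumes f: "tame \<alpha> M (apply_bcontfun f)" "\<And>\<eta>. \<bar>apply_bcontfun f \<eta>\<bar> \<le> B"
    and s: "0 \<le> s" and e: "0 < e"
  shows "\<forall>\<^sub>F T in at_top. \<forall>\<eta>. apply_bcontfun (S (T + s) f) \<eta> - apply_bcontfun (S T f) \<eta> \<le> e"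
proof -
  have B: "0 \<le> B" using f(2)[of undefined] by linarith
  \<comment> \<open>Chosen so that 2 a e covers B^2, the bound for the evolved square of f, plus 1
    for the cost of the time change.\<close>
  define a where "a = (B\<^sup>2 + 1) / (2 * e)"
  have a: "0 < a" using e by (simp add: a_def add_nonneg_pos)
  have ae: "2 * a * e = B\<^sup>2 + 1" using e by (simp add: a_def)
  \<comment> \<open>A grows quadratically in a, but a is fixed before T, so A / ln (1 + T) still
    drops below 1.\<close>
  define A where "A = s\<^sup>2 * (2 * ((K + 1) / \<alpha>) + 3) * C * (B + a)\<^sup>2 + 4 * s * (B + a) * C * M * exp (K * s)"
  define one where "one = (const_bcontfun 1 :: 'q config \<Rightarrow>\<^sub>C real)"
  have one: "apply_bcontfun one \<eta> = 1" for \<eta> by (simp add: one_def const_bcontfun.rep_eq)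
  define g where "g = f + a *\<^sub>R one"
  have g: "apply_bcontfun g = (\<lambda>\<eta>. apply_bcontfun f \<eta> + a)" by (simp add: g_def one fun_eq_iff)
  define f2 where "f2 = Bcontfun (\<lambda>\<eta>. (apply_bcontfun f \<eta>)\<^sup>2)"
  have f2: "apply_bcontfun f2 = (\<lambda>\<eta>. (apply_bcontfun f \<eta>)\<^sup>2)"
    unfolding f2_def by (intro apply_Bcontfun continuous_on_power) simp
  define g2 where "g2 = f2 + (2 * a) *\<^sub>R f + (a\<^sup>2) *\<^sub>R one"
  have g2: "apply_bcontfun g2 = (\<lambda>\<eta>. (apply_bcontfun g \<eta>)\<^sup>2)"
    by (simp add: g2_def g f2 one fun_eq_iff power2_sum mult_ac)
  have tame_g: "tame \<alpha> M (apply_bcontfun g)"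
    using f(1) unfolding tame_def has_osc_def g by simp
  have gB: "\<bar>apply_bcontfun g \<eta>\<bar> \<le> B + a" for \<eta>
    using f(2)[of \<eta>] a by (simp add: g)
  have "((\<lambda>T. A / ln (1 + T)) \<longlongrightarrow> 0) at_top"
  proof (rule real_tendsto_divide_at_top[OF tendsto_const])
    show "filterlim (\<lambda>T::real. ln (1 + T)) at_top at_top"
      by (intro filterlim_compose[OF ln_at_top] filterlim_tendsto_add_at_top[OF tendsto_const filterlim_ident])
  qed
  then have "\<forall>\<^sub>F T in at_top. A / ln (1 + T) < 1"
    by (rule order_tendstoD) simp
  moreover have "\<forall>\<^sub>F T :: real in at_top. 0 < T" by (rule eventually_gt_at_top)
  ultimately show ?thesis
  proof eventually_elim
    case (elim T)
    show ?case
    proof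
      fix \<eta>
      define x where "x = apply_bcontfun (S (T + s) f) \<eta>"
      define y where "y = apply_bcontfun (S T f) \<eta>"
      have T: "0 \<le> T" "0 \<le> T + s" using elim s by auto
      have "apply_bcontfun (S (T + s) g) \<eta> = x + a"
        unfolding g_def one_def x_def
        by (simp add: linear_add[OF S_linear[OF T(2)]] linear_cmul[OF S_linear[OF T(2)]] S_const[OF T(2)] const_bcontfun.rep_eq)
      moreover have "apply_bcontfun (S T g2) \<eta> = apply_bcontfun (S T f2) \<eta> + 2 * a * y + a\<^sup>2"
        unfolding g2_def one_def y_def
        by (simp add: linear_add[OF S_linear[OF T(1)]] linear_cmul[OF S_linear[OF T(1)]] S_const[OF T(1)] const_bcontfun.rep_eq)
      moreover have "(apply_bcontfun (S (T + s) g) \<eta>)\<^sup>2 \<le> apply_bcontfun (S T g2) \<eta> + A / ln (1 + T)"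
        unfolding A_def by (rule square_shift[OF tame_g gB g2 s]) (use elim in simp)
      ultimately have "(x + a)\<^sup>2 \<le> apply_bcontfun (S T f2) \<eta> + 2 * a * y + a\<^sup>2 + 1"
        using elim(1) by simp
      moreover have "\<bar>apply_bcontfun (S T f2) \<eta>\<bar> \<le> B\<^sup>2"
      proof (rule S_bound[OF T(1)])
        show "\<bar>apply_bcontfun f2 \<eta>\<bar> \<le> B\<^sup>2" for \<eta>
          using f(2)[of \<eta>] B by (simp add: f2 power2_le_iff_abs_le)
      qed
      moreover have "(x + a)\<^sup>2 = x\<^sup>2 + 2 * a * x + a\<^sup>2"
        by (simp add: power2_sum mult_ac)
      ultimately have "2 * a * x \<le> 2 * a * y + (B\<^sup>2 + 1)"
        using zero_le_power2[of x] by linarith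
      then have "(2 * a) * (x - y) \<le> (2 * a) * e"
        using ae by (simp add: right_diff_distrib)
      then have "x - y \<le> e"
        using a by (simp add: mult_le_cancel_left_pos)
      then show "apply_bcontfun (S (T + s) f) \<eta> - apply_bcontfun (S T f) \<eta> \<le> e"
        by (simp add: x_def y_def)
    qed
  qed
qed

lemma eventually_norm_shift_le:
  assumes f: "tame \<alpha> M (apply_bcontfun f)" and s: "0 \<le> s" and e: "0 < e"
  shows "\<forall>\<^sub>F T in at_top. norm (S (T + s) f - S T f) \<le> e"
proof -
  have tame': "tame \<alpha> M (apply_bcontfun (- f))"
    using f unfolding tame_def has_osc_def by (simp add: abs_minus_commute)
  have bd: "\<bar>apply_bcontfun f \<eta>\<bar> \<le> norm f" "\<bar>apply_bcontfun (- f) \<eta>\<bar> \<le> norm f" for \<eta>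
    using norm_bounded[of f \<eta>] by simp_all
  show ?thesis
    using shift_upper[OF f bd(1) s e] shift_upper[OF tame' bd(2) s e] eventually_ge_at_top[of 0]
  proof eventually_elim
    case (elim T)
    then have T: "0 \<le> T" "0 \<le> T + s" using s by auto
    show ?case
    proof (rule norm_bound)
      fix \<eta>
      show "norm (apply_bcontfun (S (T + s) f - S T f) \<eta>) \<le> e"
        using elim(1,2)[rule_format, of \<eta>]
        by (simp add: linear_neg[OF S_linear[OF T(1)]] linear_neg[OF S_linear[OF T(2)]] abs_le_iff)
    qed
  qed
qed

text \<open>Truncations are tame and uniformly dense, and contractivity makes the approximation
  error independent of T. The approximation enters at both times T and T + s, hence e / 6.\<close>

lemma shift_tendsto:
  assumes s: "0 \<le> s"
  shows "((\<lambda>T. norm (S (T + s) f - S T f)) \<longlongrightarrow> 0) at_top"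
proof (rule tendstoI)
  fix e :: real assume e: "0 < e"
  obtain n where n: "norm (truncation n f - f) \<le> e / 6"
    using truncation_approx[of "e / 6" f] e by auto
  define g where "g = truncation n f"
  have "tame \<alpha> (\<Sum>x\<in>window n. exp (\<alpha> * real_of_int \<bar>x\<bar>) * (2 * norm f)) (\<lambda>\<eta>. apply_bcontfun f (truncate n \<eta>))"
    by (rule tame_truncation) (use norm_bounded[of f] in simp)
  then have "tame \<alpha> (\<Sum>x\<in>window n. exp (\<alpha> * real_of_int \<bar>x\<bar>) * (2 * norm f)) (apply_bcontfun g)"
    by (simp add: g_def apply_truncation[abs_def])
  then have "\<forall>\<^sub>F T in at_top. norm (S (T + s) g - S T g) \<le> e / 3"
    using e by (intro eventually_norm_shift_le s) auto
  then show "\<forall>\<^sub>F T in at_top. dist (norm (S (T + s) f - S T f)) 0 < e"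
    using eventually_ge_at_top[of 0]
  proof eventually_elim
    case (elim T)
    then have T: "0 \<le> T" "0 \<le> T + s" using s by auto
    have "S (T + s) f - S T f = (S (T + s) g - S T g) - (S (T + s) (g - f) - S T (g - f))"
      by (simp add: linear_diff[OF S_linear[OF T(1)]] linear_diff[OF S_linear[OF T(2)]])
    also have "norm \<dots> \<le> norm (S (T + s) g - S T g) + (norm (S (T + s) (g - f)) + norm (S T (g - f)))"
      by (intro order_trans[OF norm_triangle_ineq4] add_left_mono norm_triangle_ineq4)
    also have "\<dots> \<le> e / 3 + (e / 6 + e / 6)"
      using elim(1) n S_norm_le[OF T(1), of "g - f"] S_norm_le[OF T(2), of "g - f"]
      unfolding g_def by (intro add_mono) auto
    finally show ?case using e by simp
  qed
qed

end

subsection \<open>Evolution of measures\<close>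

text \<open>Justifies the definite description in \<open>evolve\<close>: existence comes from the
  Riesz representation of a positive functional, uniqueness from
  \<open>prob_measures_eqI\<close>.\<close>

lemma evolve_props:
  fixes S :: "'q::finite semigroup"
  assumes S: "markov_semigroup S" and t: "0 \<le> t" and \<nu>: "\<nu> \<in> prob_measures"
  shows evolve_in_prob_measures: "evolve S t \<nu> \<in> prob_measures"
    and integral_evolve: "(\<integral>\<eta>. apply_bcontfun f \<eta> \<partial>evolve S t \<nu>) = (\<integral>\<eta>. apply_bcontfun (S t f) \<eta> \<partial>\<nu>)"
proof -
  interpret prob_space \<nu> using \<nu> by (simp add: prob_measures_def)
  let ?\<Lambda> = "\<lambda>f. \<integral>\<eta>. apply_bcontfun (S t f) \<eta> \<partial>\<nu>"
  have lin: "linear (S t)" using S t by (simp add: markov_semigroup_def)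
  have "\<exists>\<mu>\<in>prob_measures. \<forall>f. (\<integral>\<eta>. apply_bcontfun f \<eta> \<partial>\<mu>) = ?\<Lambda> f"
  proof (rule riesz_representation)
    show "linear ?\<Lambda>"
      by (rule linearI) (simp_all add: linear_add[OF lin] linear_cmul[OF lin] integrable_bcontfun[OF \<nu>])
    show "0 \<le> ?\<Lambda> f" if "\<And>\<eta>. 0 \<le> apply_bcontfun f \<eta>" for f
      using that S t by (intro Bochner_Integration.integral_nonneg) (simp add: markov_semigroup_def)
    show "?\<Lambda> (const_bcontfun 1) = 1"
      using S t prob_space by (simp add: markov_semigroup_def const_bcontfun.rep_eq)
  qed
  then have "\<exists>!\<mu>. \<mu> \<in> prob_measures \<and> (\<forall>f. (\<integral>\<eta>. apply_bcontfun f \<eta> \<partial>\<mu>) = ?\<Lambda> f)"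
    by (intro ex_ex1I) (blast, rule prob_measures_eqI, auto)
  from theI'[OF this] show "evolve S t \<nu> \<in> prob_measures"
    "(\<integral>\<eta>. apply_bcontfun f \<eta> \<partial>evolve S t \<nu>) = ?\<Lambda> f"
    unfolding evolve_def by blast+
qed

lemma abs_integral_le_norm:
  fixes f :: "'q::finite config \<Rightarrow>\<^sub>C real"
  assumes \<nu>: "\<nu> \<in> prob_measures"
  shows "\<bar>\<integral>\<eta>. apply_bcontfun f \<eta> \<partial>\<nu>\<bar> \<le> norm f"
proof (rule positive_functional_norm_le)
  interpret prob_space \<nu> using \<nu> by (simp add: prob_measures_def)
  show "linear (\<lambda>f :: 'q config \<Rightarrow>\<^sub>C real. \<integral>\<eta>. apply_bcontfun f \<eta> \<partial>\<nu>)"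
    by (rule linearI) (simp_all add: integrable_bcontfun[OF \<nu>])
  show "(\<integral>\<eta>. apply_bcontfun (const_bcontfun 1 :: 'q config \<Rightarrow>\<^sub>C real) \<eta> \<partial>\<nu>) = 1"
    using prob_space by (simp add: const_bcontfun.rep_eq)
qed (rule Bochner_Integration.integral_nonneg)

lemma stationaryI:
  fixes S :: "'q::finite semigroup"
  assumes "markov_semigroup S" "\<nu> \<in> prob_measures"
    and "\<And>t f. 0 \<le> t \<Longrightarrow> (\<integral>\<eta>. apply_bcontfun (S t f) \<eta> \<partial>\<nu>) = (\<integral>\<eta>. apply_bcontfun f \<eta> \<partial>\<nu>)"
  shows "\<nu> \<in> stationary_measures S"
  using assms unfolding stationary_measures_def
  by (auto intro!: prob_measures_eqI simp: evolve_in_prob_measures integral_evolve)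

lemma stationary_subset_periodic: "stationary_measures S \<subseteq> periodic_measures S"
  unfolding stationary_measures_def periodic_measures_def
  by (auto intro!: exI[of _ "1 :: real"])

text \<open>Started from \<nu> itself, the law is constantly \<nu> along the multiples of the
  period.\<close>

lemma periodic_subset_attractor:
  fixes S :: "'q::finite semigroup"
  assumes S: "markov_semigroup S"
  shows "periodic_measures S \<subseteq> attractor S"
proof
  fix \<nu> assume "\<nu> \<in> periodic_measures S"
  then obtain t where \<nu>: "\<nu> \<in> prob_measures" and t: "0 < t" "evolve S t \<nu> = \<nu>"
    by (auto simp: periodic_measures_def)
  have inv: "(\<integral>\<eta>. apply_bcontfun (S (real n * t) f) \<eta> \<partial>\<nu>) = (\<integral>\<eta>. apply_bcontfun f \<eta> \<partial>\<nu>)" for n f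
  proof (induction n)
    case 0
    then show ?case using S by (simp add: markov_semigroup_def)
  next
    case (Suc n)
    have "S (real (Suc n) * t) f = S t (S (real n * t) f)"
      using S t by (simp add: markov_semigroup_def distrib_right)
    then show ?case
      using integral_evolve[OF S _ \<nu>, of t "S (real n * t) f"] t Suc by simp
  qed
  show "\<nu> \<in> attractor S"
    unfolding attractor_def
  proof (intro CollectI conjI \<nu> bexI[of _ \<nu>] exI[of _ "\<lambda>n. real n * t"] allI)
    show "0 \<le> real n * t" for n using t by simp
    show "incseq (\<lambda>n. real n * t)"
      using t by (intro incseq_SucI) (simp add: mult_right_mono)
    show "filterlim (\<lambda>n. real n * t) at_top sequentially"
      using t by (intro filterlim_at_top_mult_tendsto_pos[OF tendsto_const] filterlim_real_sequentially)
    show "weakly_converges (\<lambda>n. evolve S (real n * t) \<nu>) \<nu> sequentially"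
      using t by (simp add: weakly_converges_def integral_evolve[OF S _ \<nu>] inv)
  qed
qed

section \<open>Stationarity of limit laws and ergodicity\<close>

context jump_semigroup
begin

lemma integral_shift_tendsto:
  assumes \<nu>: "\<nu> \<in> prob_measures" and s: "0 \<le> s"
  shows "((\<lambda>t. (\<integral>\<eta>. apply_bcontfun (S (t + s) f) \<eta> \<partial>\<nu>) - (\<integral>\<eta>. apply_bcontfun (S t f) \<eta> \<partial>\<nu>)) \<longlongrightarrow> 0) at_top"
proof (rule Lim_null_comparison[OF always_eventually shift_tendsto[OF s, of f]], rule allI)
  fix t
  have "(\<integral>\<eta>. apply_bcontfun (S (t + s) f) \<eta> \<partial>\<nu>) - (\<integral>\<eta>. apply_bcontfun (S t f) \<eta> \<partial>\<nu>)
      = (\<integral>\<eta>. apply_bcontfun (S (t + s) f - S t f) \<eta> \<partial>\<nu>)"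
    by (simp add: integrable_bcontfun[OF \<nu>])
  then show "norm ((\<integral>\<eta>. apply_bcontfun (S (t + s) f) \<eta> \<partial>\<nu>) - (\<integral>\<eta>. apply_bcontfun (S t f) \<eta> \<partial>\<nu>))
      \<le> norm (S (t + s) f - S t f)"
    using abs_integral_le_norm[OF \<nu>, of "S (t + s) f - S t f"] by simp
qed

text \<open>Testing the limit against S s f amounts to shifting all times t n by s, and the effect
  of this shift vanishes as t n tends to infinity.\<close>

lemma attractor_subset_stationary: "attractor S \<subseteq> stationary_measures S"
proof
  fix \<nu> assume "\<nu> \<in> attractor S"
  then obtain \<nu>0 t where \<nu>: "\<nu> \<in> prob_measures" and \<nu>0: "\<nu>0 \<in> prob_measures"
    and t: "\<And>n. 0 \<le> t n" "filterlim t at_top sequentially"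
    and w: "weakly_converges (\<lambda>n. evolve S (t n) \<nu>0) \<nu> sequentially"
    by (auto simp: attractor_def)
  have lim: "(\<lambda>n. \<integral>\<eta>. apply_bcontfun (S (t n) f) \<eta> \<partial>\<nu>0) \<longlonglongrightarrow> (\<integral>\<eta>. apply_bcontfun f \<eta> \<partial>\<nu>)" for f
    using w by (simp add: weakly_converges_def integral_evolve[OF semigroup t(1) \<nu>0])
  show "\<nu> \<in> stationary_measures S"
  proof (rule stationaryI[OF semigroup \<nu>])
    fix s :: real and f assume s: "0 \<le> s"
    have "(\<lambda>n. (\<integral>\<eta>. apply_bcontfun (S (t n) (S s f)) \<eta> \<partial>\<nu>0) - (\<integral>\<eta>. apply_bcontfun (S (t n) f) \<eta> \<partial>\<nu>0)) \<longlonglongrightarrow> 0"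
      using filterlim_compose[OF integral_shift_tendsto[OF \<nu>0 s, of f] t(2)] by (simp add: S_add[OF t(1) s])
    moreover have "(\<lambda>n. (\<integral>\<eta>. apply_bcontfun (S (t n) (S s f)) \<eta> \<partial>\<nu>0) - (\<integral>\<eta>. apply_bcontfun (S (t n) f) \<eta> \<partial>\<nu>0))
        \<longlonglongrightarrow> (\<integral>\<eta>. apply_bcontfun (S s f) \<eta> \<partial>\<nu>) - (\<integral>\<eta>. apply_bcontfun f \<eta> \<partial>\<nu>)"
      by (intro tendsto_diff lim)
    ultimately have "(\<integral>\<eta>. apply_bcontfun (S s f) \<eta> \<partial>\<nu>) - (\<integral>\<eta>. apply_bcontfun f \<eta> \<partial>\<nu>) = 0"
      by (rule LIMSEQ_unique[rotated])
    then show "(\<integral>\<eta>. apply_bcontfun (S s f) \<eta> \<partial>\<nu>) = (\<integral>\<eta>. apply_bcontfun f \<eta> \<partial>\<nu>)" by simp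
  qed
qed

text \<open>
  Tychonoff's theorem replaces the extraction of a weakly convergent subsequence: any cluster point of
  \<open>t \<mapsto> (g \<mapsto> \<nu>\<^sub>0 (S t g))\<close> in the product topology is a shift-invariant positive functional.
\<close>

lemma stationary_cluster_point:
  fixes F :: "real filter"
  assumes \<nu>0: "\<nu>0 \<in> prob_measures" and F: "F \<noteq> bot" "F \<le> at_top"
  shows "\<exists>\<mu>\<in>stationary_measures S. \<forall>f c e. (\<forall>\<^sub>F t in F. e \<le> \<bar>(\<integral>\<eta>. apply_bcontfun (S t f) \<eta> \<partial>\<nu>0) - c\<bar>)
    \<longrightarrow> e \<le> \<bar>(\<integral>\<eta>. apply_bcontfun f \<eta> \<partial>\<mu>) - c\<bar>"
proof -
  interpret P: prob_space \<nu>0 using \<nu>0 by (simp add: prob_measures_def)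
  define p where "p t = (\<lambda>g. \<integral>\<eta>. apply_bcontfun (S t g) \<eta> \<partial>\<nu>0)" for t
  \<comment> \<open>By contractivity all functionals p t with t \<ge> 0 lie in this product of
    compact intervals.\<close>
  define Q where "Q = (\<Pi>\<^sub>E g\<in>(UNIV :: ('q config \<Rightarrow>\<^sub>C real) set). {- norm g..norm g})"
  have F0: "\<forall>\<^sub>F t in F. 0 \<le> t"
    using F(2) eventually_ge_at_top by (rule filter_leD)
  have "compactin (product_topology (\<lambda>_. euclidean) UNIV) Q"
    unfolding Q_def compactin_PiE by simp
  then have "compact Q"
    by (simp add: euclidean_product_topology)
  moreover have "filtermap p F \<noteq> bot" using F(1) by (simp add: filtermap_bot_iff)
  moreover have "\<forall>\<^sub>F x in filtermap p F. x \<in> Q"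
    unfolding eventually_filtermap using F0
  proof eventually_elim
    case (elim t)
    have "\<bar>p t g\<bar> \<le> norm g" for g
      unfolding p_def using abs_integral_le_norm[OF \<nu>0, of "S t g"] S_norm_le[OF elim, of g] by linarith
    then show ?case by (simp add: Q_def PiE_UNIV_domain abs_le_iff minus_le_iff)
  qed
  ultimately obtain \<Lambda> where \<Lambda>: "inf (nhds \<Lambda>) (filtermap p F) \<noteq> bot"
    unfolding compact_filter by blast
  \<comment> \<open>G plays the role of a convergent subnet: it converges to \<Lambda>
    coordinatewise, and whatever holds for p t eventually along F holds eventually along G.
    Linearity, positivity and normalisation pass to \<Lambda> in this way.\<close>
  define G where "G = inf (nhds \<Lambda>) (filtermap p F)"
  have G: "G \<noteq> bot" "G \<le> nhds \<Lambda>" "G \<le> filtermap p F" using \<Lambda> by (simp_all add: G_def)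
  have ev: "((\<lambda>x. x g) \<longlongrightarrow> \<Lambda> g) G" for g
  proof -
    have "((\<lambda>x. x g) \<longlongrightarrow> \<Lambda> g) (nhds \<Lambda>)"
    proof (rule topological_tendstoI)
      fix U :: "real set" assume U: "open U" "\<Lambda> g \<in> U"
      have "open ((\<lambda>x :: ('q config \<Rightarrow>\<^sub>C real) \<Rightarrow> real. x g) -` U)"
        by (rule open_vimage[OF U(1) continuous_on_product_coordinates])
      then show "\<forall>\<^sub>F x in nhds \<Lambda>. x g \<in> U"
        using U(2) eventually_nhds_in_open by force
    qed
    then show ?thesis by (rule tendsto_mono[OF G(2)])
  qed
  have transfer: "\<forall>\<^sub>F x in G. P x" if "\<And>t. 0 \<le> t \<Longrightarrow> P (p t)" for P
  proof (rule filter_leD[OF G(3)])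
    show "\<forall>\<^sub>F x in filtermap p F. P x"
      unfolding eventually_filtermap using F0 by eventually_elim (rule that)
  qed
  have p_lin: "linear (p t)" if "0 \<le> t" for t
    unfolding p_def
    by (rule linearI) (simp_all add: linear_add[OF S_linear[OF that]] linear_cmul[OF S_linear[OF that]] integrable_bcontfun[OF \<nu>0])
  have lin: "linear \<Lambda>"
  proof (rule linearI)
    show "\<Lambda> (f + g) = \<Lambda> f + \<Lambda> g" for f g
    proof (rule tendsto_unique[OF G(1) ev])
      show "((\<lambda>x. x (f + g)) \<longlongrightarrow> \<Lambda> f + \<Lambda> g) G"
        by (rule Lim_transform_eventually[OF tendsto_add[OF ev ev] transfer]) (simp add: linear_add[OF p_lin])
    qed
    show "\<Lambda> (a *\<^sub>R f) = a *\<^sub>R \<Lambda> f" for a f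
    proof (rule tendsto_unique[OF G(1) ev])
      show "((\<lambda>x. x (a *\<^sub>R f)) \<longlongrightarrow> a *\<^sub>R \<Lambda> f) G"
        by (rule Lim_transform_eventually[OF tendsto_scaleR[OF tendsto_const ev] transfer]) (simp add: linear_cmul[OF p_lin])
    qed
  qed
  have pos: "0 \<le> \<Lambda> f" if f: "\<And>\<eta>. 0 \<le> apply_bcontfun f \<eta>" for f
  proof (rule tendsto_lowerbound[OF ev transfer G(1)])
    show "0 \<le> p t f" if "0 \<le> t" for t
      unfolding p_def using f that semigroup
      by (intro Bochner_Integration.integral_nonneg) (simp add: markov_semigroup_def)
  qed
  have one: "\<Lambda> (const_bcontfun 1) = 1"
  proof (rule tendsto_unique[OF G(1) ev])
    show "((\<lambda>x. x (const_bcontfun 1)) \<longlongrightarrow> 1) G"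
      by (rule tendsto_eventually, rule transfer)
        (use P.prob_space in \<open>simp add: p_def S_const const_bcontfun.rep_eq\<close>)
  qed
  obtain \<mu> where \<mu>: "\<mu> \<in> prob_measures" "\<And>f. (\<integral>\<eta>. apply_bcontfun f \<eta> \<partial>\<mu>) = \<Lambda> f"
    using riesz_representation[OF lin pos one] by blast
  have "\<mu> \<in> stationary_measures S"
  proof (rule stationaryI[OF semigroup \<mu>(1)])
    fix s :: real and f assume s: "0 \<le> s"
    have "((\<lambda>t. p t (S s f) - p t f) \<longlongrightarrow> 0) F"
    proof (rule Lim_transform_eventually[OF tendsto_mono[OF F(2) integral_shift_tendsto[OF \<nu>0 s, of f]]])
      show "\<forall>\<^sub>F t in F. (\<integral>\<eta>. apply_bcontfun (S (t + s) f) \<eta> \<partial>\<nu>0) - (\<integral>\<eta>. apply_bcontfun (S t f) \<eta> \<partial>\<nu>0) = p t (S s f) - p t f"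
        using F0 by eventually_elim (simp add: p_def S_add s)
    qed
    then have "((\<lambda>x. x (S s f) - x f) \<longlongrightarrow> 0) G"
      by (intro tendsto_mono[OF G(3)]) (simp add: filterlim_filtermap)
    moreover have "((\<lambda>x. x (S s f) - x f) \<longlongrightarrow> \<Lambda> (S s f) - \<Lambda> f) G"
      by (intro tendsto_diff ev)
    ultimately have "\<Lambda> (S s f) - \<Lambda> f = 0" using tendsto_unique[OF G(1)] by blast
    then show "(\<integral>\<eta>. apply_bcontfun (S s f) \<eta> \<partial>\<mu>) = (\<integral>\<eta>. apply_bcontfun f \<eta> \<partial>\<mu>)" by (simp add: \<mu>(2))
  qed
  \<comment> \<open>Staying at distance at least e from c is a closed condition, so it is inherited
    by the cluster point.\<close>
  moreover have "e \<le> \<bar>(\<integral>\<eta>. apply_bcontfun f \<eta> \<partial>\<mu>) - c\<bar>"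
    if "\<forall>\<^sub>F t in F. e \<le> \<bar>(\<integral>\<eta>. apply_bcontfun (S t f) \<eta> \<partial>\<nu>0) - c\<bar>" for f c e
  proof -
    have "\<forall>\<^sub>F x in filtermap p F. e \<le> \<bar>x f - c\<bar>"
      using that by (simp add: eventually_filtermap p_def)
    then have "\<forall>\<^sub>F x in G. e \<le> \<bar>x f - c\<bar>" by (rule filter_leD[OF G(3)])
    moreover have "((\<lambda>x. \<bar>x f - c\<bar>) \<longlongrightarrow> \<bar>\<Lambda> f - c\<bar>) G" by (intro tendsto_intros ev)
    ultimately show ?thesis unfolding \<mu>(2) by (intro tendsto_lowerbound[OF _ _ G(1)])
  qed
  ultimately show ?thesis by blast
qed

text \<open>If convergence failed for some f, the times at which the expectation is at least e away
  from its limit would be unbounded. A cluster point along these times is stationary, hence equal to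
  \<nu>, yet still at distance e.\<close>

lemma unique_stationary_ergodic:
  assumes "stationary_measures S = {\<nu>}"
  shows "ergodic S"
  unfolding ergodic_def weakly_converges_def
proof (intro exI[of _ \<nu>] conjI assms ballI allI)
  fix \<nu>0 :: "'q config measure" and f assume \<nu>0: "\<nu>0 \<in> prob_measures"
  let ?I = "\<lambda>t. \<integral>\<eta>. apply_bcontfun (S t f) \<eta> \<partial>\<nu>0"
  let ?c = "\<integral>\<eta>. apply_bcontfun f \<eta> \<partial>\<nu>"
  have "(?I \<longlongrightarrow> ?c) at_top"
  proof (rule tendstoI, rule ccontr)
    fix e :: real assume e: "0 < e" and not: "\<not> (\<forall>\<^sub>F t in at_top. dist (?I t) ?c < e)"
    \<comment> \<open>The filter of large bad times; it is proper exactly because convergence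
      fails.\<close>
    define F where "F = inf at_top (principal {t. e \<le> \<bar>?I t - ?c\<bar>})"
    have "F \<noteq> bot"
      using not by (simp add: F_def trivial_limit_def eventually_inf_principal dist_real_def not_le)
    moreover have "F \<le> at_top" by (simp add: F_def)
    ultimately obtain \<mu> where \<mu>: "\<mu> \<in> stationary_measures S"
      "\<And>f c e. \<forall>\<^sub>F t in F. e \<le> \<bar>(\<integral>\<eta>. apply_bcontfun (S t f) \<eta> \<partial>\<nu>0) - c\<bar>
        \<Longrightarrow> e \<le> \<bar>(\<integral>\<eta>. apply_bcontfun f \<eta> \<partial>\<mu>) - c\<bar>"
      using stationary_cluster_point[OF \<nu>0] by blast
    have "\<forall>\<^sub>F t in F. e \<le> \<bar>?I t - ?c\<bar>" by (simp add: F_def eventually_inf_principal)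
    from \<mu>(2)[OF this] \<mu>(1) assms e show False by simp
  qed
  moreover have "\<forall>\<^sub>F t in at_top. ?I t = (\<integral>\<eta>. apply_bcontfun f \<eta> \<partial>evolve S t \<nu>0)"
    using eventually_ge_at_top[of 0] by eventually_elim (simp add: integral_evolve[OF semigroup _ \<nu>0])
  ultimately show "((\<lambda>t. \<integral>\<eta>. apply_bcontfun f \<eta> \<partial>evolve S t \<nu>0) \<longlongrightarrow> ?c) at_top"
    by (rule Lim_transform_eventually)
qed

end

theorem theorem2p5:
  fixes c :: "'q::finite rates"
    and S :: "'q semigroup"
    and L \<alpha> :: real
  assumes "0 < L" and "0 < \<alpha>"
    and "admissible_rates c"
    and "condition_L1 c"
    and "condition_R1 L c"
    and "condition_R2 (\<lambda>r. exp (- \<alpha> * r))"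
    and "condition_R3 (\<lambda>r. exp (- \<alpha> * r)) c"
    and "generates c S"
  shows "attractor S = periodic_measures S \<and>
         periodic_measures S = stationary_measures S \<and>
         \<not> weak_symmetry_breaking S \<and>
         \<not> strong_symmetry_breaking S \<and>
         (card (stationary_measures S) = 1 \<longrightarrow> ergodic S)"
proof -
  obtain b v C K where "jump_rates (\<lambda>i \<eta>. c (fst i) \<eta> (snd i)) b v \<alpha> C K L"
    using jump_rates_of_conditions[OF assms(2,3,4,5,7)] by blast
  then interpret jump_rates "\<lambda>i \<eta>. c (fst i) \<eta> (snd i)" b v \<alpha> C K L .
  interpret jump_semigroup "\<lambda>i \<eta>. c (fst i) \<eta> (snd i)" b v \<alpha> C K L S
  proof
    show "markov_semigroup S" using assms(8) by (simp add: generates_def)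
    show "generator_graph (\<lambda>\<Delta> \<eta> \<xi>. c (fst (\<Delta>, \<xi>)) \<eta> (snd (\<Delta>, \<xi>))) \<subseteq> infinitesimal_generator S"
      using assms(8) closure_subset by (simp add: generates_def)
  qed
  \<comment> \<open>The three inclusions close a cycle; the locality of the dynamics enters through
    the first.\<close>
  have "attractor S \<subseteq> stationary_measures S" "stationary_measures S \<subseteq> periodic_measures S"
    "periodic_measures S \<subseteq> attractor S"
    by (rule attractor_subset_stationary stationary_subset_periodic periodic_subset_attractor[OF semigroup])+
  then have "attractor S = periodic_measures S" "periodic_measures S = stationary_measures S" by blast+
  moreover have "ergodic S" if "card (stationary_measures S) = 1"
    using that unique_stationary_ergodic by (auto simp: card_1_singleton_iff)
  ultimately show ?thesis
    by (simp add: weak_symmetry_breaking_def strong_symmetry_breaking_def)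
qed

end
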